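(* Let $\mathbb F_q$ be a finite field, $\mathbb K=\overline{\mathbb F}_q$, and let $X$ be a complete simplicial toric variety of dimension $n$ over $\mathbb K$ with torsion-free class group. Let $Y\subseteq(\mathbb F_q^* )^n$ be a reduced complete intersection subscheme of $X$ such that $I(Y)$ is generated by $n$ homogeneous polynomials with semi-ample degrees $\alpha_1,\dots,\alpha_n$. Then for any $\alpha\in\mathbb N\beta$ we have $$\dim_{\mathbb F_q}(\mathcal C_{\alpha,Y})=\sum_{s=0}^{n}(-1)^s\sum_{I\subseteq\{1,\dots,n\},\,|I|=s}|P_{\alpha-\alpha_I}\cap M|,$$ where $\alpha_I=\sum_{i\in I}\alpha_i$. In particular, if $\alpha\not\succeq\alpha_i$ for all $1\le i\le n$ (i.e. $P_\alpha$ does not contain any of the $P_{\alpha_i}$), then $$\dim_{\mathbb F_q}(\mathcal C_{\alpha,Y})=|P_\alpha\cap M|.$$ Furthermore, if $\alpha\succeq\alpha_1+\dots+\alpha_n$, then the dimension of $\mathcal C_{\alpha,Y}$ equals its length $|Y|$ and, hence, the code is trivial.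
   Context: Let $\Sigma\subset N_{\mathbb R}$ be the fan of $X$, $N$ a lattice of rank $n$ with dual lattice $M$, $v_1,\dots,v_r\in N$ the primitive generators of the rays $\rho_1,\dots,\rho_r$ of $\Sigma$, and $D_1,\dots,D_r$ the corresponding torus-invariant prime Weil divisors. Put $\mathcal A=\mathrm{Cl}(X)$. The homogeneous coordinate ring is $S=\mathbb K[x_1,\dots,x_r]=\bigoplus_{\alpha\in\mathcal A}S_\alpha$, graded by $\deg(x_j)=\beta_j:=[D_j]\in\mathcal A$; "homogeneous" refers to this grading. $\mathbb N\beta\subset\mathcal A$ is the semigroup (with $0$) generated by $\beta_1,\dots,\beta_r$, and $\alpha\preceq\alpha'$ means $\alpha'-\alpha\in\mathbb N\beta$. The irrelevant ideal is $B=\langle\prod_{\rho_i\not\subset\sigma}x_i:\sigma\in\Sigma\rangle$, and $\pi:\mathbb K^r\setminus V(B)\to X$ is the geometric quotient map. Fixing a basis of $M$, the dense torus $\pi((\mathbb K^* )^r)$ of $X$ is identified with $(\mathbb K^* )^n\supset(\mathbb F_q^* )^n$. For a reduced closed subscheme $Y\subset X$, $I(Y)\subset S$ is the unique radical $B$-saturated homogeneous ideal defining $Y$. $Y$ is a complete intersection if $I(Y)$ is generated by a regular sequence of homogeneous polynomials $F_1,\dots,F_k$, $k$ being the codimension of $Y$ in $X$. For $D=\sum_ja_jD_j$ put $P_D=\{m\in M_{\mathbb R}:\langle m,v_j\rangle\ge-a_j,\ 1\le j\le r\}$; up to lattice translation it depends only on $\alpha=[D]$, and $P_\alpha$ denotes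 any such $P_D$. "$P_{\alpha'}$ contains $P_\alpha$" means $P_D\subseteq P_{D'}$ for some torus-invariant $D\in\alpha$, $D'\in\alpha'$. A degree $\alpha$ is semi-ample if it is the class of a Cartier divisor $D$ with $\mathcal O(D)$ generated by global sections. Evaluation code: let $Y=\{p_1,\dots,p_N\}\subset(\mathbb F_q^* )^n$, $\alpha\in\mathbb N\beta$, let $S_\alpha^\Phi\subset S_\alpha$ be the $\mathbb F_q$-space of polynomials in $S_\alpha$ with coefficients in $\mathbb F_q$ (those invariant under the Frobenius), and fix a monomial $F_0\in S_\alpha$. Then $\mathcal C_{\alpha,Y}\subseteq\mathbb F_q^N$ is the image of the map $S_\alpha^\Phi\to\mathbb F_q^N$, $F\mapsto\left(\frac{F(p_1)}{F_0(p_1)},\dots,\frac{F(p_N)}{F_0(p_N)}\right)$, where $F/F_0$ (of degree $0$) is evaluated at homogeneous coordinates of $p_i$. Different choices of $F_0$ give equivalent codes. The code is trivial if it equals $\mathbb F_q^N$, $N=|Y|$. *)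

theory Defs
  imports
    "HOL-Analysis.Analysis"
    "HOL-Algebra.Free_Abelian_Groups"
    "HOL-Algebra.Algebraic_Closure_Type"
    "HOL-Library.Poly_Mapping"
begin

section \<open>Fans\<close>

text \<open>
  Bases of \<open>N\<close> and \<open>M\<close>, dual to each other, are fixed, so that both lattices are
  \<open>int ^ 'n\<close>, with \<open>n = CARD('n)\<close>, and \<open>N\<^sub>\<real> = M\<^sub>\<real> = real ^ 'n\<close>.
\<close>

definition rvec :: "int ^ 'n \<Rightarrow> real ^ 'n" where
  "rvec v = (\<chi> i. real_of_int (v $ i))"

definition pairing :: "int ^ 'n \<Rightarrow> int ^ 'n \<Rightarrow> int" where
  "pairing m v = (\<Sum>i\<in>UNIV. m $ i * v $ i)"

definition rational_cone :: "(real ^ 'n) set \<Rightarrow> bool" where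
  "rational_cone \<sigma> \<longleftrightarrow> (\<exists>S. finite S \<and> \<sigma> = convex_cone hull (rvec ` S))"

definition strongly_convex :: "(real ^ 'n) set \<Rightarrow> bool" where
  "strongly_convex \<sigma> \<longleftrightarrow> \<sigma> \<inter> uminus ` \<sigma> = {0}"

text \<open>The library relation \<^const>\<open>face_of\<close> counts the empty set as a face; the faces of a
  polyhedral cone in the sense of toric geometry are the nonempty ones.\<close>

definition fan :: "(real ^ 'n) set set \<Rightarrow> bool" where
  "fan \<Sigma> \<longleftrightarrow> finite \<Sigma> \<and> \<Sigma> \<noteq> {} \<and>
     (\<forall>\<sigma>\<in>\<Sigma>. rational_cone \<sigma> \<and> strongly_convex \<sigma>) \<and>
     (\<forall>\<sigma>\<in>\<Sigma>. \<forall>\<tau>. \<tau> face_of \<sigma> \<and> \<tau> \<noteq> {} \<longrightarrow> \<tau> \<in> \<Sigma>) \<and>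
     (\<forall>\<sigma>\<in>\<Sigma>. \<forall>\<tau>\<in>\<Sigma>. (\<sigma> \<inter> \<tau>) face_of \<sigma> \<and> (\<sigma> \<inter> \<tau>) face_of \<tau>)"

definition complete_fan :: "(real ^ 'n) set set \<Rightarrow> bool" where
  "complete_fan \<Sigma> \<longleftrightarrow> fan \<Sigma> \<and> \<Union>\<Sigma> = UNIV"

definition simplicial_fan :: "(real ^ 'n) set set \<Rightarrow> bool" where
  "simplicial_fan \<Sigma> \<longleftrightarrow> fan \<Sigma> \<and>
     (\<forall>\<sigma>\<in>\<Sigma>. \<exists>B. finite B \<and> independent B \<and> \<sigma> = convex_cone hull B)"

definition ray :: "int ^ 'n \<Rightarrow> (real ^ 'n) set" where
  "ray v = convex_cone hull {rvec v}"

definition primitive :: "int ^ 'n \<Rightarrow> bool" where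
  "primitive v \<longleftrightarrow> Gcd (range (\<lambda>i. v $ i)) = 1"

definition primitive_ray_generators :: "(real ^ 'n) set set \<Rightarrow> (int ^ 'n) set" where
  "primitive_ray_generators \<Sigma> = {v. primitive v \<and> ray v \<in> \<Sigma>}"

text \<open>From here on \<open>v :: 'r \<Rightarrow> int ^ 'n\<close> enumerates the primitive generators of the rays of the fan
  by a finite index type \<open>'r\<close>, with \<open>r = CARD('r)\<close>.\<close>

definition cone_rays :: "('r \<Rightarrow> int ^ 'n) \<Rightarrow> (real ^ 'n) set \<Rightarrow> 'r set" where
  "cone_rays v \<sigma> = {j. ray (v j) \<subseteq> \<sigma>}"

section \<open>Torus-invariant divisors and the class group\<close>

text \<open>A torus-invariant divisor \<open>\<Sum>j. a\<^sub>j D\<^sub>j\<close> is the element of the free abelian group on \<open>'r\<close> with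
  coefficients \<open>a\<^sub>j\<close>, and \<open>Cl(X)\<close> is the group of these divisors modulo the divisors of characters
  \<open>\<chi>\<^sup>m\<close>. Thus a class is a coset, that is, the set of all torus-invariant divisors in the class.\<close>

abbreviation Divisors :: "('r \<Rightarrow>\<^sub>0 int) monoid" where
  "Divisors \<equiv> free_Abelian_group UNIV"

definition char_divisor :: "('r::finite \<Rightarrow> int ^ 'n) \<Rightarrow> int ^ 'n \<Rightarrow> ('r \<Rightarrow>\<^sub>0 int)" where
  "char_divisor v m = (\<Sum>j\<in>UNIV. Poly_Mapping.single j (pairing m (v j)))"

definition Cl :: "('r::finite \<Rightarrow> int ^ 'n) \<Rightarrow> ('r \<Rightarrow>\<^sub>0 int) set monoid" where
  "Cl v = Divisors Mod range (char_divisor v)"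

definition div_class :: "('r::finite \<Rightarrow> int ^ 'n) \<Rightarrow> ('r \<Rightarrow>\<^sub>0 int) \<Rightarrow> ('r \<Rightarrow>\<^sub>0 int) set" where
  "div_class v D = range (char_divisor v) #>\<^bsub>Divisors\<^esub> D"

definition torsion_free :: "('g, 'm) monoid_scheme \<Rightarrow> bool" where
  "torsion_free G \<longleftrightarrow>
     (\<forall>x\<in>carrier G. \<forall>k>0. x [^]\<^bsub>G\<^esub> (k::nat) = \<one>\<^bsub>G\<^esub> \<longrightarrow> x = \<one>\<^bsub>G\<^esub>)"

definition beta :: "('r::finite \<Rightarrow> int ^ 'n) \<Rightarrow> 'r \<Rightarrow> ('r \<Rightarrow>\<^sub>0 int) set" where
  "beta v j = div_class v (Poly_Mapping.single j 1)"

definition mon_degree :: "('r::finite \<Rightarrow> int ^ 'n) \<Rightarrow> ('r \<Rightarrow>\<^sub>0 nat) \<Rightarrow> ('r \<Rightarrow>\<^sub>0 int) set" where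
  "mon_degree v a = (\<Otimes>\<^bsub>Cl v\<^esub>j\<in>UNIV. beta v j [^]\<^bsub>Cl v\<^esub> (Poly_Mapping.lookup a j))"

text \<open>The semigroup \<open>\<nat>\<beta>\<close>.\<close>

definition Nbeta :: "('r::finite \<Rightarrow> int ^ 'n) \<Rightarrow> ('r \<Rightarrow>\<^sub>0 int) set set" where
  "Nbeta v = range (mon_degree v)"

definition Cl_diff :: "('r::finite \<Rightarrow> int ^ 'n) \<Rightarrow> ('r \<Rightarrow>\<^sub>0 int) set \<Rightarrow> ('r \<Rightarrow>\<^sub>0 int) set
    \<Rightarrow> ('r \<Rightarrow>\<^sub>0 int) set" where
  "Cl_diff v \<alpha> \<alpha>' = \<alpha> \<otimes>\<^bsub>Cl v\<^esub> inv\<^bsub>Cl v\<^esub> \<alpha>'"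

definition Cl_le :: "('r::finite \<Rightarrow> int ^ 'n) \<Rightarrow> ('r \<Rightarrow>\<^sub>0 int) set \<Rightarrow> ('r \<Rightarrow>\<^sub>0 int) set \<Rightarrow> bool" where
  "Cl_le v \<alpha> \<alpha>' \<longleftrightarrow> Cl_diff v \<alpha>' \<alpha> \<in> Nbeta v"

section \<open>Polytopes\<close>

definition lattice_M :: "(real ^ 'n) set" where
  "lattice_M = range rvec"

definition div_polytope :: "('r \<Rightarrow> int ^ 'n) \<Rightarrow> ('r \<Rightarrow>\<^sub>0 int) \<Rightarrow> (real ^ 'n) set" where
  "div_polytope v D = {m. \<forall>j. m \<bullet> rvec (v j) \<ge> - real_of_int (Poly_Mapping.lookup D j)}"

text \<open>\<open>P\<^sub>\<alpha>\<close> is well defined up to lattice translation only; an arbitrary representative is picked.\<close>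

definition class_polytope :: "('r \<Rightarrow> int ^ 'n) \<Rightarrow> ('r \<Rightarrow>\<^sub>0 int) set \<Rightarrow> (real ^ 'n) set" where
  "class_polytope v \<alpha> = div_polytope v (SOME D. D \<in> \<alpha>)"

definition polytope_contains ::
    "('r \<Rightarrow> int ^ 'n) \<Rightarrow> ('r \<Rightarrow>\<^sub>0 int) set \<Rightarrow> ('r \<Rightarrow>\<^sub>0 int) set \<Rightarrow> bool" where
  "polytope_contains v \<alpha>' \<alpha> \<longleftrightarrow> (\<exists>D\<in>\<alpha>. \<exists>D'\<in>\<alpha>'. div_polytope v D \<subseteq> div_polytope v D')"

section \<open>Semi-ample classes\<close>

text \<open>A torus-invariant divisor is Cartier if it is principal on every affine chart \<open>U\<^sub>\<sigma>\<close>. On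
  \<open>U\<^sub>\<sigma>\<close>, a principal torus-invariant divisor is the divisor of a character, and
  only the \<open>D\<^sub>j\<close> with \<open>\<rho>\<^sub>j \<subseteq> \<sigma>\<close> meet \<open>U\<^sub>\<sigma>\<close>.\<close>

definition Cartier :: "(real ^ 'n) set set \<Rightarrow> ('r::finite \<Rightarrow> int ^ 'n) \<Rightarrow> ('r \<Rightarrow>\<^sub>0 int) \<Rightarrow> bool" where
  "Cartier \<Sigma> v D \<longleftrightarrow> (\<forall>\<sigma>\<in>\<Sigma>. \<exists>m. \<forall>j\<in>cone_rays v \<sigma>.
     Poly_Mapping.lookup D j = Poly_Mapping.lookup (char_divisor v m) j)"

text \<open>The coordinate ring \<open>\<bbbK>[M]\<close> of the dense torus is the type \<open>(int ^ 'n) \<Rightarrow>\<^sub>0 'k\<close>. With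
  \<open>J = cone_rays v \<sigma>\<close> the following is the space of sections of \<open>\<O>(D)\<close> over \<open>U\<^sub>\<sigma>\<close>, and with
  \<open>J = UNIV\<close> the space of global sections.\<close>

definition div_sections :: "('r \<Rightarrow> int ^ 'n) \<Rightarrow> 'r set \<Rightarrow> ('r \<Rightarrow>\<^sub>0 int)
    \<Rightarrow> ((int ^ 'n) \<Rightarrow>\<^sub>0 'k::field) set" where
  "div_sections v J D =
     {f. \<forall>m\<in>Poly_Mapping.keys f. \<forall>j\<in>J. pairing m (v j) \<ge> - Poly_Mapping.lookup D j}"

text \<open>\<open>\<O>(D)\<close> is globally generated: over each \<open>U\<^sub>\<sigma>\<close> the global sections generate the module of
  sections of \<open>\<O>(D)\<close> over the ring of regular functions.\<close>

definition globally_generated :: "'k::field itself \<Rightarrow> (real ^ 'n) set set \<Rightarrow>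
    ('r \<Rightarrow> int ^ 'n) \<Rightarrow> ('r \<Rightarrow>\<^sub>0 int) \<Rightarrow> bool" where
  "globally_generated _ \<Sigma> v D \<longleftrightarrow>
     (\<forall>\<sigma>\<in>\<Sigma>. \<forall>f \<in> (div_sections v (cone_rays v \<sigma>) D :: ((int ^ 'n) \<Rightarrow>\<^sub>0 'k) set).
        \<exists>(k::nat) g s. (\<forall>i<k. g i \<in> div_sections v (cone_rays v \<sigma>) 0 \<and> s i \<in> div_sections v UNIV D) \<and>
          f = (\<Sum>i<k. g i * s i))"

text \<open>Being Cartier and globally generated is invariant under linear equivalence, and every divisor
  is linearly equivalent to a torus-invariant one.\<close>

definition semi_ample :: "'k::field itself \<Rightarrow> (real ^ 'n) set set \<Rightarrow>
    ('r::finite \<Rightarrow> int ^ 'n) \<Rightarrow> ('r \<Rightarrow>\<^sub>0 int) set \<Rightarrow> bool" where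
  "semi_ample K \<Sigma> v \<alpha> \<longleftrightarrow> (\<exists>D. \<alpha> = div_class v D \<and> Cartier \<Sigma> v D \<and> globally_generated K \<Sigma> v D)"

section \<open>The homogeneous coordinate ring\<close>

type_synonym ('r, 'k) cox_ring = "('r \<Rightarrow>\<^sub>0 nat) \<Rightarrow>\<^sub>0 'k"

definition poly_eval :: "('r::finite, 'k::field) cox_ring \<Rightarrow> 'k ^ 'r \<Rightarrow> 'k" where
  "poly_eval f x = (\<Sum>a\<in>Poly_Mapping.keys f.
     Poly_Mapping.lookup f a * (\<Prod>j\<in>UNIV. (x $ j) ^ Poly_Mapping.lookup a j))"

definition graded_piece :: "('r::finite \<Rightarrow> int ^ 'n) \<Rightarrow> ('r \<Rightarrow>\<^sub>0 int) set \<Rightarrow> ('r, 'k::field) cox_ring set"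
  where "graded_piece v \<alpha> = {f. \<forall>a\<in>Poly_Mapping.keys f. mon_degree v a = \<alpha>}"

definition homogeneous :: "('r::finite \<Rightarrow> int ^ 'n) \<Rightarrow> ('r, 'k::field) cox_ring \<Rightarrow> bool" where
  "homogeneous v f \<longleftrightarrow> (\<exists>\<alpha>\<in>carrier (Cl v). f \<in> graded_piece v \<alpha>)"

text \<open>Ideals of a commutative ring are the submodules of the ring over itself.\<close>

definition ideal_gen :: "'a::comm_ring_1 set \<Rightarrow> 'a set" where
  "ideal_gen A = Modules.module.span (*) A"

definition is_ideal :: "'a::comm_ring_1 set \<Rightarrow> bool" where
  "is_ideal I \<longleftrightarrow> Modules.module.subspace (*) I"

definition ideal_power :: "'a::comm_ring_1 set \<Rightarrow> nat \<Rightarrow> 'a set" where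
  "ideal_power I k = ideal_gen {\<Prod>i<k. b i | b. \<forall>i<k. b i \<in> I}"

definition radical_ideal :: "'a::comm_ring_1 set \<Rightarrow> bool" where
  "radical_ideal I \<longleftrightarrow> is_ideal I \<and> (\<forall>f k. f ^ k \<in> I \<longrightarrow> f \<in> I)"

definition homogeneous_ideal :: "('r::finite \<Rightarrow> int ^ 'n) \<Rightarrow> ('r, 'k::field) cox_ring set \<Rightarrow> bool" where
  "homogeneous_ideal v I \<longleftrightarrow> is_ideal I \<and> I = ideal_gen {f \<in> I. homogeneous v f}"

definition saturated :: "'a::comm_ring_1 set \<Rightarrow> 'a set \<Rightarrow> bool" where
  "saturated B I \<longleftrightarrow> (\<forall>f k. (\<forall>g\<in>ideal_power B k. f * g \<in> I) \<longrightarrow> f \<in> I)"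

definition regular_sequence :: "nat \<Rightarrow> (nat \<Rightarrow> 'a::comm_ring_1) \<Rightarrow> bool" where
  "regular_sequence k F \<longleftrightarrow>
     (\<forall>i\<in>{1..k}. \<forall>g. g * F i \<in> ideal_gen (F ` {1..<i}) \<longrightarrow> g \<in> ideal_gen (F ` {1..<i})) \<and>
     ideal_gen (F ` {1..k}) \<noteq> UNIV"

definition irrelevant_ideal :: "(real ^ 'n) set set \<Rightarrow> ('r::finite \<Rightarrow> int ^ 'n) \<Rightarrow>
    ('r, 'k::field) cox_ring set" where
  "irrelevant_ideal \<Sigma> v = ideal_gen ((\<lambda>\<sigma>.
     \<Prod>j\<in>{j. \<not> ray (v j) \<subseteq> \<sigma>}. Poly_Mapping.single (Poly_Mapping.single j 1) 1) ` \<Sigma>)"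

definition zero_set :: "('r::finite, 'k::field) cox_ring set \<Rightarrow> ('k ^ 'r) set" where
  "zero_set I = {x. \<forall>f\<in>I. poly_eval f x = 0}"

section \<open>The toric variety and its subvarieties\<close>

text \<open>The group \<open>Hom(Cl(X), \<bbbK>\<^sup>*)\<close>, embedded in \<open>(\<bbbK>\<^sup>*)\<^sup>r\<close> by \<open>g \<mapsto> (g(\<beta>\<^sub>1), \<dots>, g(\<beta>\<^sub>r))\<close>.\<close>

definition cox_group :: "('r::finite \<Rightarrow> int ^ 'n) \<Rightarrow> ('k::field ^ 'r) set" where
  "cox_group v = {g. (\<forall>j. g $ j \<noteq> 0) \<and> (\<forall>m. (\<Prod>j\<in>UNIV. (g $ j) powi pairing m (v j)) = 1)}"

text \<open>The points of \<open>X\<close> are the orbits of this group on \<open>\<bbbK>\<^sup>r - V(B)\<close>, and \<open>\<pi>\<close> sends a point to its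
  orbit.\<close>

definition cox_quotient :: "('r::finite \<Rightarrow> int ^ 'n) \<Rightarrow> 'k::field ^ 'r \<Rightarrow> ('k ^ 'r) set" where
  "cox_quotient v x = {\<chi> j. g $ j * x $ j | g. g \<in> cox_group v}"

definition toric_variety :: "(real ^ 'n) set set \<Rightarrow> ('r::finite \<Rightarrow> int ^ 'n) \<Rightarrow> ('k::field ^ 'r) set set"
  where "toric_variety \<Sigma> v = cox_quotient v ` (- zero_set (irrelevant_ideal \<Sigma> v))"

text \<open>The point \<open>t \<in> (\<bbbK>\<^sup>*)\<^sup>n\<close> of the dense torus, as a point of \<open>X\<close>: the orbit consisting of all
  \<open>x \<in> (\<bbbK>\<^sup>*)\<^sup>r\<close> at which the \<open>i\<close>-th basis character \<open>\<Prod>j. x\<^sub>j\<^bsup>\<langle>e\<^sub>i,v\<^sub>j\<rangle>\<^esup>\<close> takes the value \<open>t\<^sub>i\<close>.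
  Its elements are the homogeneous coordinates of the point.\<close>

definition torus_point :: "('r::finite \<Rightarrow> int ^ 'n) \<Rightarrow> 'k::field ^ 'n \<Rightarrow> ('k ^ 'r) set" where
  "torus_point v t =
     {x. (\<forall>j. x $ j \<noteq> 0) \<and> (\<forall>i. (\<Prod>j\<in>UNIV. (x $ j) powi (v j $ i)) = t $ i)}"

definition subvariety :: "(real ^ 'n) set set \<Rightarrow> ('r::finite \<Rightarrow> int ^ 'n) \<Rightarrow>
    ('r, 'k::field) cox_ring set \<Rightarrow> ('k ^ 'r) set set" where
  "subvariety \<Sigma> v I = {p \<in> toric_variety \<Sigma> v. p \<subseteq> zero_set I}"

text \<open>\<open>I = I(Y)\<close>. A reduced closed subscheme is identified with its set of closed points.\<close>

definition is_ideal_of :: "(real ^ 'n) set set \<Rightarrow> ('r::finite \<Rightarrow> int ^ 'n) \<Rightarrow>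
    ('k::field ^ 'r) set set \<Rightarrow> ('r, 'k) cox_ring set \<Rightarrow> bool" where
  "is_ideal_of \<Sigma> v Y I \<longleftrightarrow> radical_ideal I \<and> saturated (irrelevant_ideal \<Sigma> v) I \<and>
     homogeneous_ideal v I \<and> subvariety \<Sigma> v I = Y"

text \<open>Complete intersections, for finite sets \<open>Y\<close> of closed points only: their codimension in \<open>X\<close>
  is \<open>n = CARD('n)\<close>. The set is nonempty, as a regular sequence generates a proper ideal.\<close>

definition complete_intersection_points :: "(real ^ 'n) set set \<Rightarrow> ('r::finite \<Rightarrow> int ^ 'n) \<Rightarrow>
    ('k::field ^ 'r) set set \<Rightarrow> bool" where
  "complete_intersection_points \<Sigma> v Y \<longleftrightarrow> finite Y \<and>
     (\<exists>F. regular_sequence CARD('n) F \<and> (\<forall>i\<in>{1..CARD('n)}. homogeneous v (F i)) \<and>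
          is_ideal_of \<Sigma> v Y (ideal_gen (F ` {1..CARD('n)})))"

section \<open>Evaluation codes\<close>

definition alg_closure_point :: "'q::field ^ 'n \<Rightarrow> 'q alg_closure ^ 'n" where
  "alg_closure_point t = (\<chi> i. to_ac (t $ i))"

text \<open>The set \<open>Y = range p\<close> of points of \<open>(\<bbbF>\<^sub>q\<^sup>*)\<^sup>n\<close>, as a set of points of \<open>X\<close>.\<close>

definition points_in_X :: "('r::finite \<Rightarrow> int ^ 'n) \<Rightarrow> ('s \<Rightarrow> 'q::field ^ 'n) \<Rightarrow>
    ('q alg_closure ^ 'r) set set" where
  "points_in_X v p = range (\<lambda>s. torus_point v (alg_closure_point (p s)))"

definition frobenius_piece :: "('r::finite \<Rightarrow> int ^ 'n) \<Rightarrow> ('r \<Rightarrow>\<^sub>0 int) set \<Rightarrow>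
    ('r, 'q::field alg_closure) cox_ring set" where
  "frobenius_piece v \<alpha> = {F \<in> graded_piece v \<alpha>. \<forall>a. Poly_Mapping.lookup F a \<in> range to_ac}"

text \<open>The points \<open>p\<^sub>1, \<dots>, p\<^sub>N\<close> are enumerated by a finite index type \<open>'s\<close>, with \<open>N = CARD('s)\<close>. The
  quotient \<open>F(x) / F\<^sub>0(x)\<close> lies in the image of \<open>\<bbbF>\<^sub>q\<close> and does not depend on the choice of
  homogeneous coordinates \<open>x\<close>.\<close>

definition evaluation_code :: "('r::finite \<Rightarrow> int ^ 'n) \<Rightarrow> ('s::finite \<Rightarrow> 'q::field ^ 'n) \<Rightarrow>
    ('r \<Rightarrow>\<^sub>0 int) set \<Rightarrow> ('r, 'q alg_closure) cox_ring \<Rightarrow> ('q ^ 's) set" where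
  "evaluation_code v p \<alpha> F\<^sub>0 = {c. \<exists>F\<in>frobenius_piece v \<alpha>.
     \<forall>s. \<forall>x\<in>torus_point v (alg_closure_point (p s)). to_ac (c $ s) = poly_eval F x / poly_eval F\<^sub>0 x}"

end

theory Submission
  imports Defs
begin

text \<open>
  Monomials of degree \<open>\<alpha>\<close> restrict to characters on the torus, so the code is spanned by vectors of
  values of characters, and its dimension is \<open>dim S\<^sub>\<alpha> - dim I(Y)\<^sub>\<alpha>\<close> because \<open>I(Y)\<close> is the full
  vanishing ideal of \<open>Y\<close> (Nullstellensatz). Since \<open>I(Y)\<close> is generated by a homogeneous regular
  sequence, this is the alternating sum over the degrees of that sequence; by Nakayama's lemma they are
  the \<open>\<alpha>\<^sub>i\<close> up to order.

  No \<open>x\<^sub>j\<close> vanishes at a point of \<open>Y\<close>, so the dimension grows with \<open>\<alpha>\<close>, and for the last claim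
  \<open>\<alpha> = \<alpha>\<^sub>1 + \<dots> + \<alpha>\<^sub>n\<close> suffices. The dimension is the same for all positive multiples of this class:
  the difference of the two alternating sums is an \<open>(n+1)\<close>-fold mixed difference of the number of lattice
  points of nef polytopes, and it vanishes because the exponential sum over such a polytope is a signed sum
  over cones, each with a pole of order at most \<open>n\<close>. The polytope of a large multiple contains a
  translate of any finite set of characters, and the characters separate the points of \<open>Y\<close>.
\<close>

hide_const (open) up_ring.coeff up_ring.monom module.smult Polynomials.lead_coeff Polynomials.degree ring.coeff ring.monom
unbundle no fps_syntax

section \<open>Polynomials and Hilbert's Nullstellensatz\<close>

text \<open>The alternating sum is available only for a regular sequence, but the generators with
  the semi-ample degrees \<alpha>_i are not assumed to be one; the definition of a complete
  intersection supplies another system. Hence the comparison of degrees. For the sum G of the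
  \<alpha>_i, the class kG - \<alpha>_I is (k-1)G plus the \<alpha>_i with i outside I. So for k
  \<ge> 1 every class in the formula for kG is nef, and comparing k with 1 involves exactly n+1 nef
  classes: (k-1)G and the \<alpha>_i. Polynomiality of the number of lattice points is not
  established; points are weighted by exp(-s <m,l>) instead, and s tends to 0. Nef polytopes may
  have smaller dimension and coinciding vertices, so vertices are indexed by maximal cones, for
  which the signed decomposition still holds. Large multiples of G absorb all characters only if the
  polytope of G is full-dimensional. No such assumption is made: it follows from Y being contained
  in the torus.\<close>

lemma poly_mapping_expand: "f = (\<Sum>a\<in>Poly_Mapping.keys f. Poly_Mapping.single a (Poly_Mapping.lookup f a))"
  by (rule poly_mapping_eqI)
    (simp add: lookup_sum lookup_single when_def in_keys_iff sum.delta' split: if_splits)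

lemma poly_mapping_sum_induct [case_names zero add single]:
  assumes "P 0" "\<And>f g. P f \<Longrightarrow> P g \<Longrightarrow> P (f + g)" "\<And>a c. P (Poly_Mapping.single a c)"
  shows "P (f :: 'a \<Rightarrow>\<^sub>0 'b::comm_monoid_add)"
proof -
  have "P (\<Sum>a\<in>A. Poly_Mapping.single a (Poly_Mapping.lookup f a))" if "finite A" for A
    using that by induction (auto intro: assms)
  from this[of "Poly_Mapping.keys f"] show ?thesis
    using poly_mapping_expand[of f] by simp
qed

definition mon_eval :: "('r::finite \<Rightarrow>\<^sub>0 nat) \<Rightarrow> 'k::field ^ 'r \<Rightarrow> 'k" where
  "mon_eval a x = (\<Prod>j\<in>UNIV. (x $ j) ^ Poly_Mapping.lookup a j)"

lemma mon_eval_0 [simp]: "mon_eval 0 x = 1"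
  by (simp add: mon_eval_def)

lemma mon_eval_at_0:
  assumes "a \<noteq> 0"
  shows "mon_eval a 0 = 0"
proof -
  obtain j where "Poly_Mapping.lookup a j \<noteq> 0" using assms by (metis lookup_zero poly_mapping_eqI)
  then show ?thesis
    unfolding mon_eval_def by (intro prod_zero) (auto intro!: bexI[of _ j] simp: zero_power)
qed

lemma mon_eval_add: "mon_eval (a + b) x = mon_eval a x * mon_eval b x"
  by (simp add: mon_eval_def lookup_add power_add prod.distrib)

text \<open>\<open>poly_eval\<close> sums over the support, which can shrink under addition by
  cancellation; values become comparable as sums over a common index set.\<close>

lemma poly_eval_superset:
  assumes "finite A" "Poly_Mapping.keys f \<subseteq> A"
  shows "poly_eval f x = (\<Sum>a\<in>A. Poly_Mapping.lookup f a * mon_eval a x)"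
  unfolding poly_eval_def mon_eval_def using assms
  by (intro sum.mono_neutral_left) (auto simp: in_keys_iff)

lemma poly_eval_0 [simp]: "poly_eval 0 x = 0"
  by (simp add: poly_eval_def)

lemma poly_eval_single [simp]: "poly_eval (Poly_Mapping.single a c) x = c * mon_eval a x"
  by (subst poly_eval_superset[of "{a}"]) auto

lemma poly_eval_add [simp]: "poly_eval (f + g) x = poly_eval f x + poly_eval g x"
proof -
  let ?A = "Poly_Mapping.keys f \<union> Poly_Mapping.keys g"
  have "Poly_Mapping.keys (f + g) \<subseteq> ?A" by (rule keys_add)
  then show ?thesis
    by (simp add: poly_eval_superset[of ?A] lookup_add sum.distrib algebra_simps)
qed

lemma poly_eval_mult [simp]: "poly_eval (f * g) x = poly_eval f x * poly_eval g x"
proof (induction f rule: poly_mapping_sum_induct)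
  case (single a c)
  show ?case
    by (induction g rule: poly_mapping_sum_induct)
      (auto simp: algebra_simps mult_single mon_eval_add)
qed (auto simp: algebra_simps)

lemma poly_eval_1 [simp]: "poly_eval 1 x = 1"
  by (simp flip: single_one)

lemma poly_eval_uminus [simp]: "poly_eval (- f) x = - poly_eval f x"
  by (metis add.right_inverse add_eq_0_iff poly_eval_0 poly_eval_add)

lemma poly_eval_diff [simp]: "poly_eval (f - g) x = poly_eval f x - poly_eval g x"
  by (metis add_uminus_conv_diff poly_eval_add poly_eval_uminus)

lemma poly_eval_sum [simp]: "poly_eval (sum f A) x = (\<Sum>a\<in>A. poly_eval (f a) x)"
  by (induction A rule: infinite_finite_induct) auto

lemma poly_eval_power [simp]: "poly_eval (f ^ n) x = poly_eval f x ^ n"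
  by (induction n) auto

lemma poly_eval_prod [simp]: "poly_eval (prod f A) x = (\<Prod>a\<in>A. poly_eval (f a) x)"
  by (induction A rule: infinite_finite_induct) auto

definition cox_var :: "'r \<Rightarrow> ('r, 'k::field) cox_ring" where
  "cox_var j = Poly_Mapping.single (Poly_Mapping.single j 1) 1"

lemma mon_eval_single: "mon_eval (Poly_Mapping.single j n) x = x $ j ^ n"
proof -
  have "mon_eval (Poly_Mapping.single j n) x = (\<Prod>i\<in>UNIV. if i = j then x $ j ^ n else 1)"
    unfolding mon_eval_def by (rule prod.cong) (auto simp: lookup_single when_def)
  then show ?thesis by simp
qed

lemma poly_eval_cox_var [simp]: "poly_eval (cox_var j) x = x $ j"
  by (simp add: cox_var_def mon_eval_single)

lemma cox_var_power: "cox_var j ^ n = Poly_Mapping.single (Poly_Mapping.single j n) 1"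
  by (induction n) (auto simp: cox_var_def mult_single simp flip: single_add)

section \<open>Division and elimination modulo a prime ideal\<close>

locale comm_subring =
  fixes R :: "'a::comm_ring_1 set"
  assumes one_mem: "1 \<in> R"
    and add_mem: "\<And>x y. x \<in> R \<Longrightarrow> y \<in> R \<Longrightarrow> x + y \<in> R"
    and mult_mem: "\<And>x y. x \<in> R \<Longrightarrow> y \<in> R \<Longrightarrow> x * y \<in> R"
    and uminus_mem: "\<And>x. x \<in> R \<Longrightarrow> - x \<in> R"
begin

lemma zero_mem: "0 \<in> R"
  using add_mem[OF one_mem uminus_mem[OF one_mem]] by simp

lemma diff_mem: "x \<in> R \<Longrightarrow> y \<in> R \<Longrightarrow> x - y \<in> R"
  using add_mem[of x "- y"] uminus_mem by simp

lemma sum_mem: "(\<And>i. i \<in> A \<Longrightarrow> f i \<in> R) \<Longrightarrow> sum f A \<in> R"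
  by (induction A rule: infinite_finite_induct) (auto simp: zero_mem add_mem)

lemma power_mem: "x \<in> R \<Longrightarrow> x ^ n \<in> R"
  by (induction n) (auto simp: one_mem mult_mem)

definition polys :: "'a poly set" where
  "polys = {p. \<forall>i. coeff p i \<in> R}"

lemma polys_add: "p \<in> polys \<Longrightarrow> q \<in> polys \<Longrightarrow> p + q \<in> polys"
  by (simp add: polys_def add_mem)

lemma polys_diff: "p \<in> polys \<Longrightarrow> q \<in> polys \<Longrightarrow> p - q \<in> polys"
  by (simp add: polys_def diff_mem)

lemma polys_mult: "p \<in> polys \<Longrightarrow> q \<in> polys \<Longrightarrow> p * q \<in> polys"
  by (auto simp: polys_def coeff_mult intro!: sum_mem mult_mem)

lemma polys_smult: "c \<in> R \<Longrightarrow> q \<in> polys \<Longrightarrow> smult c q \<in> polys"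
  by (auto simp: polys_def intro!: mult_mem)

lemma polys_monom: "c \<in> R \<Longrightarrow> monom c n \<in> polys"
  by (auto simp: polys_def zero_mem)

lemma polys_0: "0 \<in> polys" and polys_1: "1 \<in> polys"
  by (auto simp: polys_def zero_mem one_mem coeff_1)

text \<open>Division with remainder when the leading coefficient is not a unit: each lowering of the
  degree costs one factor of it. The remainder is bounded through its coefficients, so that degree 0
  of \<open>p\<close> forces \<open>b = 0\<close>.\<close>

lemma pseudo_division:
  assumes p: "p \<in> polys" and q: "q \<in> polys"
  shows "\<exists>e. \<exists>a\<in>polys. \<exists>b\<in>polys. smult (lead_coeff p ^ e) q = a * p + b \<and>
           (\<forall>i\<ge>degree p. coeff b i = 0)"
proof -
  let ?l = "lead_coeff p" and ?d = "degree p"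
  have l: "?l \<in> R" using p by (simp add: polys_def)
  have "q \<in> polys \<Longrightarrow> (\<forall>i\<ge>n. coeff q i = 0) \<Longrightarrow> \<exists>e. \<exists>a\<in>polys. \<exists>b\<in>polys.
      smult (?l ^ e) q = a * p + b \<and> (\<forall>i\<ge>?d. coeff b i = 0)" for n q
  proof (induction n arbitrary: q)
    case 0
    then show ?case by (intro exI[of _ 0] bexI[of _ 0] bexI[of _ q]) (auto simp: polys_0)
  next
    case (Suc m)
    show ?case
    proof (cases "Suc m \<le> ?d")
      case True
      then show ?thesis using Suc.prems
        by (intro exI[of _ 0] bexI[of _ 0] bexI[of _ q]) (auto simp: polys_0)
    next
      case False
      let ?c = "coeff q m"
      let ?m = "monom ?c (m - ?d)"
      let ?q = "smult ?l q - ?m * p"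
      have c: "?c \<in> R" using Suc.prems by (simp add: polys_def)
      have "?q \<in> polys"
        by (intro polys_diff polys_smult polys_mult polys_monom l c p Suc.prems)
      moreover have "coeff ?q i = 0" if "i \<ge> m" for i
      proof (cases "i = m")
        case True
        then show ?thesis using False by (simp add: coeff_monom_mult)
      next
        case ne: False
        then have "coeff q i = 0" using Suc.prems that by simp
        moreover have "coeff p (i - (m - ?d)) = 0"
          using False ne that by (intro coeff_eq_0) auto
        ultimately show ?thesis using that by (simp add: coeff_monom_mult)
      qed
      ultimately obtain e a b where *: "a \<in> polys" "b \<in> polys"
        "smult (?l ^ e) ?q = a * p + b" "\<forall>i\<ge>?d. coeff b i = 0"
        using Suc.IH by blast
      have "smult (?l ^ Suc e) q = (a + smult (?l ^ e) ?m) * p + b"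
        using *(3) by (simp add: smult_diff_right algebra_simps)
      then show ?thesis using * l c
        by (intro exI[of _ "Suc e"] bexI[of _ "a + smult (?l ^ e) ?m"] bexI[of _ b])
          (auto intro!: polys_add polys_smult polys_monom power_mem)
    qed
  qed
  from this[of q "Suc (degree q)"] q show ?thesis by (auto simp: coeff_eq_0)
qed

end

text \<open>The quotient domain is never formed: equality in it is membership of the difference in
  \<open>P\<close>, and \<open>zero_poly\<close> is vanishing of a polynomial over it.\<close>

locale prime_ideal_set =
  fixes P :: "'a::comm_ring_1 set"
  assumes P_add: "\<And>x y. x \<in> P \<Longrightarrow> y \<in> P \<Longrightarrow> x + y \<in> P"
    and P_mult: "\<And>x y. y \<in> P \<Longrightarrow> x * y \<in> P"
    and P_one: "1 \<notin> P"
    and P_zero: "0 \<in> P"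
    and P_prime: "\<And>x y. x * y \<in> P \<Longrightarrow> x \<in> P \<or> y \<in> P"
begin

lemma P_uminus: "x \<in> P \<Longrightarrow> - x \<in> P"
  using P_mult[of x "-1"] by simp

lemma P_diff: "x \<in> P \<Longrightarrow> y \<in> P \<Longrightarrow> x - y \<in> P"
  using P_add[of x "- y"] P_uminus by simp

lemma P_mult': "x \<in> P \<Longrightarrow> x * y \<in> P"
  using P_mult[of x y] by (simp add: mult.commute)

lemma P_sum: "(\<And>i. i \<in> A \<Longrightarrow> f i \<in> P) \<Longrightarrow> sum f A \<in> P"
  by (induction A rule: infinite_finite_induct) (auto simp: P_zero P_add)

lemma P_power: "x ^ n \<in> P \<Longrightarrow> x \<in> P"
  by (induction n) (use P_one P_prime in auto)

lemma P_cong: "x - y \<in> P \<Longrightarrow> x \<in> P \<longleftrightarrow> y \<in> P"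
  using P_add[of "x - y" y] P_diff[of x "x - y"] by auto

definition zero_poly :: "'a poly \<Rightarrow> bool" where
  "zero_poly p \<longleftrightarrow> (\<forall>i. coeff p i \<in> P)"

lemma zero_poly_mult: "zero_poly p \<Longrightarrow> zero_poly (p * q)"
  by (auto simp: zero_poly_def coeff_mult intro!: P_sum P_mult')

lemma zero_poly_add: "zero_poly p \<Longrightarrow> zero_poly q \<Longrightarrow> zero_poly (p + q)"
  by (auto simp: zero_poly_def P_add)

lemma zero_poly_poly: "zero_poly p \<Longrightarrow> poly p y \<in> P"
  by (auto simp: zero_poly_def poly_altdef intro!: P_sum P_mult')

end

text \<open>Models the image of \<open>R\<close> in the quotient by \<open>P\<close>, together with
  one more element \<open>y\<close>. In the application \<open>R\<close> consists of the polynomials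
  in some of the variables, and \<open>y\<close> is a further variable.\<close>

locale prime_over_subring = prime_ideal_set P + comm_subring R
  for P R :: "'a::comm_ring_1 set" +
  fixes y :: 'a
begin

text \<open>The degree modulo \<open>P\<close> can be smaller than the degree, because leading
  coefficients may lie in \<open>P\<close>. Cutting off everything above the last coefficient
  outside \<open>P\<close> makes the two agree without changing the class. The last conclusion
  bounds the new degree through the coefficients of \<open>b\<close>.\<close>

lemma trim:
  assumes b: "b \<in> polys" "\<not> zero_poly b"
  obtains b' where "b' \<in> polys" "lead_coeff b' \<notin> P" "zero_poly (b - b')"
    "poly b y - poly b' y \<in> P" "coeff b (degree b') \<notin> P"
proof -
  let ?S = "{i. coeff b i \<notin> P}"
  have sub: "?S \<subseteq> {..degree b}"
    using P_zero by (auto intro: le_degree)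
  then have fin: "finite ?S" using finite_subset by blast
  have ne: "?S \<noteq> {}" using b by (auto simp: zero_poly_def)
  define k where "k = Max ?S"
  have k: "coeff b k \<notin> P" using Max_in[OF fin ne] by (simp add: k_def)
  have kmax: "coeff b i \<in> P" if "i > k" for i
    using Max_ge[OF fin, of i] that unfolding k_def by force
  define b' where "b' = poly_cutoff (Suc k) b"
  have c: "coeff b' i = (if i \<le> k then coeff b i else 0)" for i
    by (simp add: b'_def coeff_poly_cutoff less_Suc_eq_le)
  have deg: "degree b' = k"
    using k P_zero by (intro antisym degree_le le_degree) (auto simp: c)
  have z: "zero_poly (b - b')"
    by (auto simp: zero_poly_def c kmax P_zero)
  show thesis
  proof
    show "b' \<in> polys" using b by (auto simp: polys_def c zero_mem)
    show "lead_coeff b' \<notin> P" "coeff b (degree b') \<notin> P" using k by (auto simp: deg c)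
    show "zero_poly (b - b')" by fact
    show "poly b y - poly b' y \<in> P" using zero_poly_poly[OF z, of y] by simp
  qed
qed

text \<open>Here \<open>y\<close> is algebraic modulo \<open>P\<close>. Up to denominators,
  \<open>p\<close> is its minimal polynomial, and the nonzero element \<open>poly q y\<close> has
  the inverse \<open>poly s y\<close>, with denominator \<open>c\<close>. Fractions are avoided by
  minimal-degree arguments with pseudo-division.\<close>

lemma algebraic_case:
  assumes p0: "p0 \<in> polys" "poly p0 y \<in> P" "\<not> zero_poly p0"
    and q: "q \<in> polys" "poly q y \<notin> P"
  obtains p s c where "p \<in> polys" "lead_coeff p \<notin> P" "degree p \<noteq> 0" "poly p y \<in> P"
    "s \<in> polys" "c \<in> R" "c \<notin> P" "c - poly s y * poly q y \<in> P"
    "\<And>h. h \<in> polys \<Longrightarrow> poly h y \<in> P \<Longrightarrow> \<exists>e. \<exists>a\<in>polys. \<exists>b\<in>polys.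
       smult (lead_coeff p ^ e) h = a * p + b \<and> zero_poly b"
proof -
  define good where "good p \<longleftrightarrow> p \<in> polys \<and> poly p y \<in> P \<and> lead_coeff p \<notin> P" for p
  obtain p' where "good p'"
    using trim[OF p0(1,3)] P_cong p0(2) unfolding good_def by metis
  then obtain p where p: "good p" and pmin: "\<And>p'. good p' \<Longrightarrow> degree p \<le> degree p'"
    using ex_has_least_nat[of good p' degree] by blast
  let ?d = "degree p" and ?l = "lead_coeff p"
  have pR: "p \<in> polys" and py: "poly p y \<in> P" and lP: "?l \<notin> P" using p by (auto simp: good_def)
  have lR: "?l \<in> R" using pR by (simp add: polys_def)
  have factA: "zero_poly b" if "b \<in> polys" "poly b y \<in> P" "\<forall>i\<ge>?d. coeff b i = 0" for b
  proof (rule ccontr)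
    assume "\<not> zero_poly b"
    from trim[OF that(1) this] obtain b' where b': "b' \<in> polys" "lead_coeff b' \<notin> P"
      "poly b y - poly b' y \<in> P" "coeff b (degree b') \<notin> P" by metis
    then have "good b'" using that P_cong by (auto simp: good_def)
    from pmin[OF this] that(3) b'(4) P_zero show False by metis
  qed
  have d0: "?d \<noteq> 0"
  proof
    assume "?d = 0"
    then have "poly p y = ?l" by (simp add: poly_altdef)
    then show False using py lP by simp
  qed
  have red: "\<exists>e. \<exists>a\<in>polys. \<exists>b\<in>polys. smult (?l ^ e) h = a * p + b \<and> zero_poly b"
    if h: "h \<in> polys" "poly h y \<in> P" for h
  proof -
    obtain e a b where *: "a \<in> polys" "b \<in> polys" "smult (?l ^ e) h = a * p + b"
      "\<forall>i\<ge>?d. coeff b i = 0" using pseudo_division[OF pR h(1)] by blast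
    have "poly b y = ?l ^ e * poly h y - poly a y * poly p y"
      using arg_cong[OF *(3), of "\<lambda>p. poly p y"] by simp
    then have "poly b y \<in> P" using h(2) py by (simp add: P_diff P_mult)
    then show ?thesis using * factA by blast
  qed
  \<comment> \<open>The multiples of \<open>poly q y\<close> that are nonzero modulo
    \<open>P\<close>, written as polynomials in \<open>y\<close>. One of least degree will turn out
    to be constant, which provides \<open>c\<close> and the cofactor \<open>s\<close>.\<close>
  define U where "U u \<longleftrightarrow> u \<in> polys \<and> lead_coeff u \<notin> P \<and> poly u y \<notin> P \<and>
    (\<exists>s\<in>polys. poly u y - poly s y * poly q y \<in> P)" for u
  have U_trim: "\<exists>u'. U u' \<and> coeff u (degree u') \<notin> P"
    if "u \<in> polys" "poly u y \<notin> P" "s \<in> polys" "poly u y - poly s y * poly q y \<in> P" for u s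
  proof -
    have "\<not> zero_poly u" using that zero_poly_poly by blast
    from trim[OF that(1) this] obtain b' where b': "b' \<in> polys" "lead_coeff b' \<notin> P"
      "poly u y - poly b' y \<in> P" "coeff u (degree b') \<notin> P" by metis
    have "poly b' y - poly s y * poly q y \<in> P"
      using P_diff[OF that(4) b'(3)] by (simp add: algebra_simps)
    then show ?thesis using b' that P_cong unfolding U_def by blast
  qed
  obtain u0 where "U u0" using U_trim[OF q polys_1] P_zero by auto
  then obtain u where u: "U u" and umin: "\<And>u'. U u' \<Longrightarrow> degree u \<le> degree u'"
    using ex_has_least_nat[of U u0 degree] by blast
  obtain s where uR: "u \<in> polys" and luP: "lead_coeff u \<notin> P" and uy: "poly u y \<notin> P"
    and s: "s \<in> polys" "poly u y - poly s y * poly q y \<in> P"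
    using u by (auto simp: U_def)
  have luR: "lead_coeff u \<in> R" using uR by (simp add: polys_def)
  have "degree u = 0"
  proof (rule ccontr)
    assume du: "degree u \<noteq> 0"
    have small: False if H: "a \<in> polys" "b \<in> polys" "smult c u = a * p + b" "\<forall>i\<ge>degree u. coeff b i = 0"
      "c \<in> R" "c \<notin> P" for a b c
    proof -
      have bc: "poly b y = c * poly u y - poly a y * poly p y"
        using arg_cong[OF H(3), of "\<lambda>p. poly p y"] by simp
      then have "poly b y - c * poly u y \<in> P" using py P_uminus[OF P_mult] by simp
      then have "poly b y \<notin> P" using P_cong uy H(6) P_prime by blast
      moreover have "poly b y - poly (smult c s) y * poly q y \<in> P"
        using P_diff[OF P_mult[OF s(2), of c] P_mult[OF py, of "poly a y"]]
        by (simp add: bc algebra_simps)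
      ultimately obtain u' where "U u'" "coeff b (degree u') \<notin> P"
        using U_trim H(2,5) polys_smult[OF _ s(1)] by blast
      then show False using umin H(4) P_zero by metis
    qed
    have dud: "degree u < ?d"
    proof (rule ccontr)
      assume "\<not> degree u < ?d"
      moreover obtain e a b where "a \<in> polys" "b \<in> polys" "smult (?l ^ e) u = a * p + b"
        "\<forall>i\<ge>?d. coeff b i = 0" using pseudo_division[OF pR uR] by blast
      ultimately show False using small[of a b "?l ^ e"] lP lR power_mem P_power by force
    qed
    \<comment> \<open>Since \<open>p\<close> vanishes at \<open>y\<close>, the remainder is a
      multiple of \<open>poly q y\<close> of smaller degree than \<open>u\<close>, so it vanishes
      modulo \<open>P\<close>. Then \<open>u\<close> divides \<open>p\<close>, and the cofactor
      vanishes at \<open>y\<close>; as \<open>u\<close> is not constant, that cofactor has too small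
      a degree to be nonzero.\<close>
    obtain e a b where *: "a \<in> polys" "b \<in> polys" "smult (lead_coeff u ^ e) p = a * u + b"
      "\<forall>i\<ge>degree u. coeff b i = 0" using pseudo_division[OF uR pR] by blast
    have bc: "poly b y = lead_coeff u ^ e * poly p y - poly a y * poly u y"
      using arg_cong[OF *(3), of "\<lambda>p. poly p y"] by simp
    have "poly b y \<in> P"
    proof (rule ccontr)
      assume "poly b y \<notin> P"
      moreover have "poly b y - poly (- a * s) y * poly q y \<in> P"
        using P_diff[OF P_mult[OF py, of "lead_coeff u ^ e"] P_mult[OF s(2), of "poly a y"]]
        by (simp add: bc algebra_simps)
      moreover have "- a * s \<in> polys"
        using polys_mult[OF polys_diff[OF polys_0 *(1)] s(1)] by simp
      ultimately obtain u' where "U u'" "coeff b (degree u') \<notin> P"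
        using U_trim *(2) by blast
      then show False using umin *(4) P_zero by metis
    qed
    then have zb: "zero_poly b" using factA *(2,4) dud by simp
    have "poly a y * poly u y \<in> P"
      using P_diff[OF P_mult[OF py] \<open>poly b y \<in> P\<close>, of "lead_coeff u ^ e"] by (simp add: bc)
    then have ay: "poly a y \<in> P" using uy P_prime by blast
    have za: "zero_poly a"
    proof (rule ccontr)
      assume "\<not> zero_poly a"
      from trim[OF *(1) this] obtain a' where a': "a' \<in> polys" "lead_coeff a' \<notin> P"
        "zero_poly (a - a')" "poly a y - poly a' y \<in> P" by metis
      have "good a'" using a' ay P_cong by (auto simp: good_def)
      then have da: "?d \<le> degree a'" by (rule pmin)
      let ?k = "degree a' + degree u"
      have "coeff (a' * u) ?k \<notin> P"
        using a'(2) luP P_prime by (auto simp: coeff_mult_degree_sum)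
      moreover have "a' * u = smult (lead_coeff u ^ e) p - ((a - a') * u + b)"
        by (simp add: *(3) algebra_simps)
      then have "coeff (a' * u) ?k
          = coeff (smult (lead_coeff u ^ e) p) ?k - coeff ((a - a') * u + b) ?k"
        by (metis coeff_diff)
      moreover have "coeff ((a - a') * u + b) ?k \<in> P"
        using zero_poly_add[OF zero_poly_mult[OF a'(3)] zb] by (simp add: zero_poly_def)
      moreover have "coeff p ?k = 0" using da du by (intro coeff_eq_0) simp
      ultimately show False
        using P_uminus[of "coeff ((a - a') * u + b) ?k"] by (metis coeff_smult diff_0 mult_zero_right)
    qed
    have "zero_poly (smult (lead_coeff u ^ e) p)"
      using zero_poly_add[OF zero_poly_mult[OF za] zb] *(3) by simp
    then have "lead_coeff u ^ e * ?l \<in> P" by (simp add: zero_poly_def)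
    then show False using lP luP P_prime P_power by blast
  qed
  then have "poly u y = lead_coeff u" by (simp add: poly_altdef)
  then show thesis
    using that[of p s "lead_coeff u", OF pR lP d0 py s(1) luR luP _ red] s(2) by simp
qed

end

section \<open>Zeros of prime ideals, one variable at a time\<close>

definition vars_in :: "'r set \<Rightarrow> ('r, 'k::field) cox_ring set" where
  "vars_in V = {f. \<forall>a\<in>Poly_Mapping.keys f. Poly_Mapping.keys a \<subseteq> V}"

lemma vars_in_single: "Poly_Mapping.keys a \<subseteq> V \<Longrightarrow> Poly_Mapping.single a c \<in> vars_in V"
  by (auto simp: vars_in_def split: if_splits)

lemma vars_in_add: "f \<in> vars_in V \<Longrightarrow> g \<in> vars_in V \<Longrightarrow> f + g \<in> vars_in V"
  using keys_add[of f g] by (auto simp: vars_in_def)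

interpretation vars_in: comm_subring "vars_in V :: ('r, 'k::field) cox_ring set" for V
proof
  show "(1::('r, 'k) cox_ring) \<in> vars_in V"
    by (simp add: vars_in_def)
  show "- f \<in> vars_in V" if "f \<in> vars_in V" for f :: "('r, 'k) cox_ring"
    using that by (simp add: vars_in_def in_keys_iff)
  show "f * g \<in> vars_in V" if "f \<in> vars_in V" "g \<in> vars_in V" for f g :: "('r, 'k) cox_ring"
  proof -
    have "Poly_Mapping.keys (a + b) \<subseteq> V"
      if "a \<in> Poly_Mapping.keys f" "b \<in> Poly_Mapping.keys g" for a b
      using that \<open>f \<in> _\<close> \<open>g \<in> _\<close> keys_add[of a b] unfolding vars_in_def by blast
    then show ?thesis
      using keys_mult[of f g] by (fastforce simp: vars_in_def)
  qed
qed (rule vars_in_add)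

lemma vars_in_mono: "V \<subseteq> W \<Longrightarrow> vars_in V \<subseteq> vars_in W"
  by (auto simp: vars_in_def)

lemma vars_in_insert:
  assumes "f \<in> vars_in (insert j V)"
  obtains q where "q \<in> vars_in.polys V" "poly q (cox_var j) = f"
proof -
  define rest where "rest a = Poly_Mapping.update j 0 a" for a :: "'a \<Rightarrow>\<^sub>0 nat"
  have split: "a = rest a + Poly_Mapping.single j (Poly_Mapping.lookup a j)" for a
    by (rule poly_mapping_eqI) (auto simp: rest_def lookup_update lookup_add lookup_single when_def)
  define q where "q = (\<Sum>a\<in>Poly_Mapping.keys f.
    monom (Poly_Mapping.single (rest a) (Poly_Mapping.lookup f a)) (Poly_Mapping.lookup a j))"
  have keysr: "Poly_Mapping.keys (rest a) \<subseteq> V" if "a \<in> Poly_Mapping.keys f" for a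
    using assms that by (auto simp: vars_in_def rest_def keys_update)
  have "coeff q i \<in> vars_in V" for i
    unfolding q_def coeff_sum
  proof (rule vars_in.sum_mem)
    fix a assume "a \<in> Poly_Mapping.keys f"
    then show "coeff (monom (Poly_Mapping.single (rest a) (Poly_Mapping.lookup f a)) (Poly_Mapping.lookup a j)) i
        \<in> vars_in V"
      using keysr[of a] by (simp add: vars_in.zero_mem vars_in_single)
  qed
  then have "q \<in> vars_in.polys V" by (simp add: vars_in.polys_def)
  moreover have "poly q (cox_var j) = f"
  proof -
    have "poly q (cox_var j) = (\<Sum>a\<in>Poly_Mapping.keys f. Poly_Mapping.single a (Poly_Mapping.lookup f a))"
      unfolding q_def poly_sum
      by (rule sum.cong) (use split in \<open>auto simp: poly_monom cox_var_power mult_single\<close>)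
    then show ?thesis using poly_mapping_expand[of f] by simp
  qed
  ultimately show thesis by (rule that)
qed

definition upd_vec :: "'k ^ 'r \<Rightarrow> 'r \<Rightarrow> 'k \<Rightarrow> 'k ^ 'r" where
  "upd_vec x j t = (\<chi> i. if i = j then t else x $ i)"

lemma upd_vec_nth [simp]: "upd_vec x j t $ i = (if i = j then t else x $ i)"
  by (simp add: upd_vec_def)

lemma poly_eval_upd_vec:
  assumes "f \<in> vars_in V" "j \<notin> V"
  shows "poly_eval f (upd_vec x j t) = poly_eval f x"
proof -
  have "mon_eval a (upd_vec x j t) = mon_eval a x" if "a \<in> Poly_Mapping.keys f" for a
  proof -
    have "j \<notin> Poly_Mapping.keys a"
      using assms that by (auto simp: vars_in_def)
    then have "Poly_Mapping.lookup a j = 0" by (simp add: in_keys_iff)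
    then show ?thesis unfolding mon_eval_def by (intro prod.cong) auto
  qed
  then show ?thesis
    by (simp add: poly_eval_superset[of "Poly_Mapping.keys f"])
qed

lemma poly_map_poly_sum:
  fixes f :: "'a::comm_ring_1 \<Rightarrow> 'b::comm_ring_1"
  assumes "f 0 = 0"
  shows "poly (map_poly f q) t = (\<Sum>i\<le>degree q. f (coeff q i) * t ^ i)"
proof -
  have "poly (map_poly f q) t = (\<Sum>i\<le>degree (map_poly f q). coeff (map_poly f q) i * t ^ i)"
    by (rule poly_altdef)
  also have "\<dots> = (\<Sum>i\<le>degree q. coeff (map_poly f q) i * t ^ i)"
  proof (rule sum.mono_neutral_left)
    have "degree (map_poly f q) \<le> degree q"
      by (intro degree_le) (auto simp: coeff_map_poly coeff_eq_0 assms)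
    then show "{..degree (map_poly f q)} \<subseteq> {..degree q}" by simp
  qed (auto simp: coeff_eq_0)
  finally show ?thesis by (simp add: coeff_map_poly assms)
qed

lemma poly_eval_poly:
  assumes "q \<in> vars_in.polys V" "j \<notin> V"
  shows "poly_eval (poly q (cox_var j)) (upd_vec x j t) = poly (map_poly (\<lambda>c. poly_eval c x) q) t"
proof -
  have "poly_eval (coeff q i) (upd_vec x j t) = poly_eval (coeff q i) x" for i
    using assms by (intro poly_eval_upd_vec) (auto simp: vars_in.polys_def)
  then show ?thesis
    by (subst poly_map_poly_sum) (simp_all add: poly_altdef)
qed

lemma infinite_alg_closed: "infinite (UNIV :: 'k::alg_closed_field set)"
proof
  assume fin: "finite (UNIV :: 'k set)"
  define p :: "'k poly" where "p = (\<Prod>a\<in>UNIV. [:- a, 1:]) + 1"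
  have "degree (\<Prod>a\<in>(UNIV::'k set). [:- a, 1:]) = CARD('k)"
    by (subst degree_prod_eq_sum_degree) auto
  moreover have "CARD('k) > 0" using fin by (simp add: card_gt_0_iff)
  ultimately have "degree p > 0" by (simp add: p_def degree_add_eq_left)
  then obtain z where "poly p z = 0" using alg_closed_imp_poly_has_root by blast
  moreover have "poly p z = 1" using fin by (simp add: p_def poly_prod prod_zero_iff)
  ultimately show False by simp
qed

text \<open>The other coordinates come from the induction hypothesis; only the value of the variable
  \<open>j\<close> is to be chosen. If this variable is algebraic modulo \<open>P\<close> over the
  others, the value is a root of its minimal polynomial; otherwise almost every value works.\<close>

lemma prime_point_step:
  fixes P :: "('r::finite, 'k::alg_closed_field) cox_ring set"
  assumes "prime_ideal_set P" "j \<notin> V"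
    and IH: "\<And>g. g \<in> vars_in V \<Longrightarrow> g \<notin> P \<Longrightarrow>
      \<exists>x. poly_eval g x \<noteq> 0 \<and> (\<forall>h\<in>vars_in V \<inter> P. poly_eval h x = 0)"
    and f: "f \<in> vars_in (insert j V)" "f \<notin> P"
  shows "\<exists>x. poly_eval f x \<noteq> 0 \<and> (\<forall>h\<in>vars_in (insert j V) \<inter> P. poly_eval h x = 0)"
proof -
  interpret prime_ideal_set P by fact
  interpret prime_over_subring P "vars_in V" "cox_var j"
    by (intro prime_over_subring.intro assms(1) vars_in.comm_subring_axioms)
  obtain q where q: "q \<in> vars_in.polys V" "poly q (cox_var j) = f" using vars_in_insert[OF f(1)] by blast
  let ?y = "cox_var j" and ?ev = "\<lambda>x q. map_poly (\<lambda>c. poly_eval c x) q"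
  have ev: "poly_eval (poly q ?y) (upd_vec x j t) = poly (?ev x q) t" if "q \<in> vars_in.polys V" for q x t
    using poly_eval_poly[OF that assms(2)] .
  show ?thesis
  proof (cases "\<exists>p0\<in>vars_in.polys V. poly p0 ?y \<in> P \<and> \<not> zero_poly p0")
    case True
    then obtain p0 where p0: "p0 \<in> vars_in.polys V" "poly p0 ?y \<in> P" "\<not> zero_poly p0" by blast
    have qy: "poly q ?y \<notin> P" using q f(2) by simp
    obtain p s c where p: "p \<in> vars_in.polys V" "lead_coeff p \<notin> P" "degree p \<noteq> 0" "poly p ?y \<in> P"
      and s: "s \<in> vars_in.polys V" "c \<in> vars_in V" "c \<notin> P" "c - poly s ?y * poly q ?y \<in> P"
      and red: "\<And>h. h \<in> vars_in.polys V \<Longrightarrow> poly h ?y \<in> P \<Longrightarrow> \<exists>e. \<exists>a\<in>vars_in.polys V. \<exists>b\<in>vars_in.polys V.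
         smult (lead_coeff p ^ e) h = a * p + b \<and> zero_poly b"
      by (rule algebraic_case[OF p0 q(1) qy], rule that)
    have lV: "lead_coeff p \<in> vars_in V" using p by (simp add: vars_in.polys_def)
    \<comment> \<open>Two things must survive at the point: the leading coefficient, so that
      \<open>p\<close> has a root there and its powers can be cancelled, and \<open>c\<close>, which
      \<open>f\<close> divides modulo \<open>P\<close>, so that \<open>f\<close> does not
      vanish.\<close>
    have "lead_coeff p * c \<notin> P" using p(2) s(3) P_prime by blast
    then obtain x where x: "poly_eval (lead_coeff p * c) x \<noteq> 0"
      "\<forall>h\<in>vars_in V \<inter> P. poly_eval h x = 0"
      using IH[OF vars_in.mult_mem[OF lV s(2)]] by blast
    have "degree p \<le> degree (?ev x p)"
      using x(1) by (intro le_degree) (simp add: coeff_map_poly)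
    then obtain t where t: "poly (?ev x p) t = 0"
      using alg_closed_imp_poly_has_root[of "?ev x p"] p(3) by auto
    let ?x = "upd_vec x j t"
    have van: "poly_eval h ?x = 0" if h: "h \<in> vars_in (insert j V)" "h \<in> P" for h
    proof -
      obtain q' where q': "q' \<in> vars_in.polys V" "poly q' ?y = h" using vars_in_insert[OF h(1)] by blast
      then obtain e a b where *: "a \<in> vars_in.polys V" "b \<in> vars_in.polys V" "smult (lead_coeff p ^ e) q' = a * p + b"
        "zero_poly b" using red h(2) by blast
      have "lead_coeff p ^ e * h = poly a ?y * poly p ?y + poly b ?y"
        using arg_cong[OF *(3), of "\<lambda>p. poly p ?y"] q' by simp
      then have "poly_eval (lead_coeff p ^ e * h) ?x
          = poly_eval (poly a ?y) ?x * poly_eval (poly p ?y) ?x + poly_eval (poly b ?y) ?x"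
        by simp
      moreover have "poly_eval (poly p ?y) ?x = 0" using t ev[OF p(1), of x t] by simp
      moreover have "poly_eval (poly b ?y) ?x = 0"
      proof -
        have "poly_eval (coeff b i) x = 0" for i
          using *(2,4) x(2) unfolding vars_in.polys_def zero_poly_def by blast
        then show ?thesis unfolding ev[OF *(2)] by (subst poly_map_poly_sum) auto
      qed
      moreover have "poly_eval (lead_coeff p) ?x \<noteq> 0"
        using poly_eval_upd_vec[OF lV assms(2)] x(1) by simp
      ultimately show ?thesis by simp
    qed
    have sV: "poly s ?y \<in> vars_in (insert j V)"
    proof -
      have "?y \<in> vars_in (insert j V)" by (simp add: cox_var_def vars_in_single)
      then show ?thesis unfolding poly_altdef using s(1) vars_in_mono[of V "insert j V"]
        by (intro vars_in.sum_mem vars_in.mult_mem vars_in.power_mem) (auto simp: vars_in.polys_def)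
    qed
    have "c - poly s ?y * f \<in> vars_in (insert j V)"
      using s(2) sV f(1) vars_in_mono[of V "insert j V"]
      by (intro vars_in.diff_mem vars_in.mult_mem) auto
    then have "poly_eval (c - poly s ?y * f) ?x = 0"
      by (rule van) (use s(4) q(2) in simp)
    moreover have "poly_eval c ?x \<noteq> 0" using poly_eval_upd_vec[OF s(2) assms(2)] x(1) by simp
    ultimately have "poly_eval f ?x \<noteq> 0" by auto
    then show ?thesis using van by blast
  next
    case False
    \<comment> \<open>Without an algebraic relation every element of \<open>P\<close> has all its
      coefficients in \<open>P\<close>, and hence vanishes for every value of the new variable. It
      remains to avoid the finitely many roots of \<open>f\<close>.\<close>
    have "\<not> zero_poly q" using zero_poly_poly q f(2) by blast
    then obtain i where i: "coeff q i \<notin> P" by (auto simp: zero_poly_def)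
    moreover have "coeff q i \<in> vars_in V" using q by (simp add: vars_in.polys_def)
    ultimately obtain x where x: "poly_eval (coeff q i) x \<noteq> 0"
      "\<forall>h\<in>vars_in V \<inter> P. poly_eval h x = 0" using IH by blast
    have "coeff (?ev x q) i \<noteq> 0" using x(1) by (simp add: coeff_map_poly)
    then have "?ev x q \<noteq> 0" by auto
    then have "finite {t. poly (?ev x q) t = 0}" by (rule poly_roots_finite)
    then obtain t where t: "poly (?ev x q) t \<noteq> 0"
      using ex_new_if_finite[OF infinite_alg_closed] by blast
    have "poly_eval h (upd_vec x j t) = 0" if h: "h \<in> vars_in (insert j V)" "h \<in> P" for h
    proof -
      obtain q' where q': "q' \<in> vars_in.polys V" "poly q' ?y = h" using vars_in_insert[OF h(1)] by blast
      then have "zero_poly q'" using False h(2) by blast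
      have "poly_eval (coeff q' i) x = 0" for i
        using \<open>zero_poly q'\<close> q'(1) x(2) unfolding vars_in.polys_def zero_poly_def by blast
      then show ?thesis unfolding q'(2)[symmetric] ev[OF q'(1)] by (subst poly_map_poly_sum) auto
    qed
    moreover have "poly_eval f (upd_vec x j t) \<noteq> 0" using t ev[OF q(1)] q(2) by simp
    ultimately show ?thesis by blast
  qed
qed

lemma prime_point:
  fixes P :: "('r::finite, 'k::alg_closed_field) cox_ring set"
  assumes P: "prime_ideal_set P" and f: "f \<notin> P"
  shows "\<exists>x. poly_eval f x \<noteq> 0 \<and> (\<forall>h\<in>P. poly_eval h x = 0)"
proof -
  interpret prime_ideal_set P by fact
  have "finite V \<Longrightarrow> g \<in> vars_in V \<Longrightarrow> g \<notin> P \<Longrightarrow>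
      \<exists>x. poly_eval g x \<noteq> 0 \<and> (\<forall>h\<in>vars_in V \<inter> P. poly_eval h x = 0)" for V g
  proof (induction V arbitrary: g rule: finite_induct)
    case empty
    have const: "h = Poly_Mapping.single 0 (Poly_Mapping.lookup h 0)"
      if h: "h \<in> vars_in {}" for h :: "('r, 'k) cox_ring"
    proof -
      have "Poly_Mapping.keys h \<subseteq> {0}" using h by (auto simp: vars_in_def)
      then show ?thesis
        by (intro poly_mapping_eqI) (auto simp: lookup_single when_def in_keys_iff)
    qed
    have z: "h = 0" if "h \<in> vars_in {} \<inter> P" for h
    proof (rule ccontr)
      assume "h \<noteq> 0"
      moreover have hc: "h = Poly_Mapping.single 0 (Poly_Mapping.lookup h 0)" using const that by blast
      ultimately have "Poly_Mapping.lookup h 0 \<noteq> 0" by (metis single_zero)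
      then have "Poly_Mapping.single 0 (inverse (Poly_Mapping.lookup h 0)) * h = 1"
        by (subst (2) hc) (simp add: mult_single)
      then show False using P_mult[of h] P_one that by (metis IntD2)
    qed
    have "g \<noteq> 0" using empty P_zero by blast
    then have "Poly_Mapping.lookup g 0 \<noteq> 0" using const[OF empty(1)] by (metis single_zero)
    then have "poly_eval g 0 \<noteq> 0" by (subst const[OF empty(1)]) simp
    moreover have "\<forall>h\<in>vars_in {} \<inter> P. poly_eval h 0 = 0"
    proof
      fix h assume "h \<in> vars_in {} \<inter> P"
      then have "h = 0" by (rule z)
      then show "poly_eval h 0 = 0" by simp
    qed
    ultimately show ?case by blast
  next
    case (insert j V)
    show ?case by (rule prime_point_step[OF P insert.hyps(2) insert.IH insert.prems])
  qed
  from this[of UNIV f] f show ?thesis by (auto simp: vars_in_def)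
qed

lemma ideal_gen_module: "Modules.module ((*) :: 'a::comm_ring_1 \<Rightarrow> _)"
  by unfold_locales (auto simp: algebra_simps)

lemmas ring_subspace_def = module.subspace_def[OF ideal_gen_module]
lemmas ring_span_empty = module.span_empty[OF ideal_gen_module]
lemmas ring_span_base = module.span_base[OF ideal_gen_module]
lemmas ring_span_zero = module.span_zero[OF ideal_gen_module]
lemmas ring_span_add = module.span_add[OF ideal_gen_module]
lemmas ring_span_diff = module.span_diff[OF ideal_gen_module]
lemmas ring_span_scale = module.span_scale[OF ideal_gen_module]
lemmas ring_span_sum = module.span_sum[OF ideal_gen_module]
lemmas ring_span_mono = module.span_mono[OF ideal_gen_module]
lemmas ring_span_minimal = module.span_minimal[OF ideal_gen_module]
lemmas ring_span_superset = module.span_superset[OF ideal_gen_module]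
lemmas ring_span_induct_alt [consumes 1, case_names base step] =
  module.span_induct_alt[OF ideal_gen_module]

lemma is_ideal_iff: "is_ideal I \<longleftrightarrow>
    0 \<in> I \<and> (\<forall>x\<in>I. \<forall>y\<in>I. x + y \<in> I) \<and> (\<forall>c. \<forall>x\<in>I. c * x \<in> I)"
  by (simp add: is_ideal_def ring_subspace_def)

text \<open>A maximal ideal among those avoiding the powers of \<open>f\<close> is prime.\<close>

lemma prime_avoiding:
  fixes I :: "'a::comm_ring_1 set"
  assumes I: "is_ideal I" and f: "\<And>k. f ^ k \<notin> I"
  obtains P where "prime_ideal_set P" "I \<subseteq> P" "f \<notin> P"
proof -
  define \<A> where "\<A> = {J. is_ideal J \<and> I \<subseteq> J \<and> (\<forall>k. f ^ k \<notin> J)}"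
  have "\<exists>N\<in>\<A>. \<forall>M\<in>\<A>. N \<subseteq> M \<longrightarrow> M = N"
  proof (rule subset_Zorn_nonempty)
    show "\<A> \<noteq> {}" using I f by (auto simp: \<A>_def)
    fix C assume C: "C \<noteq> {}" "subset.chain \<A> C"
    then have C\<A>: "\<And>J. J \<in> C \<Longrightarrow> is_ideal J \<and> I \<subseteq> J \<and> (\<forall>k. f ^ k \<notin> J)"
      by (auto simp: \<A>_def subset_chain_def)
    have "is_ideal (\<Union>C)"
      unfolding is_ideal_iff
    proof (intro conjI ballI allI)
      show "0 \<in> \<Union>C" using C(1) C\<A> by (auto simp: is_ideal_iff)
      show "c * x \<in> \<Union>C" if "x \<in> \<Union>C" for c x using that C\<A> unfolding is_ideal_iff by blast
      fix x y assume "x \<in> \<Union>C" "y \<in> \<Union>C"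
      then obtain J J' where "J \<in> C" "x \<in> J" "J' \<in> C" "y \<in> J'" by blast
      moreover from this C(2) have "J \<subseteq> J' \<or> J' \<subseteq> J" by (auto simp: subset_chain_def)
      ultimately show "x + y \<in> \<Union>C" using C\<A> unfolding is_ideal_iff by blast
    qed
    then show "\<Union>C \<in> \<A>" using C(1) C\<A> by (fastforce simp: \<A>_def)
  qed
  then obtain P where P: "is_ideal P" "I \<subseteq> P" "\<And>k. f ^ k \<notin> P"
    and Pmax: "\<And>M. is_ideal M \<Longrightarrow> (\<And>k. f ^ k \<notin> M) \<Longrightarrow> P \<subseteq> M \<Longrightarrow> M = P"
    by (auto simp: \<A>_def)
  have P0: "0 \<in> P" and Padd: "\<And>x y. x \<in> P \<Longrightarrow> y \<in> P \<Longrightarrow> x + y \<in> P"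
    and Pmult: "\<And>c x. x \<in> P \<Longrightarrow> c * x \<in> P"
    using P(1) by (auto simp: is_ideal_iff)
  \<comment> \<open>By maximality, the ideal generated by \<open>P\<close> and an element outside it
    contains a power of \<open>f\<close>.\<close>
  have ext: "\<exists>k. \<exists>c. \<exists>u\<in>P. f ^ k = u + c * x" if "x \<notin> P" for x
  proof (rule ccontr)
    assume no: "\<nexists>k. \<exists>c. \<exists>u\<in>P. f ^ k = u + c * x"
    define M where "M = {u + c * x | u c. u \<in> P}"
    have "is_ideal M"
      unfolding is_ideal_iff
    proof (intro conjI ballI allI)
      show "0 \<in> M" unfolding M_def using P0 by (auto intro!: exI[of _ 0])
      fix z assume "z \<in> M"
      then obtain u c where z: "z = u + c * x" "u \<in> P" by (auto simp: M_def)
      have "d * z = d * u + d * c * x" for d unfolding z(1) by (simp only: distrib_left mult.assoc)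
      moreover have "d * u + d * c * x \<in> M" for d
        unfolding M_def by (rule CollectI, intro exI conjI, rule refl, rule Pmult[OF z(2)])
      ultimately show "d * z \<in> M" for d by (simp only:)
      fix z' assume "z' \<in> M"
      then obtain u' c' where z': "z' = u' + c' * x" "u' \<in> P" by (auto simp: M_def)
      have "z + z' = (u + u') + (c + c') * x" unfolding z(1) z'(1) by (simp only: distrib_right add_ac)
      moreover have "(u + u') + (c + c') * x \<in> M"
        unfolding M_def by (rule CollectI, intro exI conjI, rule refl, rule Padd[OF z(2) z'(2)])
      ultimately show "z + z' \<in> M" by (simp only:)
    qed
    moreover have "P \<subseteq> M"
    proof
      fix u assume "u \<in> P"
      then show "u \<in> M" unfolding M_def by (intro CollectI exI[of _ u] exI[of _ 0]) simp
    qed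
    moreover have "x \<in> M" unfolding M_def using P0 by (intro CollectI exI[of _ 0] exI[of _ 1]) simp
    moreover have "f ^ k \<notin> M" for k using no unfolding M_def by blast
    ultimately show False using Pmax[of M] that by blast
  qed
  have "prime_ideal_set P"
  proof
    show "1 \<notin> P" using P(3)[of 0] by simp
    show "x \<in> P \<or> y \<in> P" if xy: "x * y \<in> P" for x y
    proof (rule ccontr)
      assume "\<not> ?thesis"
      then obtain k c u k' c' u' where *: "u \<in> P" "f ^ k = u + c * x" "u' \<in> P" "f ^ k' = u' + c' * y"
        using ext by meson
      have "f ^ (k + k') = (u' + c' * y) * u + (c * x * u' + c * c' * (x * y))"
        unfolding power_add *(2,4) by (simp only: distrib_left distrib_right mult_ac add_ac)
      also have "\<dots> \<in> P" by (rule Padd[OF Pmult[OF *(1)] Padd[OF Pmult[OF *(3)] Pmult[OF xy]]])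
      finally show False using P(3) by blast
    qed
  qed (use P0 Padd Pmult in auto)
  then show thesis using that P(2) P(3)[of 1] by simp
qed

text \<open>If no power of \<open>f\<close> lies in \<open>I\<close>, some prime containing
  \<open>I\<close> avoids \<open>f\<close>, and this prime has a zero at which \<open>f\<close> does
  not vanish.\<close>

theorem Nullstellensatz:
  fixes I :: "('r::finite, 'k::alg_closed_field) cox_ring set"
  assumes "is_ideal I" "\<And>x. x \<in> zero_set I \<Longrightarrow> poly_eval f x = 0"
  shows "\<exists>k. f ^ k \<in> I"
proof (rule ccontr)
  assume "\<nexists>k. f ^ k \<in> I"
  then obtain P where "prime_ideal_set P" "I \<subseteq> P" "f \<notin> P"
    using prime_avoiding[OF assms(1)] by metis
  with prime_point[of P f] assms(2) show False by (auto simp: zero_set_def)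
qed

section \<open>Dimensions of subspaces\<close>

context vector_space
begin

lemma span_disjoint_parts:
  assumes "independent B" "C \<subseteq> B" "D \<subseteq> B" "C \<inter> D = {}" "x \<in> span C" "x \<in> span D"
  shows "x = 0"
proof -
  have "representation B x = representation C x" "representation B x = representation D x"
    using assms by (auto intro!: representation_extend)
  then have "representation B x b = 0" for b
    using representation_ne_zero[of C x b] representation_ne_zero[of D x b] assms(4) by force
  moreover have "x \<in> span B" using assms span_mono by blast
  ultimately show ?thesis using sum_nonzero_representation_eq[OF assms(1), of x] by simp
qed

end

context vector_space_pair
begin

lemma dim_image_inj:
  assumes lf: "Vector_Spaces.linear s1 s2 f" and inj: "inj_on f (vs1.span S)"
  shows "vs2.dim (f ` S) = vs1.dim S"
proof -
  obtain B where B: "B \<subseteq> S" "vs1.independent B" "S \<subseteq> vs1.span B" "card B = vs1.dim S"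
    using vs1.basis_exists by blast
  have sub: "vs1.span B \<subseteq> vs1.span S" using B(1) by (rule vs1.span_mono)
  show ?thesis
  proof (rule vs2.dim_unique)
    show "f ` B \<subseteq> f ` S" using B(1) by blast
    show "f ` S \<subseteq> vs2.span (f ` B)"
      using B(3) linear_span_image[OF lf, of B] by auto
    show "vs2.independent (f ` B)"
      using inj_on_subset[OF inj sub] B(2) by (intro linear_independent_injective_image[OF lf])
    show "card (f ` B) = vs1.dim S"
      using B inj_on_subset[OF inj] vs1.span_superset[of S] by (subst card_image) auto
  qed
qed

text \<open>The polynomial ring is infinite-dimensional, so finiteness is required only of a
  spanning set \<open>W\<close> around the subspace \<open>A\<close>; in the applications
  \<open>W\<close> consists of the monomials of one degree.\<close>

lemma rank_nullity:
  assumes lf: "Vector_Spaces.linear s1 s2 f" and A: "vs1.subspace A" "A \<subseteq> vs1.span W" "finite W"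
  shows "vs1.dim A = vs2.dim (f ` A) + vs1.dim {x\<in>A. f x = 0}"
proof -
  let ?N = "{x\<in>A. f x = 0}"
  obtain B0 where B0: "B0 \<subseteq> ?N" "vs1.independent B0" "?N \<subseteq> vs1.span B0" "card B0 = vs1.dim ?N"
    using vs1.basis_exists by blast
  obtain B where B: "B0 \<subseteq> B" "B \<subseteq> A" "vs1.independent B" "A \<subseteq> vs1.span B"
    using vs1.maximal_independent_subset_extend[of B0 A] B0 by blast
  have fin: "finite B"
    using vs1.independent_span_bound[OF A(3) B(3)] B(2) A(2) by blast
  let ?C = "B - B0"
  have spA: "vs1.span B = A"
    using B A(1) by (simp add: subset_antisym vs1.span_minimal)
  have inj: "inj_on f (vs1.span ?C)"
    unfolding linear_inj_on_iff_eq_0[OF lf vs1.subspace_span]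
  proof (intro ballI impI)
    fix x assume x: "x \<in> vs1.span ?C" "f x = 0"
    have "x \<in> A" using x(1) vs1.span_mono[of ?C B] spA by blast
    then have "x \<in> vs1.span B0" using x(2) B0(3) by blast
    then show "x = 0" using vs1.span_disjoint_parts[OF B(3), of ?C B0] x(1) B(1) by blast
  qed
  have "f ` A = vs2.span (f ` B)" using linear_span_image[OF lf, of B] spA by simp
  also have "\<dots> = vs2.span (f ` ?C)"
  proof
    have "f b \<in> vs2.span (f ` ?C)" if "b \<in> B" for b
      using B0(1) that vs2.span_zero vs2.span_base by (cases "b \<in> B0") auto
    then show "vs2.span (f ` B) \<subseteq> vs2.span (f ` ?C)"
      by (intro vs2.span_minimal) auto
    show "vs2.span (f ` ?C) \<subseteq> vs2.span (f ` B)" by (intro vs2.span_mono) auto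
  qed
  finally have "vs2.dim (f ` A) = vs2.dim (f ` ?C)" by simp
  also have "\<dots> = vs1.dim ?C" by (rule dim_image_inj[OF lf inj])
  also have "\<dots> = card ?C"
    using vs1.independent_mono[OF B(3), of ?C] by (simp add: vs1.dim_eq_card_independent)
  also have "\<dots> = card B - card B0" using B(1) fin by (simp add: card_Diff_subset finite_subset)
  finally have "vs2.dim (f ` A) = card B - card B0" .
  moreover have "card B = vs1.dim A" using vs1.basis_card_eq_dim[OF B(2,4,3)] .
  moreover have "card B0 \<le> card B" using fin B(1) by (rule card_mono)
  ultimately show ?thesis using B0(4) by simp
qed

end

context vector_space
begin

text \<open>Rank-nullity, applied twice to the identity minus a projection onto \<open>A\<close>.
  This map has kernel \<open>A\<close>, and it has the same image on the sum as on
  \<open>B\<close>.\<close>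

lemma dim_sum_inter:
  assumes A: "subspace A" "A \<subseteq> span W" and B: "subspace B" "B \<subseteq> span W" and W: "finite W"
  shows "dim {x + y | x y. x \<in> A \<and> y \<in> B} + dim (A \<inter> B) = dim A + dim B"
proof -
  interpret vector_space_pair scale scale ..
  have id: "Vector_Spaces.linear scale scale (\<lambda>x. x)" by (simp add: Vector_Spaces.linear_iff vector_space_axioms)
  obtain p where p: "p ` UNIV \<subseteq> A" "Vector_Spaces.linear scale scale p" "\<forall>v\<in>A. p v = v"
    using linear_exists_left_inverse_on[OF id A(1)] by auto
  define f where "f x = x - p x" for x
  have lf: "Vector_Spaces.linear scale scale f"
    using p(2) by (simp add: Vector_Spaces.linear_iff f_def scale_right_diff_distrib algebra_simps)
  have ker: "f x = 0 \<longleftrightarrow> x \<in> A" for x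
    using p(1,3) by (auto simp: f_def)
  let ?S = "{x + y | x y. x \<in> A \<and> y \<in> B}"
  have sub: "A \<subseteq> ?S" "B \<subseteq> ?S"
    using subspace_0[OF A(1)] subspace_0[OF B(1)] by force+
  have S: "subspace ?S" "?S \<subseteq> span W"
    using subspace_sums[OF A(1) B(1)] A(2) B(2) by (auto intro: span_add)
  have "f (x + y) = f y" if "x \<in> A" for x y
    using linear_add[OF lf, of x y] ker[of x] that by simp
  then have img: "f ` ?S = f ` B" using sub(2) by (auto simp: image_iff)
  have "{x \<in> ?S. f x = 0} = A" "{x \<in> B. f x = 0} = A \<inter> B" using ker sub by auto
  then show ?thesis
    using rank_nullity[OF lf S W] rank_nullity[OF lf B W] img by simp
qed

end

section \<open>Extension of scalars along a field embedding\<close>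

definition map_vec :: "('a \<Rightarrow> 'b) \<Rightarrow> 'a ^ 's \<Rightarrow> 'b ^ 's" where
  "map_vec f x = (\<chi> i. f (x $ i))"

lemma map_vec_nth [simp]: "map_vec f x $ i = f (x $ i)"
  by (simp add: map_vec_def)

lemma span_map_vec:
  fixes f :: "'q::field \<Rightarrow> 'k::field" and S :: "('q ^ 's) set"
  assumes hom: "f 0 = 0" "\<And>x y. f (x + y) = f x + f y" "\<And>x y. f (x * y) = f x * f y"
    and x: "x \<in> vec.span S"
  shows "map_vec f x \<in> vec.span (map_vec f ` S)"
  using x
proof (induction rule: vec.span_induct_alt)
  case base
  have "map_vec f (0 :: 'q ^ 's) = 0" by (simp add: vec_eq_iff hom)
  then show ?case by (simp add: vec.span_zero)
next
  case (step c x y)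
  have "map_vec f (c *s x + y) = f c *s map_vec f x + map_vec f y" by (simp add: vec_eq_iff hom)
  then show ?case using step by (simp add: vec.span_add vec.span_scale vec.span_base)
qed

text \<open>A basis of the whole space extending one of the span of \<open>S\<close> is mapped to a
  spanning set, because unit vectors are mapped to unit vectors. The cardinality is right, so
  independence over the small field persists over the large one. This carries the dimension of the
  code to the algebraic closure.\<close>

lemma dim_map_vec:
  fixes f :: "'q::field \<Rightarrow> 'k::field" and S :: "('q ^ 's) set"
  assumes hom: "f 0 = 0" "f 1 = 1" "\<And>x y. f (x + y) = f x + f y" "\<And>x y. f (x * y) = f x * f y"
    and inj: "inj f"
  shows "vec.dim (map_vec f ` S) = vec.dim S"
proof -
  have minj: "inj (map_vec f :: 'q ^ 's \<Rightarrow> _)"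
    using inj by (auto simp: inj_def vec_eq_iff)
  have span: "map_vec f x \<in> vec.span (map_vec f ` T)" if "x \<in> vec.span T" for x T
    using span_map_vec[of f] hom that by blast
  obtain B where B: "B \<subseteq> S" "vec.independent B" "S \<subseteq> vec.span B" "card B = vec.dim S"
    using vec.basis_exists by blast
  obtain C where "B \<subseteq> C" "C \<subseteq> UNIV" and C: "vec.independent C" "UNIV \<subseteq> vec.span C"
    by (rule vec.maximal_independent_subset_extend[OF subset_UNIV B(2)], rule that)
  have finC: "finite C" using vec.finiteI_independent[OF C(1)] .
  have cC: "card C = CARD('s)"
    by (rule trans[OF vec.basis_card_eq_dim[OF subset_UNIV C(2,1)] vec_dim_card])
  have "vec.span (map_vec f ` C) = UNIV"
  proof -
    have "x \<in> vec.span (map_vec f ` C)" for x :: "'k ^ 's"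
    proof -
      have "axis i 1 \<in> vec.span (map_vec f ` C)" for i
      proof -
        have "map_vec f (axis i 1) \<in> vec.span (map_vec f ` C)" using C(2) by (intro span) auto
        moreover have "map_vec f (axis i 1) = axis i 1" by (auto simp: vec_eq_iff axis_def hom)
        ultimately show ?thesis by simp
      qed
      then have "(\<Sum>i\<in>UNIV. x $ i *s axis i 1) \<in> vec.span (map_vec f ` C)"
        by (intro vec.span_sum vec.span_scale)
      then show ?thesis by (simp add: basis_expansion)
    qed
    then show ?thesis by blast
  qed
  then have "vec.independent (map_vec f ` C)"
    using finC vec_dim_card[where 'a = 'k and 'n = 's]
    by (intro vec.card_le_dim_spanning[of _ UNIV])
      (auto simp: card_image inj_on_subset[OF minj] cC simp del: vec.dim_UNIV)
  then have "vec.independent (map_vec f ` B)" 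
    by (rule vec.independent_mono) (use \<open>B \<subseteq> C\<close> in blast)
  then show ?thesis
    using B span by (intro vec.dim_unique[of "map_vec f ` B"])
      (auto simp: card_image inj_on_subset[OF minj])
qed

section \<open>Divisor classes\<close>

lemma pairing_add: "pairing (m + m') w = pairing m w + pairing m' w"
  by (simp add: pairing_def sum.distrib algebra_simps)

lemma pairing_diff: "pairing (m - m') w = pairing m w - pairing m' w"
  by (simp add: pairing_def sum_subtractf algebra_simps)

lemma pairing_uminus: "pairing (- m) w = - pairing m w"
  by (simp add: pairing_def sum_negf)

lemma pairing_0 [simp]: "pairing 0 w = 0"
  by (simp add: pairing_def)

lemma pairing_sum: "pairing (sum f A) w = (\<Sum>i\<in>A. pairing (f i) w)"
  by (induction A rule: infinite_finite_induct) (auto simp: pairing_add)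

lemma rvec_inner: "rvec m \<bullet> rvec w = real_of_int (pairing m w)"
  by (simp add: rvec_def pairing_def inner_vec_def)

lemma inj_rvec: "inj rvec"
  by (auto simp: inj_def rvec_def vec_eq_iff)

lemma char_lookup [simp]: "Poly_Mapping.lookup (char_divisor v m) j = pairing m (v j)"
  by (simp add: char_divisor_def lookup_sum lookup_single when_def)

lemma char_add: "char_divisor v (m + m') = char_divisor v m + char_divisor v m'"
  by (rule poly_mapping_eqI) (simp add: lookup_add pairing_add)

lemma char_uminus: "char_divisor v (- m) = - char_divisor v m"
  by (rule poly_mapping_eqI) (simp add: pairing_uminus)

lemma char_0 [simp]: "char_divisor v 0 = 0"
  by (rule poly_mapping_eqI) simp

lemma char_normal: "normal (range (char_divisor v)) Divisors"
proof -
  interpret D: comm_group Divisors by (rule abelian_free_Abelian_group)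
  have "subgroup (range (char_divisor v)) Divisors"
  proof (rule D.subgroupI)
    fix a b assume "a \<in> range (char_divisor v)" "b \<in> range (char_divisor v)"
    then show "a \<otimes>\<^bsub>Divisors\<^esub> b \<in> range (char_divisor v)" "inv\<^bsub>Divisors\<^esub> a \<in> range (char_divisor v)"
      by (auto simp flip: char_add char_uminus)
  qed auto
  then show ?thesis by (rule D.subgroup_imp_normal)
qed

lemma comm_group_Cl: "comm_group (Cl v)"
  unfolding Cl_def
  by (rule comm_group.abelian_FactGroup[OF abelian_free_Abelian_group])
    (use char_normal in \<open>auto simp: normal_def\<close>)

lemma mem_div_class: "D' \<in> div_class v D \<longleftrightarrow> (\<exists>m. D' = D + char_divisor v m)"
  by (auto simp: div_class_def r_coset_def add.commute)

lemma carrier_Cl: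
  fixes v :: "'r::finite \<Rightarrow> int ^ 'n"
  shows "carrier (Cl v) = range (div_class v)"
proof -
  have "carrier (free_Abelian_group UNIV) = (UNIV :: ('r \<Rightarrow>\<^sub>0 int) set)" by auto
  then show ?thesis by (simp add: Cl_def carrier_FactGroup div_class_def[abs_def])
qed

lemma div_class_carrier [simp]: "div_class v D \<in> carrier (Cl v)"
  by (simp add: carrier_Cl)

lemma div_class_eqI:
  assumes D': "D' = D + char_divisor v m"
  shows "div_class v D' = div_class v D"
proof (rule Set.set_eqI)
  fix E
  have "E = D' + char_divisor v m' \<longleftrightarrow> E = D + char_divisor v (m + m')" for m'
    by (simp add: D' char_add add_ac)
  moreover have "E = D + char_divisor v m' \<longleftrightarrow> E = D' + char_divisor v (m' - m)" for m'
    by (simp add: D' add_ac flip: char_add)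
  ultimately show "E \<in> div_class v D' \<longleftrightarrow> E \<in> div_class v D"
    unfolding mem_div_class by blast
qed

lemma div_class_eq_iff: "div_class v D' = div_class v D \<longleftrightarrow> (\<exists>m. D' = D + char_divisor v m)"
proof
  assume eq: "div_class v D' = div_class v D"
  have "D' \<in> div_class v D'" unfolding mem_div_class by (rule exI[of _ 0]) simp
  then show "\<exists>m. D' = D + char_divisor v m" by (simp add: eq mem_div_class)
next
  assume "\<exists>m. D' = D + char_divisor v m"
  then show "div_class v D' = div_class v D" using div_class_eqI by blast
qed

lemma Cl_mult: "div_class v D \<otimes>\<^bsub>Cl v\<^esub> div_class v D' = div_class v (D + D')"
  using normal.rcos_sum[OF char_normal, of D D' v] by (simp add: Cl_def div_class_def)

lemma Cl_one: "\<one>\<^bsub>Cl v\<^esub> = div_class v 0"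
proof -
  have "range (char_divisor v) = div_class v 0" by (auto simp: mem_div_class)
  then show ?thesis by (simp add: Cl_def)
qed

lemma Cl_inv: "inv\<^bsub>Cl v\<^esub> (div_class v D) = div_class v (- D)"
proof -
  interpret comm_group "Cl v" by (rule comm_group_Cl)
  show ?thesis by (rule inv_equality) (simp_all add: Cl_mult Cl_one)
qed

lemma Cl_diff_class: "Cl_diff v (div_class v D) (div_class v D') = div_class v (D - D')"
  by (simp add: Cl_diff_def Cl_inv Cl_mult)

lemma Cl_pow: "div_class v D [^]\<^bsub>Cl v\<^esub> (n::nat) = div_class v (frag_cmul (int n) D)"
proof -
  interpret comm_group "Cl v" by (rule comm_group_Cl)
  show ?thesis by (induction n) (simp_all add: Cl_one Cl_mult frag_cmul_distrib add.commute)
qed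

lemma Cl_finprod: "finite A \<Longrightarrow> (\<Otimes>\<^bsub>Cl v\<^esub>i\<in>A. div_class v (D i)) = div_class v (\<Sum>i\<in>A. D i)"
proof (induction A rule: finite_induct)
  case empty
  interpret comm_group "Cl v" by (rule comm_group_Cl)
  show ?case by (simp add: Cl_one)
next
  case (insert a A)
  interpret comm_group "Cl v" by (rule comm_group_Cl)
  show ?case using insert by (simp add: Cl_mult Pi_def)
qed

text \<open>The divisor of zeros of the monomial with exponent \<open>a\<close>, an effective
  representative of its degree.\<close>

definition exp_divisor :: "('r \<Rightarrow>\<^sub>0 nat) \<Rightarrow> ('r \<Rightarrow>\<^sub>0 int)" where
  "exp_divisor a = Poly_Mapping.map int a"

lemma exp_divisor_lookup [simp]: "Poly_Mapping.lookup (exp_divisor a) j = int (Poly_Mapping.lookup a j)"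
  by (simp add: exp_divisor_def map.rep_eq when_def)

lemma exp_divisor_add: "exp_divisor (a + b) = exp_divisor a + exp_divisor b"
  by (rule poly_mapping_eqI) (simp add: lookup_add)

lemma exp_divisor_0 [simp]: "exp_divisor 0 = 0"
  by (rule poly_mapping_eqI) simp

lemma mon_degree_class: "mon_degree v a = div_class v (exp_divisor a)"
proof -
  have "mon_degree v a =
      div_class v (\<Sum>j\<in>UNIV. frag_cmul (int (Poly_Mapping.lookup a j)) (Poly_Mapping.single j 1))"
    by (simp add: mon_degree_def beta_def Cl_pow Cl_finprod)
  also have "(\<Sum>j\<in>UNIV. frag_cmul (int (Poly_Mapping.lookup a j)) (Poly_Mapping.single j 1)) = exp_divisor a"
    by (rule poly_mapping_eqI) (simp add: lookup_sum lookup_single when_def if_distrib cong: if_cong)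
  finally show ?thesis .
qed

section \<open>Lattice points of a divisor and monomials of its class\<close>

definition lattice_points :: "('r \<Rightarrow> int ^ 'n) \<Rightarrow> ('r \<Rightarrow>\<^sub>0 int) \<Rightarrow> (int ^ 'n) set" where
  "lattice_points v D = {m. \<forall>j. pairing m (v j) \<ge> - Poly_Mapping.lookup D j}"

lemma lattice_points_iff:
  "m \<in> lattice_points v D \<longleftrightarrow> (\<forall>j. 0 \<le> Poly_Mapping.lookup D j + pairing m (v j))"
proof -
  have "- Poly_Mapping.lookup D j \<le> pairing m (v j) \<longleftrightarrow> 0 \<le> Poly_Mapping.lookup D j + pairing m (v j)" for j
    by arith
  then show ?thesis by (simp add: lattice_points_def)
qed

lemma lattice_points_of_exponent:
  assumes a: "exp_divisor a = D + char_divisor v m"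
  shows "m \<in> lattice_points v D"
  unfolding lattice_points_iff by (metis a char_lookup exp_divisor_lookup lookup_add of_nat_0_le_iff)

text \<open>At a lattice point all coefficients are nonnegative, so \<open>nat\<close> truncates
  nothing. With the preceding lemma this matches lattice points of \<open>D\<close> with the
  monomials in the class of \<open>D\<close>.\<close>

lemma exp_divisor_map_nat:
  assumes m: "m \<in> lattice_points v D"
  shows "exp_divisor (Poly_Mapping.map nat (D + char_divisor v m)) = D + char_divisor v m"
proof (rule poly_mapping_eqI)
  fix j
  have "Poly_Mapping.lookup D j + pairing m (v j) \<ge> 0"
    using m by (simp add: lattice_points_iff)
  then show "Poly_Mapping.lookup (exp_divisor (Poly_Mapping.map nat (D + char_divisor v m))) j
      = Poly_Mapping.lookup (D + char_divisor v m) j"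
    by (simp add: map.rep_eq when_def lookup_add)
qed

lemma lattice_points_char:
  "m \<in> lattice_points v (D + char_divisor v m') \<longleftrightarrow> m + m' \<in> lattice_points v D"
  by (auto simp: lattice_points_def lookup_add pairing_add algebra_simps)

lemma card_lattice_points_class:
  assumes "div_class v D = div_class v D'"
  shows "card (lattice_points v D) = card (lattice_points v D')"
proof -
  obtain m where m: "D = D' + char_divisor v m" using assms div_class_eq_iff by metis
  have "bij_betw (\<lambda>x. x + m) (lattice_points v D) (lattice_points v D')"
    by (rule bij_betw_byWitness[where f' = "\<lambda>x. x - m"]) (auto simp: m lattice_points_char)
  then show ?thesis by (rule bij_betw_same_card)
qed

text \<open>The representative picked in \<open>class_polytope\<close> differs from \<open>D\<close>
  by the divisor of a character, which only translates the lattice points.\<close>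

lemma card_class_polytope:
  "card (class_polytope v (div_class v D) \<inter> lattice_M) = card (lattice_points v D)"
proof -
  define D' where "D' = (SOME D'. D' \<in> div_class v D)"
  have "D \<in> div_class v D" unfolding mem_div_class by (rule exI[of _ 0]) simp
  then have "D' \<in> div_class v D" unfolding D'_def by (rule someI)
  then have eq: "div_class v D' = div_class v D" by (simp add: div_class_eq_iff mem_div_class)
  have iff: "rvec m \<bullet> rvec (v j) \<ge> - real_of_int (Poly_Mapping.lookup D' j)
      \<longleftrightarrow> pairing m (v j) \<ge> - Poly_Mapping.lookup D' j" for m j
    unfolding rvec_inner by linarith
  have "class_polytope v (div_class v D) \<inter> lattice_M = rvec ` lattice_points v D'"
    by (auto simp: class_polytope_def div_polytope_def lattice_M_def lattice_points_def iff
        simp flip: D'_def)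
  then show ?thesis
    by (simp add: card_image inj_on_subset[OF inj_rvec] card_lattice_points_class[OF eq])
qed

text \<open>Both sides say that the class contains an effective divisor. The partial order on
  classes is handled through this criterion from here on.\<close>

lemma Nbeta_iff: "div_class v D \<in> Nbeta v \<longleftrightarrow> lattice_points v D \<noteq> {}"
proof
  assume "div_class v D \<in> Nbeta v"
  then obtain a m where "exp_divisor a = D + char_divisor v m"
    unfolding Nbeta_def mon_degree_class by (metis div_class_eq_iff imageE)
  then have "m \<in> lattice_points v D" by (rule lattice_points_of_exponent)
  then show "lattice_points v D \<noteq> {}" by blast
next
  assume "lattice_points v D \<noteq> {}"
  then obtain m where "m \<in> lattice_points v D" by blast
  then obtain a where "exp_divisor a = D + char_divisor v m" using exp_divisor_map_nat by blast
  then have "mon_degree v a = div_class v D"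
    unfolding mon_degree_class by (simp add: div_class_eq_iff) blast
  then show "div_class v D \<in> Nbeta v" by (auto simp: Nbeta_def)
qed

lemma graded_piece_iff: "f \<in> graded_piece v (div_class v D) \<longleftrightarrow>
    (\<forall>a\<in>Poly_Mapping.keys f. \<exists>m. exp_divisor a = D + char_divisor v m)"
  by (auto simp: graded_piece_def mon_degree_class div_class_eq_iff)

section \<open>Complete simplicial fans\<close>

text \<open>A complete simplicial fan in combinatorial form: \<open>\<Delta>\<close> is the set of the index sets of its cones.\<close>

locale fan_complex =
  fixes \<Delta> :: "'r::finite set set" and u :: "'r \<Rightarrow> 'e::euclidean_space"
  assumes down: "J \<in> \<Delta> \<Longrightarrow> K \<subseteq> J \<Longrightarrow> K \<in> \<Delta>"
    and rep_ex: "\<exists>c. (\<forall>j. c j \<ge> 0) \<and> {j. c j \<noteq> 0} \<in> \<Delta> \<and> x = (\<Sum>j\<in>UNIV. c j *\<^sub>R u j)"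
    and rep_unique: "\<lbrakk>\<forall>j. c j \<ge> 0; {j. c j \<noteq> 0} \<in> \<Delta>; \<forall>j. c' j \<ge> 0; {j. c' j \<noteq> 0} \<in> \<Delta>;
       (\<Sum>j\<in>UNIV. c j *\<^sub>R u j) = (\<Sum>j\<in>UNIV. c' j *\<^sub>R u j)\<rbrakk> \<Longrightarrow> c = c'"
begin

definition lin :: "('r \<Rightarrow> real) \<Rightarrow> 'e" where
  "lin c = (\<Sum>j\<in>UNIV. c j *\<^sub>R u j)"

lemma lin_add: "lin (\<lambda>j. c j + d j) = lin c + lin d"
  by (simp add: lin_def scaleR_left_distrib sum.distrib)

lemma lin_diff: "lin (\<lambda>j. c j - d j) = lin c - lin d"
  by (simp add: lin_def scaleR_left_diff_distrib sum_subtractf)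

lemma lin_scale: "lin (\<lambda>j. t * c j) = t *\<^sub>R lin c"
  by (simp add: lin_def scaleR_sum_right)

lemma lin_inner: "m \<bullet> lin c = (\<Sum>j\<in>UNIV. c j * (m \<bullet> u j))"
  by (simp add: lin_def inner_sum_right)

lemma lin_sum: "(\<And>j. j \<notin> J \<Longrightarrow> c j = 0) \<Longrightarrow> lin c = (\<Sum>j\<in>J. c j *\<^sub>R u j)"
  unfolding lin_def by (intro sum.mono_neutral_right) auto

lemma lin_in_span: "(\<And>j. j \<notin> J \<Longrightarrow> c j = 0) \<Longrightarrow> lin c \<in> span (u ` J)"
  by (subst lin_sum[of J]) (auto intro: span_sum[OF span_scale[OF span_base]])

lemma lin_unique:
  assumes "\<forall>j. c j \<ge> 0" "{j. c j \<noteq> 0} \<in> \<Delta>" "\<forall>j. c' j \<ge> 0" "{j. c' j \<noteq> 0} \<in> \<Delta>" "lin c = lin c'"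
  shows "c = c'"
  using rep_unique assms by (simp add: lin_def)

text \<open>Adding a relation \<open>d\<close> to a large multiple \<open>t\<close> of the sum of
  the generators of \<open>J\<close> changes neither the point nor the support, and keeps all
  coefficients nonnegative. Uniqueness of the representation then gives
  \<open>d = 0\<close>.\<close>

lemma lin_indep:
  assumes "J \<in> \<Delta>" "\<And>j. j \<notin> J \<Longrightarrow> d j = 0" "lin d = 0"
  shows "d = (\<lambda>_. 0)"
proof -
  define t where "t = 1 + (\<Sum>j\<in>UNIV. \<bar>d j\<bar>)"
  have t: "t + d j > 0" "t > 0" for j
  proof -
    have "\<bar>d j\<bar> \<le> (\<Sum>j\<in>UNIV. \<bar>d j\<bar>)" by (rule member_le_sum) auto
    then show "t + d j > 0" "t > 0" by (auto simp: t_def)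
  qed
  define c where "c j = (if j \<in> J then t else 0)" for j
  have pos: "c j + d j \<ge> 0" "c j \<ge> 0" for j
    using t(1)[of j] t(2) assms(2)[of j] by (auto simp: c_def less_imp_le)
  have s1: "{j. c j \<noteq> 0} = J" using t by (auto simp: c_def)
  have s2: "{j. c j + d j \<noteq> 0} = J"
  proof -
    have "c j + d j \<noteq> 0 \<longleftrightarrow> j \<in> J" for j
      using t(1)[of j] assms(2)[of j] by (auto simp: c_def)
    then show ?thesis by auto
  qed
  have "(\<lambda>j. c j + d j) = c"
    by (rule lin_unique) (use pos s1 s2 assms in \<open>auto simp: lin_add\<close>)
  then show ?thesis by (metis add_cancel_left_right)
qed

lemma indep_gens:
  assumes "J \<in> \<Delta>"
  shows "inj_on u J" "independent (u ` J)"
proof -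
  show inj: "inj_on u J"
  proof (rule inj_onI, rule ccontr)
    fix i j assume ij: "i \<in> J" "j \<in> J" "u i = u j" "i \<noteq> j"
    define d where "d k = (if k = i then 1 else if k = j then -1 else (0::real))" for k
    have "lin d = (\<Sum>k\<in>{i,j}. d k *\<^sub>R u k)" by (rule lin_sum) (auto simp: d_def)
    then have "lin d = 0" using ij by (simp add: d_def)
    then have "d = (\<lambda>_. 0)" using ij by (intro lin_indep[OF assms]) (auto simp: d_def)
    then have "d i = 0" by simp
    then show False by (simp add: d_def)
  qed
  show "independent (u ` J)"
    unfolding independent_explicit
  proof (intro conjI allI impI ballI)
    show "finite (u ` J)" by simp
    fix c v assume c: "(\<Sum>v\<in>u ` J. c v *\<^sub>R v) = 0" "v \<in> u ` J"
    define d where "d j = (if j \<in> J then c (u j) else 0)" for j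
    have "lin d = (\<Sum>j\<in>J. d j *\<^sub>R u j)" by (rule lin_sum) (auto simp: d_def)
    also have "\<dots> = 0" using c(1) by (simp add: d_def sum.reindex[OF inj])
    finally have "d = (\<lambda>_. 0)" by (intro lin_indep[OF assms]) (auto simp: d_def)
    then show "c v = 0" using c(2) by (auto simp: d_def fun_eq_iff split: if_splits)
  qed
qed

definition top :: "'r set set" where
  "top = {J \<in> \<Delta>. card J = DIM('e)}"

lemma top_span: "J \<in> top \<Longrightarrow> span (u ` J) = UNIV"
  using indep_gens[of J] card_ge_dim_independent[of "u ` J" UNIV]
  by (auto simp: top_def card_image)

definition crd :: "'r set \<Rightarrow> 'e \<Rightarrow> 'r \<Rightarrow> real" where
  "crd J x = (SOME c. (\<forall>j. j \<notin> J \<longrightarrow> c j = 0) \<and> lin c = x)"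

lemma crd:
  assumes "J \<in> top"
  shows "j \<notin> J \<Longrightarrow> crd J x j = 0" "lin (crd J x) = x"
proof -
  have "x \<in> span (u ` J)" using top_span[OF assms] by simp
  then obtain c where c: "x = (\<Sum>v\<in>u ` J. c v *\<^sub>R v)" by (auto simp: span_finite)
  define d where "d j = (if j \<in> J then c (u j) else 0)" for j
  have "lin d = (\<Sum>j\<in>J. d j *\<^sub>R u j)" by (rule lin_sum) (auto simp: d_def)
  also have "\<dots> = x"
    using indep_gens(1)[of J] assms by (simp add: c d_def sum.reindex top_def)
  finally have "\<exists>c. (\<forall>j. j \<notin> J \<longrightarrow> c j = 0) \<and> lin c = x"
    by (intro exI[of _ d]) (auto simp: d_def)
  from someI_ex[OF this] show "j \<notin> J \<Longrightarrow> crd J x j = 0" "lin (crd J x) = x"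
    by (auto simp: crd_def)
qed

lemma crd_eqI:
  assumes "J \<in> top" "\<And>j. j \<notin> J \<Longrightarrow> c j = 0" "lin c = x"
  shows "crd J x = c"
proof -
  have "(\<lambda>j. crd J x j - c j) = (\<lambda>_. 0)"
    using assms crd[OF assms(1)] by (intro lin_indep[of J]) (auto simp: top_def lin_diff)
  then show ?thesis by (simp add: fun_eq_iff)
qed

definition generic :: "'e \<Rightarrow> bool" where
  "generic w \<longleftrightarrow> (\<forall>K\<in>\<Delta>. card K < DIM('e) \<longrightarrow> w \<notin> span (u ` K))"

definition neg :: "'r set \<Rightarrow> 'e \<Rightarrow> 'r set" where
  "neg J w = {j \<in> J. crd J w j < 0}"

text \<open>The spans to be avoided are finitely many proper subspaces, hence a null set, whereas a
  nonempty open set is not one.\<close>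

lemma generic_in_open:
  assumes "open S" "S \<noteq> {}"
  shows "\<exists>w\<in>S. generic w"
proof (rule ccontr)
  assume "\<not> ?thesis"
  then have "S \<subseteq> (\<Union>K\<in>{K\<in>\<Delta>. card K < DIM('e)}. span (u ` K))"
    by (auto simp: generic_def)
  moreover have "negligible (\<Union>K\<in>{K\<in>\<Delta>. card K < DIM('e)}. span (u ` K))"
  proof (rule negligible_Union)
    show "finite ((\<lambda>K. span (u ` K)) ` {K \<in> \<Delta>. card K < DIM('e)})" by simp
    fix t assume "t \<in> (\<lambda>K. span (u ` K)) ` {K \<in> \<Delta>. card K < DIM('e)}"
    then obtain K where K: "card K < DIM('e)" "t = span (u ` K)" by auto
    have "dim (span (u ` K)) \<le> card (u ` K)" by (simp add: dim_le_card')
    also have "\<dots> \<le> card K" by (rule card_image_le) simp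
    finally show "negligible t" using K by (intro negligible_lowdim) simp
  qed
  ultimately show False
    using negligible_subset open_not_negligible assms by blast
qed

lemma generic_crd:
  assumes "generic w" "J \<in> top" "j \<in> J"
  shows "crd J w j \<noteq> 0"
proof
  assume 0: "crd J w j = 0"
  have "lin (crd J w) \<in> span (u ` (J - {j}))"
    using crd(1)[OF assms(2)] 0 by (intro lin_in_span) auto
  then have "w \<in> span (u ` (J - {j}))" by (simp add: crd[OF assms(2)])
  moreover have "J - {j} \<in> \<Delta>" using assms(2) down[of J] by (auto simp: top_def)
  moreover have "card (J - {j}) < DIM('e)"
    using assms(2,3) by (auto simp: top_def intro!: psubset_card_mono)
  ultimately show False using assms(1) by (auto simp: generic_def)
qed

text \<open>Let \<open>x\<close> be the sum of the generators of \<open>K\<close>, a point in the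
  relative interior of that cone. The required \<open>J\<close> is the maximal cone entered on
  moving from \<open>x\<close> a little in the direction \<open>w\<close>: only the coordinates in
  \<open>K\<close> are positive at \<open>x\<close>, so only those of \<open>w\<close> may be
  negative.\<close>

lemma local_top_exists:
  assumes K: "K \<in> \<Delta>" and w: "generic w"
  shows "\<exists>J\<in>top. K \<subseteq> J \<and> neg J w \<subseteq> K"
proof -
  define x where "x = lin (\<lambda>j. of_bool (j \<in> K))"
  define \<delta> where "\<delta> i = 1 / real (Suc i)" for i
  have \<delta>: "\<delta> i > 0" for i by (simp add: \<delta>_def)
  have "\<exists>c. (\<forall>j. c j \<ge> 0) \<and> {j. c j \<noteq> 0} \<in> \<Delta> \<and> lin c = x + \<delta> i *\<^sub>R w" for i
    using rep_ex[of "x + \<delta> i *\<^sub>R w"] by (auto simp: lin_def)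
  then obtain c where c: "\<And>i j. c i j \<ge> 0" "\<And>i. {j. c i j \<noteq> 0} \<in> \<Delta>"
    "\<And>i. lin (c i) = x + \<delta> i *\<^sub>R w"
    by metis
  \<comment> \<open>There are finitely many cones, so one of them contains infinitely many points of
    the sequence that approaches \<open>x\<close>.\<close>
  have "\<exists>i0\<in>UNIV. infinite {i\<in>UNIV. {j. c i j \<noteq> 0} = {j. c i0 j \<noteq> 0}}"
    by (rule pigeonhole_infinite) auto
  then obtain J where inf: "infinite {i. {j. c i j \<noteq> 0} = J}" and J: "J \<in> \<Delta>"
    using c(2) by auto
  obtain i where i: "{j. c i j \<noteq> 0} = J"
    using infinite_nat_iff_unbounded[of "{i. {j. c i j \<noteq> 0} = J}"] inf by auto
  obtain i' where i': "i' > i" "{j. c i' j \<noteq> 0} = J"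
    using infinite_nat_iff_unbounded[of "{i. {j. c i j \<noteq> 0} = J}"] inf by auto
  have ij: "c i j = 0" "c i' j = 0" if "j \<notin> J" for j using i i'(2) that by blast+
  have dd: "\<delta> i - \<delta> i' > 0" using i'(1) by (simp add: \<delta>_def frac_less2)
  \<comment> \<open>Two points of the sequence in the same cone determine the coordinates
    \<open>d\<close> of the direction \<open>w\<close> in that cone, and from these the coordinates
    \<open>e\<close> of \<open>x\<close>. They are nonnegative because the sequence approaches
    \<open>x\<close> inside the cone.\<close>
  define d where "d j = (1 / (\<delta> i - \<delta> i')) * (c i j - c i' j)" for j
  have d0: "d j = 0" if "j \<notin> J" for j using ij[OF that] by (simp add: d_def)
  have wd: "lin d = w"
  proof -
    have "lin d = (1 / (\<delta> i - \<delta> i')) *\<^sub>R lin (\<lambda>j. c i j - c i' j)"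
      unfolding d_def by (rule lin_scale)
    also have "lin (\<lambda>j. c i j - c i' j) = lin (c i) - lin (c i')" by (rule lin_diff)
    also have "\<dots> = (\<delta> i - \<delta> i') *\<^sub>R w" by (simp add: c(3) scaleR_left_diff_distrib)
    finally show ?thesis using dd by simp
  qed
  define e where "e j = c i j - \<delta> i * d j" for j
  have e0: "e j = 0" if "j \<notin> J" for j using ij[OF that] d0[OF that] by (simp add: e_def)
  have xe: "lin e = x"
  proof -
    have "lin e = lin (c i) - lin (\<lambda>j. \<delta> i * d j)" unfolding e_def by (rule lin_diff)
    then show ?thesis by (simp add: lin_scale c(3) wd)
  qed
  have epos: "e j + \<delta> k * d j > 0" if "{j. c k j \<noteq> 0} = J" "j \<in> J" for k j
  proof -
    have "(\<lambda>j. (e j + \<delta> k * d j) - c k j) = (\<lambda>_. 0)"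
    proof (rule lin_indep[OF J])
      have "lin (\<lambda>j. (e j + \<delta> k * d j) - c k j) = lin (\<lambda>j. e j + \<delta> k * d j) - lin (c k)"
        by (rule lin_diff)
      also have "lin (\<lambda>j. e j + \<delta> k * d j) = lin e + lin (\<lambda>j. \<delta> k * d j)" by (rule lin_add)
      finally show "lin (\<lambda>j. (e j + \<delta> k * d j) - c k j) = 0" by (simp add: lin_scale c(3) wd xe)
      fix j assume "j \<notin> J"
      moreover from this have "c k j = 0" using that(1) by blast
      ultimately show "e j + \<delta> k * d j - c k j = 0" using e0 d0 by simp
    qed
    then have "e j + \<delta> k * d j = c k j" by (metis eq_iff_diff_eq_0)
    moreover have "c k j \<noteq> 0" using that by blast
    ultimately show ?thesis using c(1)[of k j] by simp
  qed
  have enn: "e j \<ge> 0" for j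
  proof (cases "j \<in> J")
    case True
    show ?thesis
    proof (rule ccontr)
      assume "\<not> ?thesis"
      then have ej: "e j < 0" by simp
      obtain n :: nat where n: "\<bar>d j\<bar> / - e j < real n" using reals_Archimedean2 by blast
      obtain k where k: "k > n" "{j. c k j \<noteq> 0} = J"
        using infinite_nat_iff_unbounded[of "{i. {j. c i j \<noteq> 0} = J}"] inf by auto
      have "\<bar>d j\<bar> < real n * - e j" using n ej by (simp add: field_simps)
      also have "\<dots> \<le> real (Suc k) * - e j" using k ej by (intro mult_right_mono) auto
      finally have "\<delta> k * \<bar>d j\<bar> < - e j" by (simp add: \<delta>_def field_simps)
      moreover have "\<delta> k * d j \<le> \<delta> k * \<bar>d j\<bar>" using \<delta>[of k] by (intro mult_left_mono) auto
      ultimately show False using epos[OF k(2) True] by simp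
    qed
  qed (simp add: e0)
  have "e = (\<lambda>j. of_bool (j \<in> K))"
  proof (rule lin_unique)
    show "{j. e j \<noteq> 0} \<in> \<Delta>" using e0 by (intro down[OF J]) auto
    show "{j. of_bool (j \<in> K) \<noteq> (0::real)} \<in> \<Delta>" using K by simp
  qed (use enn xe x_def in auto)
  then have e: "e j = of_bool (j \<in> K)" for j by simp
  have KJ: "K \<subseteq> J" using e0 by (force simp: e)
  have dpos: "d j > 0" if "j \<in> J" "j \<notin> K" for j
    using epos[OF i that(1)] that(2) \<delta>[of i] by (simp add: e zero_less_mult_iff)
  have "w \<in> span (u ` J)" using lin_in_span[of J d] d0 wd by simp
  then have "card J \<ge> DIM('e)" using w J by (force simp: generic_def)
  moreover have "card J \<le> DIM('e)"
    using indep_gens[OF J] independent_bound[of "u ` J"] by (simp add: card_image)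
  ultimately have top: "J \<in> top" using J by (simp add: top_def)
  have "crd J w = d" by (rule crd_eqI[OF top d0 wd])
  then have "neg J w \<subseteq> K" using dpos by (force simp: neg_def)
  then show ?thesis using top KJ by blast
qed

text \<open>With \<open>t\<close> larger than all coordinates of \<open>w\<close> in both cones,
  \<open>w\<close> plus \<open>t\<close> times the sum of the generators of \<open>K\<close> has
  positive coordinates on all of \<open>J\<close> and on all of \<open>J'\<close>. A point is
  represented only once, so the supports agree.\<close>

lemma local_top_unique:
  assumes w: "generic w" and J: "J \<in> top" "K \<subseteq> J" "neg J w \<subseteq> K"
    and J': "J' \<in> top" "K \<subseteq> J'" "neg J' w \<subseteq> K"
  shows "J = J'"
proof -
  define t where "t = 1 + (\<Sum>j\<in>UNIV. \<bar>crd J w j\<bar>) + (\<Sum>j\<in>UNIV. \<bar>crd J' w j\<bar>)"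
  define c where "c I j = t * of_bool (j \<in> K) + crd I w j" for I j
  have nn: "(\<forall>j. c I j \<ge> 0) \<and> {j. c I j \<noteq> 0} = I"
    if I: "I \<in> top" "K \<subseteq> I" "neg I w \<subseteq> K" "I = J \<or> I = J'" for I
  proof -
    have bound: "\<bar>crd I w j\<bar> < t" for j
    proof -
      have "\<bar>crd J w j\<bar> \<le> (\<Sum>j\<in>UNIV. \<bar>crd J w j\<bar>)" by (rule member_le_sum) auto
      moreover have "\<bar>crd J' w j\<bar> \<le> (\<Sum>j\<in>UNIV. \<bar>crd J' w j\<bar>)" by (rule member_le_sum) auto
      moreover have "0 \<le> (\<Sum>j\<in>UNIV. \<bar>crd J w j\<bar>)" "0 \<le> (\<Sum>j\<in>UNIV. \<bar>crd J' w j\<bar>)"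
        by (auto intro: sum_nonneg)
      ultimately show ?thesis using I(4) unfolding t_def by auto
    qed
    have pos: "c I j > 0" if "j \<in> I" for j
    proof (cases "j \<in> K")
      case True
      then show ?thesis using bound[of j] by (simp add: c_def)
    next
      case False
      then have "crd I w j \<ge> 0" using I(3) that by (auto simp: neg_def)
      then show ?thesis using generic_crd[OF w I(1) that] False by (simp add: c_def)
    qed
    have zero: "c I j = 0" if "j \<notin> I" for j
      using crd(1)[OF I(1) that] I(2) that by (auto simp: c_def)
    have "c I j \<ge> 0 \<and> (c I j \<noteq> 0 \<longleftrightarrow> j \<in> I)" for j
      using pos[of j] zero[of j] by fastforce
    then show ?thesis by auto
  qed
  have "c J = c J'"
  proof (rule lin_unique)
    show "lin (c J) = lin (c J')"
      unfolding c_def lin_add crd(2)[OF J(1)] crd(2)[OF J'(1)] by simp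
  qed (use nn J J' in \<open>auto simp: top_def\<close>)
  then show ?thesis using nn J J' by metis
qed

lemma interval_alternating_sum:
  assumes "finite B"
  shows "(\<Sum>K | A \<subseteq> K \<and> K \<subseteq> B. (-1) ^ card K) = (if A = B then (-1) ^ card B else (0::int))"
proof -
  consider "A = B" | "A \<subset> B" | "\<not> A \<subseteq> B" by blast
  then show ?thesis
  proof cases
    case 1
    then have "{K. A \<subseteq> K \<and> K \<subseteq> B} = {B}" by auto
    then show ?thesis using 1 by simp
  next
    case 2
    have fin: "finite {K. A \<subseteq> K \<and> K \<subseteq> B}"
      by (rule finite_subset[of _ "Pow B"]) (use assms in auto)
    have "(\<Sum>K | A \<subseteq> K \<and> K \<subseteq> B. (-1) ^ card K) = (0::int)"
    proof (rule sum_alternating_cancels[OF fin])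
      have "{x \<in> {K. A \<subseteq> K \<and> K \<subseteq> B}. even (card x)} = {T. T \<subseteq> B \<and> A \<subseteq> T \<and> even (card T)}"
        "{x \<in> {K. A \<subseteq> K \<and> K \<subseteq> B}. odd (card x)} = {T. T \<subseteq> B \<and> A \<subseteq> T \<and> odd (card T)}"
        by auto
      then show "card {x \<in> {K. A \<subseteq> K \<and> K \<subseteq> B}. even (card x)}
          = card {x \<in> {K. A \<subseteq> K \<and> K \<subseteq> B}. odd (card x)}"
        using card_subsupersets_even_odd[OF assms 2] by (simp only:)
    qed
    moreover have "A \<noteq> B" using 2 by blast
    ultimately show ?thesis by (simp only: if_False)
  next
    case 3
    then have "{K. A \<subseteq> K \<and> K \<subseteq> B} = {}" by auto
    moreover have "A \<noteq> B" using 3 by blast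
    ultimately show ?thesis by (simp only: if_False sum.empty)
  qed
qed

text \<open>The left-hand side does not mention \<open>w\<close>, so the sum on the right is the same for all generic
  vectors; this replaces a wall-crossing argument.\<close>

lemma euler_sum:
  assumes w: "generic w"
  shows "(\<Sum>K | K \<in> \<Delta> \<and> K \<subseteq> U. (-1) ^ card K) =
    (\<Sum>J | J \<in> top \<and> neg J w = J \<inter> U. (-1) ^ card (J \<inter> U) :: int)"
proof -
  \<comment> \<open>For fixed \<open>w\<close> the fan is partitioned into intervals
    \<open>neg J w \<subseteq> K \<subseteq> J\<close>, one for each maximal cone. Within an
    interval, the faces contained in \<open>U\<close> cancel unless there is exactly one of
    them.\<close>
  let ?R = "\<lambda>J K. K \<subseteq> J \<and> neg J w \<subseteq> K"
  have "(\<Sum>K | K \<in> \<Delta> \<and> K \<subseteq> U. (-1) ^ card K)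
      = (\<Sum>K | K \<in> \<Delta> \<and> K \<subseteq> U. \<Sum>J | J \<in> top \<and> ?R J K. (-1) ^ card K :: int)"
  proof (rule sum.cong[OF refl])
    fix K assume "K \<in> {K. K \<in> \<Delta> \<and> K \<subseteq> U}"
    then obtain J where J: "J \<in> top" "?R J K" using local_top_exists[OF _ w] by blast
    then have "{J. J \<in> top \<and> ?R J K} = {J}" using local_top_unique[OF w] by blast
    then show "(-1) ^ card K = (\<Sum>J | J \<in> top \<and> ?R J K. (-1) ^ card K :: int)" by simp
  qed
  also have "\<dots> = (\<Sum>J\<in>top. \<Sum>K | K \<in> {K. K \<in> \<Delta> \<and> K \<subseteq> U} \<and> ?R J K. (-1) ^ card K)"
    by (subst sum.swap_restrict) auto
  also have "\<dots> = (\<Sum>J\<in>top. if neg J w = J \<inter> U then (-1) ^ card (J \<inter> U) else 0)"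
  proof (rule sum.cong[OF refl])
    fix J assume J: "J \<in> top"
    then have "{K. K \<in> {K. K \<in> \<Delta> \<and> K \<subseteq> U} \<and> ?R J K} = {K. neg J w \<subseteq> K \<and> K \<subseteq> J \<inter> U}"
      using down[of J] by (auto simp: top_def)
    then show "(\<Sum>K | K \<in> {K. K \<in> \<Delta> \<and> K \<subseteq> U} \<and> ?R J K. (-1) ^ card K)
      = (if neg J w = J \<inter> U then (-1) ^ card (J \<inter> U) else (0::int))"
      by (simp only: interval_alternating_sum finite)
  qed
  also have "\<dots> = (\<Sum>J | J \<in> top \<and> neg J w = J \<inter> U. (-1) ^ card (J \<inter> U))"
    by (rule sum.inter_filter[symmetric]) simp
  finally show ?thesis .
qed

lemma empty_mem: "{} \<in> \<Delta>"
  using rep_ex[of 0] down by blast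

text \<open>The data of a nef divisor: its coefficients \<open>a\<close>, and for each maximal cone \<open>J\<close> the character
  \<open>\<mu> J\<close> that gives the divisor on the chart of \<open>J\<close>, a vertex of the polytope.\<close>

definition nef_data :: "('r \<Rightarrow> real) \<Rightarrow> ('r set \<Rightarrow> 'e) \<Rightarrow> bool" where
  "nef_data a \<mu> \<longleftrightarrow> (\<forall>J\<in>top. (\<forall>j\<in>J. \<mu> J \<bullet> u j = - a j) \<and> (\<forall>j. \<mu> J \<bullet> u j \<ge> - a j))"

text \<open>If \<open>m\<close> satisfies all inequalities, only the zero cone is counted on the
  other side of the Euler sum. If it violates the one at \<open>j0\<close>, the sum may be evaluated
  at a generic \<open>w\<close> close to \<open>u j0\<close>, where every term disappears: there
  \<open>m\<close> is smaller than all the vertices.\<close>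

lemma nef_indicator:
  fixes m :: 'e
  assumes nef: "nef_data a \<mu>" and l: "generic l"
  defines "N \<equiv> {j. m \<bullet> u j < - a j}"
  shows "(\<Sum>J | J \<in> top \<and> neg J l = J \<inter> N. (-1) ^ card (J \<inter> N)) = (if N = {} then 1 else 0::int)"
proof (cases "N = {}")
  case True
  have "{K. K \<in> \<Delta> \<and> K \<subseteq> {}} = {{}}" using empty_mem by auto
  then show ?thesis using euler_sum[OF l, of N] True by simp
next
  case False
  then obtain j0 where j0: "j0 \<in> N" by blast
  define S where "S = (\<Inter>J\<in>top. {x. (m - \<mu> J) \<bullet> x < 0})"
  have "open S" unfolding S_def
    by (intro open_INT ballI open_halfspace_lt) auto
  moreover have "u j0 \<in> S"
  proof -
    have "(m - \<mu> J) \<bullet> u j0 < 0" if "J \<in> top" for J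
    proof -
      have "\<mu> J \<bullet> u j0 \<ge> - a j0" using nef that by (simp add: nef_data_def)
      moreover have "m \<bullet> u j0 < - a j0" using j0 by (simp add: N_def)
      ultimately show ?thesis by (simp add: inner_diff_left)
    qed
    then show ?thesis by (simp add: S_def)
  qed
  ultimately obtain w where w: "w \<in> S" "generic w" using generic_in_open by blast
  \<comment> \<open>Equality would give each coordinate of \<open>w\<close> in \<open>J\<close> the
    same sign as the corresponding value of \<open>m - \<mu> J\<close>, and so
    \<open>m - \<mu> J\<close> would be nonnegative on \<open>w\<close>.\<close>
  have "neg J w \<noteq> J \<inter> N" if J: "J \<in> top" for J
  proof
    assume eq: "neg J w = J \<inter> N"
    have "(m - \<mu> J) \<bullet> w = (m - \<mu> J) \<bullet> lin (crd J w)" by (simp add: crd(2)[OF J])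
    also have "\<dots> = (\<Sum>j\<in>UNIV. crd J w j * ((m - \<mu> J) \<bullet> u j))" by (rule lin_inner)
    also have "\<dots> \<ge> 0"
    proof (rule sum_nonneg)
      fix j
      show "crd J w j * ((m - \<mu> J) \<bullet> u j) \<ge> 0"
      proof (cases "j \<in> J")
        case True
        then have e: "(m - \<mu> J) \<bullet> u j = m \<bullet> u j + a j"
          using nef J by (simp add: nef_data_def inner_diff_left)
        show ?thesis
        proof (cases "j \<in> N")
          case inN: True
          then have "j \<in> neg J w" using True eq by blast
          then show ?thesis using inN e by (auto simp: neg_def N_def intro!: mult_nonpos_nonpos)
        next
          case notN: False
          then have "j \<notin> neg J w" using eq by blast
          then show ?thesis using True notN e by (auto simp: neg_def N_def intro!: mult_nonneg_nonneg)
        qed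
      qed (simp add: crd(1)[OF J])
    qed
    finally show False using w(1) J by (auto simp: S_def)
  qed
  then have "{J. J \<in> top \<and> neg J w = J \<inter> N} = {}" by blast
  then show ?thesis using euler_sum[OF l, of N] euler_sum[OF w(2), of N] False
    by (simp only: sum.empty if_False)
qed

end

section \<open>From cones to the combinatorial form of the fan\<close>

lemma convex_cone_hull_image:
  assumes "finite I"
  shows "convex_cone hull (f ` I) = {\<Sum>i\<in>I. c i *\<^sub>R f i | c. \<forall>i\<in>I. c i \<ge> 0}" (is "_ = ?R")
proof
  show "convex_cone hull (f ` I) \<subseteq> ?R"
  proof (rule hull_minimal)
    show "f ` I \<subseteq> ?R"
    proof
      fix x assume "x \<in> f ` I"
      then obtain i where i: "i \<in> I" "x = f i" by blast
      have "(\<Sum>k\<in>I. of_bool (k = i) *\<^sub>R f k) = (\<Sum>k\<in>I. if k = i then f k else 0)"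
        by (rule sum.cong) auto
      then have "x = (\<Sum>k\<in>I. of_bool (k = i) *\<^sub>R f k)" using i assms by simp
      then show "x \<in> ?R" by (intro CollectI exI[of _ "\<lambda>k. of_bool (k = i)"]) auto
    qed
    show "convex_cone ?R"
      unfolding convex_cone_iff
    proof (intro conjI ballI allI impI)
      show "0 \<in> ?R" by (intro CollectI exI[of _ "\<lambda>_. 0"]) auto
      fix x assume "x \<in> ?R"
      then obtain c where c: "x = (\<Sum>i\<in>I. c i *\<^sub>R f i)" "\<forall>i\<in>I. c i \<ge> 0" by blast
      show "t *\<^sub>R x \<in> ?R" if "t \<ge> 0" for t
        using c that by (intro CollectI exI[of _ "\<lambda>i. t * c i"]) (auto simp: scaleR_sum_right)
      fix y assume "y \<in> ?R"
      then obtain d where d: "y = (\<Sum>i\<in>I. d i *\<^sub>R f i)" "\<forall>i\<in>I. d i \<ge> 0" by blast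
      show "x + y \<in> ?R"
        using c d by (intro CollectI exI[of _ "\<lambda>i. c i + d i"])
          (auto simp: scaleR_left_distrib sum.distrib)
    qed
  qed
  show "?R \<subseteq> convex_cone hull (f ` I)"
  proof
    fix x assume "x \<in> ?R"
    then obtain c where c: "x = (\<Sum>i\<in>I. c i *\<^sub>R f i)" "\<forall>i\<in>I. c i \<ge> 0" by blast
    have "(\<Sum>i\<in>K. c i *\<^sub>R f i) \<in> convex_cone hull (f ` I)" if "finite K" "K \<subseteq> I" for K
      using that
    proof (induction K rule: finite_induct)
      case empty
      show ?case by (simp add: convex_cone_hull_contains_0)
    next
      case (insert k K)
      then have "c k *\<^sub>R f k \<in> convex_cone hull (f ` I)"
        using c(2) by (intro convex_cone_hull_mul hull_inc) auto
      then show ?case using insert by (simp add: convex_cone_hull_add)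
    qed
    then show "x \<in> convex_cone hull (f ` I)" using assms c(1) by blast
  qed
qed

text \<open>Faces are defined by segments, while cones call for sums; the factor 2 makes
  \<open>a + b\<close> the midpoint of two points of the cone.\<close>

lemma face_of_sum:
  assumes F: "F face_of C" and ab: "2 *\<^sub>R a \<in> C" "2 *\<^sub>R b \<in> C" "a + b \<in> F"
  shows "2 *\<^sub>R a \<in> F"
proof (cases "a = b")
  case True
  then show ?thesis using ab by (simp add: scaleR_2)
next
  case False
  then have "midpoint (2 *\<^sub>R a) (2 *\<^sub>R b) \<in> open_segment (2 *\<^sub>R a) (2 *\<^sub>R b)" by simp
  moreover have "midpoint (2 *\<^sub>R a) (2 *\<^sub>R b) = a + b"
    by (simp add: midpoint_def scaleR_right_distrib)
  ultimately show ?thesis using F ab by (auto simp: face_of_def)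
qed

text \<open>Unlike \<^const>\<open>independent\<close>, this excludes repeated vectors.\<close>

definition indep_on :: "'r set \<Rightarrow> ('r \<Rightarrow> 'e::real_vector) \<Rightarrow> bool" where
  "indep_on J f \<longleftrightarrow> (\<forall>d. (\<Sum>j\<in>J. d j *\<^sub>R f j) = 0 \<longrightarrow> (\<forall>j\<in>J. d j = 0))"

lemma indep_onD: "indep_on J f \<Longrightarrow> (\<Sum>j\<in>J. d j *\<^sub>R f j) = 0 \<Longrightarrow> j \<in> J \<Longrightarrow> d j = 0"
  unfolding indep_on_def by blast

lemma indep_on_eqD:
  assumes "indep_on J f" "(\<Sum>j\<in>J. c j *\<^sub>R f j) = (\<Sum>j\<in>J. d j *\<^sub>R f j)" "j \<in> J"
  shows "c j = d j"
proof -
  have "(\<Sum>j\<in>J. (c j - d j) *\<^sub>R f j) = 0"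
    using assms(2) by (simp add: scaleR_left_diff_distrib sum_subtractf)
  then have "c j - d j = 0"
    by (rule indep_onD[OF assms(1) _ assms(3), of "\<lambda>j. c j - d j"])
  then show ?thesis by simp
qed

text \<open>Coefficients are unique by independence, and a proper convex combination of nonnegative
  coefficients vanishes only if both of them do.\<close>

lemma face_of_simplicial_cone:
  assumes "finite J" "indep_on J f" "K \<subseteq> J"
  shows "(convex_cone hull (f ` K)) face_of (convex_cone hull (f ` J))"
proof -
  have memK: "x \<in> convex_cone hull (f ` K) \<longleftrightarrow>
      (\<exists>c. x = (\<Sum>i\<in>J. c i *\<^sub>R f i) \<and> (\<forall>i\<in>J. c i \<ge> 0) \<and> (\<forall>i\<in>J-K. c i = 0))" for x
  proof
    assume "x \<in> convex_cone hull (f ` K)"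
    then obtain c where c: "x = (\<Sum>i\<in>K. c i *\<^sub>R f i)" "\<forall>i\<in>K. c i \<ge> 0"
      using assms finite_subset by (subst (asm) convex_cone_hull_image) blast+
    have "x = (\<Sum>i\<in>J. (if i \<in> K then c i else 0) *\<^sub>R f i)"
      unfolding c(1) using assms by (intro sum.mono_neutral_cong_left) auto
    then show "\<exists>c. x = (\<Sum>i\<in>J. c i *\<^sub>R f i) \<and> (\<forall>i\<in>J. c i \<ge> 0) \<and> (\<forall>i\<in>J-K. c i = 0)"
      using c(2) by (intro exI[of _ "\<lambda>i. if i \<in> K then c i else 0"]) auto
  next
    assume "\<exists>c. x = (\<Sum>i\<in>J. c i *\<^sub>R f i) \<and> (\<forall>i\<in>J. c i \<ge> 0) \<and> (\<forall>i\<in>J-K. c i = 0)"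
    then obtain c where c: "x = (\<Sum>i\<in>J. c i *\<^sub>R f i)" "\<forall>i\<in>J. c i \<ge> 0" "\<forall>i\<in>J-K. c i = 0" by blast
    have "x = (\<Sum>i\<in>K. c i *\<^sub>R f i)"
      unfolding c(1) using assms c(3) by (intro sum.mono_neutral_right) auto
    then show "x \<in> convex_cone hull (f ` K)"
      using c(2) assms finite_subset by (subst convex_cone_hull_image) blast+
  qed
  show ?thesis
    unfolding face_of_def
  proof (intro conjI ballI impI)
    show "convex_cone hull (f ` K) \<subseteq> convex_cone hull (f ` J)"
      using assms(3) by (intro hull_mono) auto
    show "convex (convex_cone hull (f ` K))" by (rule convex_convex_cone_hull)
    fix a b x assume a: "a \<in> convex_cone hull (f ` J)" and b: "b \<in> convex_cone hull (f ` J)"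
      and x: "x \<in> convex_cone hull (f ` K)" "x \<in> open_segment a b"
    obtain ca where ca: "a = (\<Sum>i\<in>J. ca i *\<^sub>R f i)" "\<forall>i\<in>J. ca i \<ge> 0"
      using a by (subst (asm) convex_cone_hull_image[OF assms(1)]) blast
    obtain cb where cb: "b = (\<Sum>i\<in>J. cb i *\<^sub>R f i)" "\<forall>i\<in>J. cb i \<ge> 0"
      using b by (subst (asm) convex_cone_hull_image[OF assms(1)]) blast
    obtain cx where cx: "x = (\<Sum>i\<in>J. cx i *\<^sub>R f i)" "\<forall>i\<in>J-K. cx i = 0"
      using x(1) unfolding memK by blast
    obtain t where t: "0 < t" "t < 1" "x = (1 - t) *\<^sub>R a + t *\<^sub>R b"
      using x(2) by (auto simp: in_segment)
    have "x = (\<Sum>i\<in>J. ((1 - t) * ca i + t * cb i) *\<^sub>R f i)"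
      by (simp add: t(3) ca(1) cb(1) scaleR_sum_right sum.distrib scaleR_left_distrib)
    then have e: "cx i = (1 - t) * ca i + t * cb i" if "i \<in> J" for i
      using indep_on_eqD[OF assms(2) _ that] cx(1) by metis
    have "ca i = 0 \<and> cb i = 0" if i: "i \<in> J - K" for i
    proof -
      have "(1 - t) * ca i + t * cb i = 0" using e[of i] i cx(2) by simp
      moreover have "(1 - t) * ca i \<ge> 0" "t * cb i \<ge> 0" using t i ca cb by auto
      ultimately have "(1 - t) * ca i = 0" "t * cb i = 0" by linarith+
      then show ?thesis using t by simp
    qed
    then show "a \<in> convex_cone hull (f ` K)" "b \<in> convex_cone hull (f ` K)"
      unfolding memK using ca cb by blast+
  qed
qed

lemma primitive_of_nonzero:
  fixes s :: "int ^ 'n"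
  assumes "s \<noteq> 0"
  obtains g u where "g > 0" "primitive u" "\<And>i. s $ i = g * u $ i"
proof -
  define g where "g = Gcd (range (\<lambda>i. s $ i))"
  have dvd: "g dvd s $ i" for i unfolding g_def by (rule Gcd_dvd) simp
  define u where "u = (\<chi> i. s $ i div g)"
  have su: "s $ i = g * u $ i" for i using dvd by (simp add: u_def)
  have g0: "g \<noteq> 0" using assms su by (auto simp: vec_eq_iff)
  moreover have "g \<ge> 0" unfolding g_def by (rule Gcd_int_greater_eq_0)
  ultimately have gpos: "g > 0" by simp
  have "range (\<lambda>i. s $ i) = (*) g ` range (\<lambda>i. u $ i)" by (auto simp: image_image su)
  then have "g = normalize (g * Gcd (range (\<lambda>i. u $ i)))"
    using Gcd_mult[of g "range (\<lambda>i. u $ i)"] g_def by simp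
  then have "g = g * Gcd (range (\<lambda>i. u $ i))" using gpos by (simp add: abs_mult)
  then have "primitive u" using g0 by (simp add: primitive_def)
  then show thesis using that gpos su by blast
qed

text \<open>The factor \<open>t\<close> is any positive real. A nonzero coordinate yields positive
  integers with \<open>q * s $ i = p * u $ i\<close> for all \<open>i\<close>, and comparing
  greatest common divisors gives \<open>p = q\<close>.\<close>

lemma primitive_unique:
  fixes s u :: "int ^ 'n"
  assumes "primitive s" "primitive u" "t > 0" "rvec s = t *\<^sub>R rvec u"
  shows "s = u"
proof -
  have r: "real_of_int (s $ i) = t * real_of_int (u $ i)" for i
    using arg_cong[OF assms(4), of "\<lambda>x. x $ i"] by (simp add: rvec_def)
  have "\<exists>i. u $ i \<noteq> 0"
  proof (rule ccontr)
    assume "\<not> ?thesis"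
    then have "range (\<lambda>i. u $ i) = {0}" by auto
    then show False using assms(2) by (simp add: primitive_def)
  qed
  then obtain i0 where i0: "u $ i0 \<noteq> 0" by blast
  define p q where "p = \<bar>s $ i0\<bar>" and "q = \<bar>u $ i0\<bar>"
  have tpq: "t * real_of_int q = real_of_int p"
    using r[of i0] assms(3) by (simp add: p_def q_def abs_mult)
  have "q * s $ i = p * u $ i" for i
  proof -
    have "real_of_int (q * s $ i) = real_of_int (p * u $ i)" by (simp add: r flip: tpq)
    then show ?thesis by linarith
  qed
  then have "(*) q ` range (\<lambda>i. s $ i) = (*) p ` range (\<lambda>i. u $ i)" by (auto simp: image_image)
  then have "normalize q = normalize p"
    using Gcd_mult[of q "range (\<lambda>i. s $ i)"] Gcd_mult[of p "range (\<lambda>i. u $ i)"] assms(1,2)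
    by (simp add: primitive_def)
  then have "p = q" by (simp add: p_def q_def)
  then have "t = 1" using tpq i0 by (simp add: q_def)
  then show ?thesis using r by (simp add: vec_eq_iff)
qed

lemma ray_eq: "ray w = {t *\<^sub>R rvec w | t. t \<ge> 0}"
proof -
  have "ray w = convex_cone hull (rvec ` {w})" by (simp add: ray_def)
  also have "\<dots> = {t *\<^sub>R rvec w | t. t \<ge> 0}"
    by (subst convex_cone_hull_image) (auto intro: exI[of _ "\<lambda>_. _"])
  finally show ?thesis .
qed

locale complete_simplicial =
  fixes \<Sigma> :: "(real ^ 'n) set set" and v :: "'r::finite \<Rightarrow> int ^ 'n"
  assumes complete: "complete_fan \<Sigma>" and simplicial: "simplicial_fan \<Sigma>"
    and gens: "bij_betw v UNIV (primitive_ray_generators \<Sigma>)"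
begin

lemma fan: "fan \<Sigma>" using complete by (simp add: complete_fan_def)

lemma v_inj: "v i = v j \<Longrightarrow> i = j"
  using gens by (auto simp: bij_betw_def inj_def)

lemma v_primitive: "primitive (v j)" and v_ray: "ray (v j) \<in> \<Sigma>"
proof -
  have "v j \<in> primitive_ray_generators \<Sigma>" using gens by (auto simp: bij_betw_def)
  then show "primitive (v j)" "ray (v j) \<in> \<Sigma>" by (auto simp: primitive_ray_generators_def)
qed

lemma rvec_v_nonzero: "rvec (v j) \<noteq> 0"
proof
  assume "rvec (v j) = 0"
  then have "range (\<lambda>i. v j $ i) = {0}" by (auto simp: rvec_def vec_eq_iff)
  then show False using v_primitive[of j] by (simp add: primitive_def)
qed

lemma face_mem: "\<sigma> \<in> \<Sigma> \<Longrightarrow> \<tau> face_of \<sigma> \<Longrightarrow> \<tau> \<noteq> {} \<Longrightarrow> \<tau> \<in> \<Sigma>"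
  using fan by (auto simp: fan_def)

text \<open>The simplicial generators are arbitrary real vectors. Each spans a face of its cone,
  which therefore belongs to the fan and is rational; an integral point on it, divided by the gcd of
  its coordinates, is one of the \<open>v j\<close>.\<close>

lemma ray_generator:
  assumes B: "finite B" "independent B" "convex_cone hull B \<in> \<Sigma>" and b: "b \<in> B"
  shows "\<exists>j t. t > 0 \<and> b = t *\<^sub>R rvec (v j)"
proof -
  have "indep_on B (\<lambda>x. x)"
    unfolding indep_on_def using B(1,2) independent_explicit_finite_subsets[of B] by auto
  then have "convex_cone hull {b} face_of convex_cone hull B"
    using face_of_simplicial_cone[OF B(1), of "\<lambda>x. x" "{b}"] b by simp
  then have mem: "convex_cone hull {b} \<in> \<Sigma>"
    by (rule face_mem[OF B(3) _ convex_cone_hull_nonempty])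
  have hb: "convex_cone hull {b} = {t *\<^sub>R b | t. t \<ge> 0}"
    using convex_cone_hull_image[of "{b}" "\<lambda>x. x"] by (auto intro: exI[of _ "\<lambda>_. _"])
  have b0: "b \<noteq> 0" using b B(2) dependent_zero by blast
  obtain S where S: "finite S" "convex_cone hull {b} = convex_cone hull (rvec ` S)"
  proof -
    have "rational_cone (convex_cone hull {b})" using mem fan by (simp add: fan_def)
    then show thesis using that unfolding rational_cone_def by blast
  qed
  have "\<exists>s\<in>S. rvec s \<noteq> 0"
  proof (rule ccontr)
    assume "\<not> ?thesis"
    then have "rvec ` S \<subseteq> {0}" by auto
    then have "convex_cone hull (rvec ` S) \<subseteq> {0}"
      by (intro hull_minimal) (auto simp: convex_cone_iff)
    then show False using S(2) b0 hull_inc[of b "{b}"] by auto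
  qed
  then obtain s where s: "s \<in> S" "rvec s \<noteq> 0" by blast
  have "rvec s \<in> convex_cone hull {b}" unfolding S(2) using s(1) by (intro hull_inc) simp
  then obtain t where t: "t \<ge> 0" "rvec s = t *\<^sub>R b" unfolding hb by blast
  then have tpos: "t > 0" using s(2) by (cases "t = 0") auto
  have "s \<noteq> 0" using s(2) by (auto simp: rvec_def vec_eq_iff)
  then obtain g u where g: "g > 0" "primitive u" "\<And>i. s $ i = g * u $ i"
    using primitive_of_nonzero by blast
  have su: "rvec s = real_of_int g *\<^sub>R rvec u" by (simp add: rvec_def vec_eq_iff g(3))
  have bu: "b = (g / t) *\<^sub>R rvec u"
  proof -
    have "(g / t) *\<^sub>R rvec u = (1 / t) *\<^sub>R rvec s" by (simp add: su)
    then show ?thesis using tpos t(2) by simp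
  qed
  have ub: "rvec u = (t / g) *\<^sub>R b" using g(1) tpos by (simp add: bu)
  have "ray u = convex_cone hull {b}"
  proof
    show "ray u \<subseteq> convex_cone hull {b}"
      unfolding ray_eq hb
    proof clarsimp
      fix r :: real assume "r \<ge> 0"
      then have "r *\<^sub>R rvec u = (r * (t / g)) *\<^sub>R b \<and> 0 \<le> r * (t / g)"
        using g(1) tpos ub by simp
      then show "\<exists>t. r *\<^sub>R rvec u = t *\<^sub>R b \<and> 0 \<le> t" by blast
    qed
    show "convex_cone hull {b} \<subseteq> ray u"
      unfolding ray_eq hb
    proof clarsimp
      fix r :: real assume "r \<ge> 0"
      then have "r *\<^sub>R b = (r * (g / t)) *\<^sub>R rvec u \<and> 0 \<le> r * (g / t)"
        using g(1) tpos by (subst bu) simp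
      then show "\<exists>t. r *\<^sub>R b = t *\<^sub>R rvec u \<and> 0 \<le> t" by blast
    qed
  qed
  then have "u \<in> primitive_ray_generators \<Sigma>"
    using mem g(2) by (simp add: primitive_ray_generators_def)
  then obtain j where "u = v j" using gens by (auto simp: bij_betw_def)
  then show ?thesis using bu g(1) tpos by (intro exI[of _ j] exI[of _ "g / t"]) simp
qed

text \<open>A ray of the fan contained in the cone is a face of it. When its generator is written as
  a nonnegative combination of the generators in \<open>J\<close>, the face property puts a nonzero
  summand on the ray, and primitivity identifies the two generators.\<close>

lemma cone_rays_of_hull:
  assumes J: "indep_on J (\<lambda>j. rvec (v j))" and mem: "convex_cone hull ((\<lambda>j. rvec (v j)) ` J) \<in> \<Sigma>"
  shows "cone_rays v (convex_cone hull ((\<lambda>j. rvec (v j)) ` J)) = J"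
proof
  let ?u = "\<lambda>j. rvec (v j)"
  let ?\<sigma> = "convex_cone hull (?u ` J)"
  show "J \<subseteq> cone_rays v ?\<sigma>"
  proof
    fix j assume "j \<in> J"
    then have "rvec (v j) \<in> ?\<sigma>" by (intro hull_inc) auto
    then show "j \<in> cone_rays v ?\<sigma>"
      by (auto simp: cone_rays_def ray_eq intro: convex_cone_hull_mul)
  qed
  show "cone_rays v ?\<sigma> \<subseteq> J"
  proof
    fix j assume "j \<in> cone_rays v ?\<sigma>"
    then have sub: "ray (v j) \<subseteq> ?\<sigma>" by (simp add: cone_rays_def)
    have "?\<sigma> \<inter> ray (v j) face_of ?\<sigma>" using fan mem v_ray[of j] by (auto simp: fan_def)
    then have face: "ray (v j) face_of ?\<sigma>" using sub by (simp add: Int_absorb1)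
    have uj: "?u j \<in> ray (v j)" unfolding ray_eq by (intro CollectI exI[of _ 1]) simp
    then have "?u j \<in> ?\<sigma>" using sub by blast
    then obtain c where c: "?u j = (\<Sum>k\<in>J. c k *\<^sub>R ?u k)" "\<forall>k\<in>J. c k \<ge> 0"
      by (subst (asm) convex_cone_hull_image) auto
    obtain k where k: "k \<in> J" "c k \<noteq> 0"
    proof (rule ccontr)
      assume "\<not> thesis"
      then have "\<forall>k\<in>J. c k = 0" using that by blast
      then show False using c(1) rvec_v_nonzero[of j] by simp
    qed
    have split: "?u j = c k *\<^sub>R ?u k + (\<Sum>i\<in>J-{k}. c i *\<^sub>R ?u i)"
      unfolding c(1) using k(1) by (subst sum.remove[of J k]) auto
    have "2 *\<^sub>R (c k *\<^sub>R ?u k) \<in> ray (v j)"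
    proof (rule face_of_sum[OF face])
      show "2 *\<^sub>R (c k *\<^sub>R ?u k) \<in> ?\<sigma>"
        using k c(2) by (intro convex_cone_hull_mul hull_inc) auto
      have "(\<Sum>i\<in>J-{k}. c i *\<^sub>R ?u i) \<in> convex_cone hull (?u ` (J - {k}))"
        using c(2) by (subst convex_cone_hull_image) auto
      moreover have "convex_cone hull (?u ` (J - {k})) \<subseteq> ?\<sigma>" by (intro hull_mono) auto
      ultimately show "2 *\<^sub>R (\<Sum>i\<in>J-{k}. c i *\<^sub>R ?u i) \<in> ?\<sigma>"
        by (intro convex_cone_hull_mul) auto
      show "c k *\<^sub>R ?u k + (\<Sum>i\<in>J-{k}. c i *\<^sub>R ?u i) \<in> ray (v j)" using uj split by simp
    qed
    then obtain t where t: "t \<ge> 0" "(2 * c k) *\<^sub>R ?u k = t *\<^sub>R ?u j" unfolding ray_eq by auto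
    have ck: "c k > 0" using k c(2) by (simp add: less_le)
    have "?u k = (1 / (2 * c k)) *\<^sub>R ((2 * c k) *\<^sub>R ?u k)" using ck by simp
    then have kj: "?u k = (t / (2 * c k)) *\<^sub>R ?u j" unfolding t(2) by simp
    then have "t \<noteq> 0" using rvec_v_nonzero[of k] by auto
    then have "t / (2 * c k) > 0" using t(1) ck by simp
    then have "v k = v j" using primitive_unique[OF v_primitive v_primitive _ kj] by blast
    then show "j \<in> J" using v_inj k(1) by blast
  qed
qed

text \<open>The independent real generators given by simpliciality are rescaled to primitive ones;
  neither independence nor the hull changes.\<close>

lemma cone_structure:
  assumes "\<sigma> \<in> \<Sigma>"
  shows "indep_on (cone_rays v \<sigma>) (\<lambda>j. rvec (v j))"
    and "convex_cone hull ((\<lambda>j. rvec (v j)) ` cone_rays v \<sigma>) = \<sigma>"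
proof -
  let ?u = "\<lambda>j. rvec (v j)"
  obtain B where B: "finite B" "independent B" "\<sigma> = convex_cone hull B"
    using simplicial assms by (auto simp: simplicial_fan_def)
  obtain jj t where jt: "\<And>b. b \<in> B \<Longrightarrow> t b > 0 \<and> b = t b *\<^sub>R ?u (jj b)"
    using ray_generator[OF B(1,2)] assms B(3) by metis
  have indB: "(\<Sum>b\<in>B. d b *\<^sub>R b) = 0 \<Longrightarrow> b \<in> B \<Longrightarrow> d b = 0" for d b
    using B(1,2) independent_explicit_finite_subsets[of B] by auto
  have inj: "inj_on jj B"
  proof (rule inj_onI, rule ccontr)
    fix b b' assume bb: "b \<in> B" "b' \<in> B" "jj b = jj b'" "b \<noteq> b'"
    define d where "d x = (if x = b then t b' else if x = b' then - t b else 0)" for x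
    have "(\<Sum>x\<in>B. d x *\<^sub>R x) = (\<Sum>x\<in>{b,b'}. d x *\<^sub>R x)"
      using bb B(1) by (intro sum.mono_neutral_right) (auto simp: d_def)
    also have "\<dots> = t b' *\<^sub>R b - t b *\<^sub>R b'" using bb(4) by (simp add: d_def)
    also have "\<dots> = 0"
    proof -
      have "t b' *\<^sub>R b = (t b' * t b) *\<^sub>R ?u (jj b)" using jt[OF bb(1)] by (metis scaleR_scaleR)
      moreover have "t b *\<^sub>R b' = (t b * t b') *\<^sub>R ?u (jj b')" using jt[OF bb(2)] by (metis scaleR_scaleR)
      ultimately show ?thesis using bb(3) by (simp add: mult.commute)
    qed
    finally have "d b = 0" using indB bb(1) by blast
    then have "t b' = 0" by (simp add: d_def)
    then show False using jt[OF bb(2)] by (metis less_irrefl)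
  qed
  define J where "J = jj ` B"
  have ind: "indep_on J ?u"
    unfolding indep_on_def
  proof (intro allI impI ballI)
    fix d j assume d: "(\<Sum>j\<in>J. d j *\<^sub>R ?u j) = 0" and j: "j \<in> J"
    have "(\<Sum>b\<in>B. (d (jj b) / t b) *\<^sub>R b) = (\<Sum>b\<in>B. d (jj b) *\<^sub>R ?u (jj b))"
    proof (rule sum.cong[OF refl])
      fix b assume b: "b \<in> B"
      have tb: "t b \<noteq> 0" "t b *\<^sub>R ?u (jj b) = b" using jt[OF b] by (metis less_irrefl)+
      have "d (jj b) *\<^sub>R ?u (jj b) = (d (jj b) / t b) *\<^sub>R (t b *\<^sub>R ?u (jj b))" using tb(1) by simp
      then show "(d (jj b) / t b) *\<^sub>R b = d (jj b) *\<^sub>R ?u (jj b)" unfolding tb(2) by simp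
    qed
    also have "\<dots> = 0" using d by (simp add: J_def sum.reindex[OF inj])
    finally have z: "b \<in> B \<Longrightarrow> d (jj b) / t b = 0" for b
      by (rule indB[of "\<lambda>b. d (jj b) / t b"])
    obtain b where b: "b \<in> B" "j = jj b" using j unfolding J_def by blast
    have "t b \<noteq> 0" using jt[OF b(1)] by (metis less_irrefl)
    then show "d j = 0" using z[OF b(1)] b(2) by simp
  qed
  have hull: "convex_cone hull (?u ` J) = \<sigma>"
    unfolding B(3)
  proof
    have "?u (jj b) \<in> convex_cone hull B" if b: "b \<in> B" for b
    proof -
      have "(1 / t b) *\<^sub>R b \<in> convex_cone hull B"
        using b jt[OF b] by (intro convex_cone_hull_mul hull_inc) auto
      moreover have tb: "t b \<noteq> 0" "t b *\<^sub>R ?u (jj b) = b" using jt[OF b] by (metis less_irrefl)+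
      have "?u (jj b) = (1 / t b) *\<^sub>R (t b *\<^sub>R ?u (jj b))" using tb(1) by simp
      then have "?u (jj b) = (1 / t b) *\<^sub>R b" unfolding tb(2) .
      ultimately show ?thesis by (simp only:)
    qed
    then show "convex_cone hull (?u ` J) \<subseteq> convex_cone hull B"
      by (intro hull_minimal convex_cone_convex_cone_hull) (auto simp: J_def)
    have "b \<in> convex_cone hull (?u ` J)" if b: "b \<in> B" for b
    proof -
      have "t b *\<^sub>R ?u (jj b) \<in> convex_cone hull (?u ` J)"
        using b jt[OF b] by (intro convex_cone_hull_mul hull_inc) (auto simp: J_def)
      then show ?thesis using jt[OF b] by metis
    qed
    then show "convex_cone hull B \<subseteq> convex_cone hull (?u ` J)"
      by (intro hull_minimal convex_cone_convex_cone_hull) auto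
  qed
  have "cone_rays v \<sigma> = J" using cone_rays_of_hull[OF ind] hull assms by simp
  then show "indep_on (cone_rays v \<sigma>) ?u" "convex_cone hull (?u ` cone_rays v \<sigma>) = \<sigma>"
    using ind hull by simp_all
qed

lemma cone_rays_subset:
  assumes "\<sigma> \<in> \<Sigma>" "K \<subseteq> cone_rays v \<sigma>"
  shows "\<exists>\<tau>\<in>\<Sigma>. K = cone_rays v \<tau>"
proof -
  let ?u = "\<lambda>j. rvec (v j)"
  let ?\<tau> = "convex_cone hull (?u ` K)"
  have "?\<tau> face_of \<sigma>"
    using face_of_simplicial_cone[OF _ cone_structure(1)[OF assms(1)] assms(2)]
    by (simp add: cone_structure(2)[OF assms(1)])
  then have mem: "?\<tau> \<in> \<Sigma>" using face_mem[OF assms(1)] convex_cone_hull_nonempty by blast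
  have "indep_on K ?u"
    unfolding indep_on_def
  proof (intro allI impI ballI)
    fix d j assume d: "(\<Sum>j\<in>K. d j *\<^sub>R ?u j) = 0" and j: "j \<in> K"
    have "(\<Sum>j\<in>cone_rays v \<sigma>. (if j \<in> K then d j else 0) *\<^sub>R ?u j) = (\<Sum>j\<in>K. d j *\<^sub>R ?u j)"
      using assms(2) by (intro sum.mono_neutral_cong_right) auto
    then have "(if j \<in> K then d j else 0) = 0"
      using d j assms(2)
      by (intro indep_onD[OF cone_structure(1)[OF assms(1)], of "\<lambda>j. if j \<in> K then d j else 0"]) auto
    then show "d j = 0" using j by simp
  qed
  then show ?thesis using cone_rays_of_hull mem by blast
qed

lemma fan_complex: "fan_complex (cone_rays v ` \<Sigma>) (\<lambda>j. rvec (v j))"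
proof
  let ?u = "\<lambda>j. rvec (v j)"
  show "K \<in> cone_rays v ` \<Sigma>" if "J \<in> cone_rays v ` \<Sigma>" "K \<subseteq> J" for J K
    using that cone_rays_subset by blast
  show "\<exists>c. (\<forall>j. 0 \<le> c j) \<and> {j. c j \<noteq> 0} \<in> cone_rays v ` \<Sigma> \<and> x = (\<Sum>j\<in>UNIV. c j *\<^sub>R ?u j)" for x
  proof -
    obtain \<sigma> where \<sigma>: "\<sigma> \<in> \<Sigma>" "x \<in> \<sigma>" using complete by (auto simp: complete_fan_def)
    let ?J = "cone_rays v \<sigma>"
    have "x \<in> convex_cone hull (?u ` ?J)" using \<sigma>(2) cone_structure(2)[OF \<sigma>(1)] by simp
    then obtain c where c: "x = (\<Sum>j\<in>?J. c j *\<^sub>R ?u j)" "\<forall>j\<in>?J. c j \<ge> 0"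
      by (subst (asm) convex_cone_hull_image) auto
    let ?c = "\<lambda>j. if j \<in> ?J then c j else 0"
    have "x = (\<Sum>j\<in>UNIV. ?c j *\<^sub>R ?u j)"
      unfolding c(1) by (intro sum.mono_neutral_cong_left) auto
    moreover have "{j. ?c j \<noteq> 0} \<subseteq> ?J" by auto
    then have "{j. ?c j \<noteq> 0} \<in> cone_rays v ` \<Sigma>"
      using cone_rays_subset[OF \<sigma>(1)] by blast
    ultimately show ?thesis using c(2) by (intro exI[of _ ?c]) auto
  qed
  \<comment> \<open>If a point interior to one cone lies in another, then the intersection is a face
    of the first cone that contains the point, hence all its summands. So all rays of the first cone
    lie in the second.\<close>
  have sub: "{j. c j \<noteq> 0} \<subseteq> {j. c' j \<noteq> 0}"
    if c: "\<forall>j. 0 \<le> c j" "{j. c j \<noteq> 0} \<in> cone_rays v ` \<Sigma>"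
    and c': "\<forall>j. 0 \<le> c' j" "{j. c' j \<noteq> 0} \<in> cone_rays v ` \<Sigma>"
    and eq: "(\<Sum>j\<in>UNIV. c j *\<^sub>R ?u j) = (\<Sum>j\<in>UNIV. c' j *\<^sub>R ?u j)" for c c'
  proof
    fix k assume k: "k \<in> {j. c j \<noteq> 0}"
    obtain \<tau> where \<tau>: "\<tau> \<in> \<Sigma>" "{j. c j \<noteq> 0} = cone_rays v \<tau>" using c by blast
    obtain \<tau>' where \<tau>': "\<tau>' \<in> \<Sigma>" "{j. c' j \<noteq> 0} = cone_rays v \<tau>'" using c' by blast
    have mem: "(\<Sum>j\<in>K. d j *\<^sub>R ?u j) \<in> \<rho>"
      if "\<rho> \<in> \<Sigma>" "\<forall>j. 0 \<le> d j" "{j. d j \<noteq> 0} = cone_rays v \<rho>" for d \<rho> K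
    proof -
      have "(\<Sum>j\<in>K. d j *\<^sub>R ?u j) = (\<Sum>j\<in>cone_rays v \<rho>. (if j \<in> K then d j else 0) *\<^sub>R ?u j)"
        using that(3) by (intro sum.mono_neutral_cong) auto
      moreover have "\<dots> \<in> convex_cone hull (?u ` cone_rays v \<rho>)"
        using that(2) by (subst convex_cone_hull_image) auto
      ultimately show ?thesis using cone_structure(2)[OF that(1)] by simp
    qed
    have face: "(\<tau> \<inter> \<tau>') face_of \<tau>" using fan \<tau>(1) \<tau>'(1) by (auto simp: fan_def)
    have cone: "t *\<^sub>R y \<in> \<rho>" if "\<rho> \<in> \<Sigma>" "t \<ge> 0" "y \<in> \<rho>" for t y \<rho>
      using convex_cone_hull_mul[of y "?u ` cone_rays v \<rho>" t] cone_structure(2)[OF that(1)] that by simp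
    have split: "(\<Sum>j\<in>UNIV. c j *\<^sub>R ?u j) = c k *\<^sub>R ?u k + (\<Sum>i\<in>UNIV-{k}. c i *\<^sub>R ?u i)"
      by (subst sum.remove[of UNIV k]) auto
    have "2 *\<^sub>R (c k *\<^sub>R ?u k) \<in> \<tau> \<inter> \<tau>'"
    proof (rule face_of_sum[OF face])
      show "2 *\<^sub>R (c k *\<^sub>R ?u k) \<in> \<tau>"
        using cone[OF \<tau>(1), of 2 "c k *\<^sub>R ?u k"] mem[OF \<tau>(1) c(1) \<tau>(2), of "{k}"] by simp
      show "2 *\<^sub>R (\<Sum>i\<in>UNIV-{k}. c i *\<^sub>R ?u i) \<in> \<tau>"
        using cone[OF \<tau>(1)] mem[OF \<tau>(1) c(1) \<tau>(2)] by simp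
      show "c k *\<^sub>R ?u k + (\<Sum>i\<in>UNIV-{k}. c i *\<^sub>R ?u i) \<in> \<tau> \<inter> \<tau>'"
        using mem[OF \<tau>(1) c(1) \<tau>(2), of UNIV] mem[OF \<tau>'(1) c'(1) \<tau>'(2), of UNIV] eq split by simp
    qed
    then have "2 *\<^sub>R (c k *\<^sub>R ?u k) \<in> \<tau>'" by blast
    then have "(1 / (2 * c k)) *\<^sub>R (2 *\<^sub>R (c k *\<^sub>R ?u k)) \<in> \<tau>'"
      by (rule cone[OF \<tau>'(1), rotated]) (use c(1) in simp)
    moreover have "(1 / (2 * c k)) *\<^sub>R (2 *\<^sub>R (c k *\<^sub>R ?u k)) = ?u k" using k by simp
    ultimately have "?u k \<in> \<tau>'" by (simp only:)
    then have "ray (v k) \<subseteq> \<tau>'" using cone[OF \<tau>'(1)] by (auto simp: ray_eq)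
    then show "k \<in> {j. c' j \<noteq> 0}" unfolding \<tau>'(2) by (simp add: cone_rays_def)
  qed
  show "c = c'"
    if c: "\<forall>j. 0 \<le> c j" "{j. c j \<noteq> 0} \<in> cone_rays v ` \<Sigma>"
    and c': "\<forall>j. 0 \<le> c' j" "{j. c' j \<noteq> 0} \<in> cone_rays v ` \<Sigma>"
    and eq: "(\<Sum>j\<in>UNIV. c j *\<^sub>R ?u j) = (\<Sum>j\<in>UNIV. c' j *\<^sub>R ?u j)" for c c'
  proof
    fix k
    have supp: "{j. c j \<noteq> 0} = {j. c' j \<noteq> 0}"
      using sub[OF c c' eq] sub[OF c' c eq[symmetric]] by blast
    obtain \<tau> where \<tau>: "\<tau> \<in> \<Sigma>" "{j. c j \<noteq> 0} = cone_rays v \<tau>" using c by blast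
    have red: "(\<Sum>j\<in>UNIV. d j *\<^sub>R ?u j) = (\<Sum>j\<in>cone_rays v \<tau>. d j *\<^sub>R ?u j)"
      if "{j. d j \<noteq> 0} = cone_rays v \<tau>" for d
      using that by (intro sum.mono_neutral_right) auto
    have "(\<Sum>j\<in>cone_rays v \<tau>. c j *\<^sub>R ?u j) = (\<Sum>j\<in>cone_rays v \<tau>. c' j *\<^sub>R ?u j)"
      using red[of c] red[of c'] eq \<tau>(2) supp by simp
    then have "c k = c' k" if "k \<in> cone_rays v \<tau>"
      by (rule indep_on_eqD[OF cone_structure(1)[OF \<tau>(1)] _ that])
    moreover have "c k = c' k" if "k \<notin> cone_rays v \<tau>"
    proof -
      have "k \<notin> {j. c j \<noteq> 0}" unfolding \<tau>(2) by (rule that)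
      moreover from this have "k \<notin> {j. c' j \<noteq> 0}" unfolding supp .
      ultimately show ?thesis by simp
    qed
    ultimately show "c k = c' k" by blast
  qed
qed

end

section \<open>Mixed differences of numbers of lattice points\<close>

lemma lattice_points_iff_real:
  "m \<in> lattice_points v D \<longleftrightarrow> (\<forall>j. rvec m \<bullet> rvec (v j) \<ge> - real_of_int (Poly_Mapping.lookup D j))"
  unfolding lattice_points_def rvec_inner by (simp add: minus_le_iff flip: of_int_minus)

locale lattice_fan = fan_complex \<Delta> "\<lambda>j. rvec (v j)"
  for \<Delta> :: "'r::finite set set" and v :: "'r \<Rightarrow> int ^ 'n"
begin

text \<open>The integral counterpart of \<open>nef_data\<close>. The vertices are carried along
  explicitly because they add up when divisors are added.\<close>

definition nef :: "('r \<Rightarrow>\<^sub>0 int) \<Rightarrow> ('r set \<Rightarrow> int ^ 'n) \<Rightarrow> bool" where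
  "nef D \<mu> \<longleftrightarrow> (\<forall>J\<in>top. (\<forall>j\<in>J. pairing (\<mu> J) (v j) = - Poly_Mapping.lookup D j) \<and>
     \<mu> J \<in> lattice_points v D)"

lemma nef_add:
  assumes "nef D \<mu>" "nef D' \<mu>'"
  shows "nef (D + D') (\<lambda>J. \<mu> J + \<mu>' J)"
  unfolding nef_def
proof (intro ballI conjI)
  fix J assume J: "J \<in> top"
  show "pairing (\<mu> J + \<mu>' J) (v j) = - Poly_Mapping.lookup (D + D') j" if "j \<in> J" for j
    using assms J that by (simp add: nef_def pairing_add lookup_add)
  have "- Poly_Mapping.lookup D j \<le> pairing (\<mu> J) (v j)"
    "- Poly_Mapping.lookup D' j \<le> pairing (\<mu>' J) (v j)" for j
    using assms J by (auto simp: nef_def lattice_points_def)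
  from add_mono[OF this] show "\<mu> J + \<mu>' J \<in> lattice_points v (D + D')"
    by (simp add: lattice_points_def pairing_add lookup_add)
qed

lemma nef_zero: "nef 0 (\<lambda>_. 0)"
  by (simp add: nef_def lattice_points_def)

lemma nef_sum:
  assumes "\<And>i. i \<in> A \<Longrightarrow> nef (D i) (\<mu> i)"
  shows "nef (\<Sum>i\<in>A. D i) (\<lambda>J. \<Sum>i\<in>A. \<mu> i J)"
  using assms
  by (induction A rule: infinite_finite_induct) (auto simp: nef_zero intro!: nef_add)

text \<open>By completeness, minus the sum of all generators is again a nonnegative combination of
  them. The resulting relation with positive weights bounds the polytopes and leaves only constants
  in degree 0.\<close>

lemma positive_relation:
  obtains w where "\<And>j. w j > (0::real)" "\<And>m. (\<Sum>j\<in>UNIV. w j * real_of_int (pairing m (v j))) = 0"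
proof -
  obtain c where c: "\<forall>j. c j \<ge> 0" "- (\<Sum>j\<in>UNIV. rvec (v j)) = (\<Sum>j\<in>UNIV. c j *\<^sub>R rvec (v j))"
    using rep_ex[of "- (\<Sum>j\<in>UNIV. rvec (v j))"] by blast
  have "(\<Sum>j\<in>UNIV. (1 + c j) * real_of_int (pairing m (v j))) = 0" for m
  proof -
    have "(\<Sum>j\<in>UNIV. (1 + c j) * real_of_int (pairing m (v j)))
      = rvec m \<bullet> (\<Sum>j\<in>UNIV. (1 + c j) *\<^sub>R rvec (v j))"
      by (simp add: inner_sum_right rvec_inner)
    also have "(\<Sum>j\<in>UNIV. (1 + c j) *\<^sub>R rvec (v j)) = 0"
      using c(2) by (simp add: scaleR_left_distrib sum.distrib add_eq_0_iff)
    finally show ?thesis by simp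
  qed
  then show thesis using that[of "\<lambda>j. 1 + c j"] c(1) by (simp add: add_pos_nonneg)
qed

lemma top_nonempty: "\<exists>J. J \<in> top"
proof -
  obtain w :: "real ^ 'n" where "generic w" using generic_in_open[of UNIV] by auto
  then show ?thesis using local_top_exists[OF empty_mem] by blast
qed

lemma pairing_determines:
  assumes J: "J \<in> top" and eq: "\<And>j. j \<in> J \<Longrightarrow> pairing m (v j) = pairing m' (v j)"
  shows "m = m'"
proof -
  have "(rvec m - rvec m') \<bullet> x = 0" for x
  proof -
    have "(rvec m - rvec m') \<bullet> x = (rvec m - rvec m') \<bullet> lin (crd J x)" by (simp add: crd(2)[OF J])
    also have "\<dots> = (\<Sum>j\<in>UNIV. crd J x j * ((rvec m - rvec m') \<bullet> rvec (v j)))" by (rule lin_inner)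
    also have "\<dots> = 0"
    proof (rule sum.neutral, rule ballI)
      fix j
      show "crd J x j * ((rvec m - rvec m') \<bullet> rvec (v j)) = 0"
        using crd(1)[OF J, of j x] eq[of j] by (cases "j \<in> J") (auto simp: inner_diff_left rvec_inner)
    qed
    finally show ?thesis .
  qed
  then have "rvec m = rvec m'" by (metis inner_eq_zero_iff right_minus_eq)
  then show ?thesis by (rule injD[OF inj_rvec])
qed

text \<open>In the positive relation, lower bounds for the other pairings give an upper bound for
  each single one; finitely many values of the pairings leave finitely many points.\<close>

lemma finite_lattice_points: "finite (lattice_points v D)"
proof -
  obtain w where w: "\<And>j. w j > (0::real)" "\<And>m. (\<Sum>j\<in>UNIV. w j * real_of_int (pairing m (v j))) = 0"
    using positive_relation by blast
  define b where "b j = (\<Sum>i\<in>UNIV-{j}. w i * real_of_int (Poly_Mapping.lookup D i)) / w j" for j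
  obtain J where J: "J \<in> top" using top_nonempty by blast
  let ?f = "\<lambda>m j. pairing m (v j)"
  have "?f ` lattice_points v D \<subseteq> (\<Pi>\<^sub>E j\<in>UNIV. {- Poly_Mapping.lookup D j .. \<lfloor>b j\<rfloor>})"
  proof (intro image_subsetI PiE_I)
    fix m j assume m: "m \<in> lattice_points v D"
    then have lo: "- Poly_Mapping.lookup D i \<le> pairing m (v i)" for i by (auto simp: lattice_points_def)
    have "w j * real_of_int (pairing m (v j)) = (\<Sum>i\<in>UNIV-{j}. w i * - real_of_int (pairing m (v i)))"
      using w(2)[of m] by (simp add: sum.remove[of UNIV j] sum_negf)
    also have "\<dots> \<le> (\<Sum>i\<in>UNIV-{j}. w i * real_of_int (Poly_Mapping.lookup D i))"
    proof (rule sum_mono)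
      fix i
      have "- real_of_int (pairing m (v i)) \<le> real_of_int (Poly_Mapping.lookup D i)"
        using lo[of i] by linarith
      then show "w i * - real_of_int (pairing m (v i)) \<le> w i * real_of_int (Poly_Mapping.lookup D i)"
        using w(1)[of i] by (intro mult_left_mono) auto
    qed
    finally have "real_of_int (pairing m (v j)) \<le> b j"
      using w(1)[of j] by (simp add: b_def field_simps)
    then show "pairing m (v j) \<in> {- Poly_Mapping.lookup D j .. \<lfloor>b j\<rfloor>}"
      using lo by (simp add: le_floor_iff)
  qed simp
  moreover have "finite (\<Pi>\<^sub>E j\<in>UNIV. {- Poly_Mapping.lookup D j .. \<lfloor>b j\<rfloor>})" by (rule finite_PiE) auto
  ultimately have "finite (?f ` lattice_points v D)" by (rule finite_subset)
  moreover have "inj_on ?f (lattice_points v D)"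
    by (rule inj_onI) (metis pairing_determines[OF J])
  ultimately show ?thesis using finite_imageD by blast
qed

text \<open>The decomposition of Lawrence and Varchenko: \<open>flipped l J\<close> is the dual of the cone \<open>J\<close>, with the
  inequalities reversed (and made strict) at which the generic vector \<open>l\<close> has a negative coordinate.
  It lies in the half space on which \<open>l\<close> is nonnegative, so that exponential sums over it converge.\<close>

definition flipped :: "real ^ 'n \<Rightarrow> 'r set \<Rightarrow> (int ^ 'n) set" where
  "flipped l J = {m. \<forall>j\<in>J. crd J l j < 0 \<longleftrightarrow> pairing m (v j) < 0}"

lemma flipped_decomposition:
  assumes nef: "nef D \<mu>" and l: "generic l"
  shows "of_bool (m \<in> lattice_points v D) =
    (\<Sum>J\<in>top. (-1) ^ card (neg J l) * of_bool (m - \<mu> J \<in> flipped l J) :: real)"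
proof -
  define N where "N = {j. rvec m \<bullet> rvec (v j) < - real_of_int (Poly_Mapping.lookup D j)}"
  have Niff: "j \<in> N \<longleftrightarrow> pairing m (v j) < - Poly_Mapping.lookup D j" for j
    unfolding N_def rvec_inner by simp linarith
  have nd: "nef_data (\<lambda>j. real_of_int (Poly_Mapping.lookup D j)) (\<lambda>J. rvec (\<mu> J))"
    using nef unfolding nef_data_def nef_def lattice_points_iff_real by (simp add: rvec_inner)
  \<comment> \<open>Translation by the vertex makes the inequalities of \<open>J\<close>
    homogeneous. Membership in the flipped cone then says that the inequalities of \<open>J\<close>
    violated by \<open>m\<close> are those at which \<open>l\<close> is negative.\<close>
  have iff: "m - \<mu> J \<in> flipped l J \<longleftrightarrow> neg J l = J \<inter> N" if J: "J \<in> top" for J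
  proof -
    have "pairing (m - \<mu> J) (v j) < 0 \<longleftrightarrow> j \<in> N" if "j \<in> J" for j
    proof -
      have "pairing (m - \<mu> J) (v j) = pairing m (v j) + Poly_Mapping.lookup D j"
        using nef J that by (simp add: nef_def pairing_diff)
      then show ?thesis unfolding Niff by arith
    qed
    then show ?thesis by (auto simp: flipped_def neg_def)
  qed
  have "(\<Sum>J\<in>top. (-1) ^ card (neg J l) * of_bool (m - \<mu> J \<in> flipped l J) :: int)
     = (\<Sum>J\<in>top. if neg J l = J \<inter> N then (-1) ^ card (J \<inter> N) else 0)"
    by (rule sum.cong) (auto simp: iff)
  also have "\<dots> = (\<Sum>J | J \<in> top \<and> neg J l = J \<inter> N. (-1) ^ card (J \<inter> N))"
    by (rule sum.inter_filter[symmetric]) simp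
  also have "\<dots> = (if N = {} then 1 else 0)"
    unfolding N_def by (rule nef_indicator[OF nd l])
  also have "N = {} \<longleftrightarrow> m \<in> lattice_points v D"
    unfolding lattice_points_iff_real N_def by (auto simp: not_less)
  finally have "real_of_int (\<Sum>J\<in>top. (-1) ^ card (neg J l) * of_bool (m - \<mu> J \<in> flipped l J))
    = real_of_int (if m \<in> lattice_points v D then 1 else 0)" by (rule arg_cong)
  then show ?thesis by (simp split: if_splits)
qed

text \<open>On the flipped cone the coordinates of \<open>l\<close> and the pairings agree in sign,
  so the weight is a product of powers of numbers below 1. The exponents determine \<open>m\<close>,
  but they need not take all values, as the rays of \<open>J\<close> need not be a lattice basis;
  this is why a product of geometric series bounds the sum and need not equal it.\<close>

lemma flipped_sum_bound:
  assumes l: "generic l" and J: "J \<in> top" and s: "s > 0" and S: "finite S" "S \<subseteq> flipped l J"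
  shows "(\<Sum>m\<in>S. exp (- s * (rvec m \<bullet> l))) \<le> (\<Prod>j\<in>J. 1 / (1 - exp (- s * \<bar>crd J l j\<bar>)))"
proof -
  let ?x = "\<lambda>j. exp (- s * \<bar>crd J l j\<bar>)"
  have x: "0 < ?x j" "?x j < 1" if "j \<in> J" for j
    using generic_crd[OF l J that] s by (auto simp: mult_pos_pos)
  define k where "k m = (\<lambda>j\<in>J. nat \<bar>pairing m (v j)\<bar>)" for m
  have sgn: "crd J l j * real_of_int (pairing m (v j)) = \<bar>crd J l j\<bar> * \<bar>real_of_int (pairing m (v j))\<bar>"
    if "m \<in> S" "j \<in> J" for m j
  proof -
    have "crd J l j < 0 \<longleftrightarrow> pairing m (v j) < 0" using that S(2) by (auto simp: flipped_def)
    then show ?thesis by (cases "pairing m (v j) < 0") auto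
  qed
  have val: "exp (- s * (rvec m \<bullet> l)) = (\<Prod>j\<in>J. ?x j ^ k m j)" if "m \<in> S" for m
  proof -
    have "rvec m \<bullet> l = rvec m \<bullet> lin (crd J l)" by (simp add: crd(2)[OF J])
    also have "\<dots> = (\<Sum>j\<in>UNIV. crd J l j * real_of_int (pairing m (v j)))"
      by (simp add: lin_inner rvec_inner)
    also have "\<dots> = (\<Sum>j\<in>J. crd J l j * real_of_int (pairing m (v j)))"
      using crd(1)[OF J] by (intro sum.mono_neutral_right) auto
    also have "\<dots> = (\<Sum>j\<in>J. \<bar>crd J l j\<bar> * real (k m j))"
      using sgn[OF that] by (intro sum.cong) (auto simp: k_def)
    finally have "- s * (rvec m \<bullet> l) = (\<Sum>j\<in>J. real (k m j) * (- s * \<bar>crd J l j\<bar>))"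
      by (simp add: sum_distrib_left algebra_simps flip: sum_negf)
    then have "exp (- s * (rvec m \<bullet> l)) = (\<Prod>j\<in>J. exp (real (k m j) * (- s * \<bar>crd J l j\<bar>)))"
      by (simp only: exp_sum finite)
    also have "\<dots> = (\<Prod>j\<in>J. ?x j ^ k m j)" by (rule prod.cong[OF refl]) (rule exp_of_nat_mult)
    finally show ?thesis .
  qed
  have inj: "inj_on k S"
  proof (rule inj_onI)
    fix m m' assume m: "m \<in> S" "m' \<in> S" "k m = k m'"
    show "m = m'"
    proof (rule pairing_determines[OF J])
      fix j assume j: "j \<in> J"
      have "nat \<bar>pairing m (v j)\<bar> = nat \<bar>pairing m' (v j)\<bar>"
        using fun_cong[OF m(3), of j] j by (simp add: k_def)
      moreover have "pairing m (v j) < 0 \<longleftrightarrow> pairing m' (v j) < 0"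
        using m(1,2) j S(2) by (auto simp: flipped_def)
      ultimately show "pairing m (v j) = pairing m' (v j)" by linarith
    qed
  qed
  obtain K where K: "\<And>m j. m \<in> S \<Longrightarrow> j \<in> J \<Longrightarrow> k m j \<le> K"
  proof
    fix m j assume "m \<in> S" "j \<in> J"
    then show "k m j \<le> (\<Sum>m\<in>S. \<Sum>j\<in>J. k m j)"
      using member_le_sum[of j J "k m"] member_le_sum[of m S "\<lambda>m. \<Sum>j\<in>J. k m j"] S(1)
      by (meson finite le_trans zero_le)
  qed
  have "(\<Sum>m\<in>S. exp (- s * (rvec m \<bullet> l))) = (\<Sum>g\<in>k ` S. \<Prod>j\<in>J. ?x j ^ g j)"
    unfolding sum.reindex[OF inj] o_def by (rule sum.cong[OF refl]) (rule val)
  also have "\<dots> \<le> (\<Sum>g\<in>PiE J (\<lambda>_. {..K}). \<Prod>j\<in>J. ?x j ^ g j)"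
    using K by (intro sum_mono2 finite_PiE) (auto simp: k_def intro!: prod_nonneg)
  also have "\<dots> = (\<Prod>j\<in>J. \<Sum>i\<le>K. ?x j ^ i)"
    by (rule prod_sum_PiE[symmetric]) auto
  also have "\<dots> \<le> (\<Prod>j\<in>J. 1 / (1 - ?x j))"
  proof (rule prod_mono)
    fix j assume j: "j \<in> J"
    have ne: "1 - ?x j \<noteq> 0" using x[OF j] by linarith
    have "(\<Sum>i\<le>K. ?x j ^ i) * (1 - ?x j) = 1 - ?x j ^ Suc K"
      using sum_gp_basic[of "?x j" K] by (simp only: mult.commute)
    then have "(\<Sum>i\<le>K. ?x j ^ i) = (1 - ?x j ^ Suc K) / (1 - ?x j)"
      by (simp only: nonzero_eq_divide_eq[OF ne])
    also have "\<dots> \<le> 1 / (1 - ?x j)"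
      using x[OF j] by (intro divide_right_mono) auto
    finally show "0 \<le> (\<Sum>i\<le>K. ?x j ^ i) \<and> (\<Sum>i\<le>K. ?x j ^ i) \<le> 1 / (1 - ?x j)"
      using x[OF j] by (auto intro!: sum_nonneg)
  qed
  finally show ?thesis .
qed

definition cone_sum :: "real ^ 'n \<Rightarrow> 'r set \<Rightarrow> real \<Rightarrow> real" where
  "cone_sum l J s = (\<Sum>\<^sub>\<infinity>m\<in>flipped l J. exp (- s * (rvec m \<bullet> l)))"

lemma cone_sum:
  assumes l: "generic l" and J: "J \<in> top" and s: "s > 0"
  shows "((\<lambda>m. exp (- s * (rvec m \<bullet> l))) has_sum cone_sum l J s) (flipped l J)"
    and "0 \<le> cone_sum l J s" "cone_sum l J s \<le> (\<Prod>j\<in>J. 1 / (1 - exp (- s * \<bar>crd J l j\<bar>)))"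
proof -
  have summable: "(\<lambda>m. exp (- s * (rvec m \<bullet> l))) summable_on (flipped l J)"
    using flipped_sum_bound[OF l J s]
    by (intro nonneg_bdd_above_summable_on) (auto simp: bdd_above_def)
  then show "((\<lambda>m. exp (- s * (rvec m \<bullet> l))) has_sum cone_sum l J s) (flipped l J)"
    unfolding cone_sum_def by (rule has_sum_infsum)
  show "0 \<le> cone_sum l J s" unfolding cone_sum_def by (rule infsum_nonneg) simp
  show "cone_sum l J s \<le> (\<Prod>j\<in>J. 1 / (1 - exp (- s * \<bar>crd J l j\<bar>)))"
    unfolding cone_sum_def using summable flipped_sum_bound[OF l J s]
    by (intro infsum_le_finite_sums) auto
qed

lemma has_sum_sum_family:
  fixes f :: "'y \<Rightarrow> 'x \<Rightarrow> real"
  assumes "finite T" "\<And>J. J \<in> T \<Longrightarrow> (f J has_sum a J) A"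
  shows "((\<lambda>x. \<Sum>J\<in>T. f J x) has_sum (\<Sum>J\<in>T. a J)) A"
  using assms by (induction T rule: finite_induct) (auto intro!: has_sum_add)

text \<open>The signed decomposition, weighted and summed over the whole lattice. The common vector
  \<open>l\<close> makes all cone series converge at once, and moving a cone to its vertex
  multiplies its series by the weight of the vertex.\<close>

lemma polytope_exp_sum:
  assumes nef: "nef D \<mu>" and l: "generic l" and s: "s > 0"
  shows "(\<Sum>m\<in>lattice_points v D. exp (- s * (rvec m \<bullet> l))) =
    (\<Sum>J\<in>top. (-1) ^ card (neg J l) * exp (- s * (rvec (\<mu> J) \<bullet> l)) * cone_sum l J s)"
proof -
  let ?e = "\<lambda>m. exp (- s * (rvec m \<bullet> l))"
  have "((\<lambda>m. (-1) ^ card (neg J l) * of_bool (m - \<mu> J \<in> flipped l J) * ?e m) has_sum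
      ((-1) ^ card (neg J l) * ?e (\<mu> J) * cone_sum l J s)) UNIV" if J: "J \<in> top" for J
  proof -
    have "((\<lambda>m. of_bool (m \<in> flipped l J) * ?e m) has_sum cone_sum l J s) UNIV"
      using cone_sum(1)[OF l J s] by (subst (asm) has_sum_cong_neutral[of UNIV]) auto
    moreover have "bij_betw (\<lambda>m. m - \<mu> J) UNIV UNIV"
      by (rule bij_betw_byWitness[where f' = "\<lambda>m. m + \<mu> J"]) auto
    ultimately have "((\<lambda>m. of_bool (m - \<mu> J \<in> flipped l J) * ?e (m - \<mu> J)) has_sum cone_sum l J s) UNIV"
      by (subst has_sum_reindex_bij_betw[where f = "\<lambda>m. of_bool (m \<in> flipped l J) * ?e m"])
    from has_sum_cmult_right[OF this, of "(-1) ^ card (neg J l) * ?e (\<mu> J)"]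
    have "((\<lambda>m. (-1) ^ card (neg J l) * ?e (\<mu> J) * (of_bool (m - \<mu> J \<in> flipped l J) * ?e (m - \<mu> J)))
      has_sum ((-1) ^ card (neg J l) * ?e (\<mu> J) * cone_sum l J s)) UNIV" .
    moreover have split: "?e m = ?e (\<mu> J) * ?e (m - \<mu> J)" for m
    proof -
      have "rvec m = rvec (\<mu> J) + rvec (m - \<mu> J)" by (simp add: rvec_def vec_eq_iff)
      then show ?thesis by (simp add: inner_add_left algebra_simps flip: exp_add)
    qed
    have "(-1) ^ card (neg J l) * ?e (\<mu> J) * (of_bool (m - \<mu> J \<in> flipped l J) * ?e (m - \<mu> J))
        = (-1) ^ card (neg J l) * of_bool (m - \<mu> J \<in> flipped l J) * ?e m" for m
      unfolding split[of m] by (simp only: mult_ac)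
    ultimately show ?thesis by (simp only:)
  qed
  then have "((\<lambda>m. \<Sum>J\<in>top. (-1) ^ card (neg J l) * of_bool (m - \<mu> J \<in> flipped l J) * ?e m) has_sum
      (\<Sum>J\<in>top. (-1) ^ card (neg J l) * ?e (\<mu> J) * cone_sum l J s)) UNIV"
    by (intro has_sum_sum_family) auto
  moreover have "(\<Sum>J\<in>top. (-1) ^ card (neg J l) * of_bool (m - \<mu> J \<in> flipped l J) * ?e m)
      = of_bool (m \<in> lattice_points v D) * ?e m" for m
    unfolding flipped_decomposition[OF nef l] by (simp only: sum_distrib_right)
  moreover have "((\<lambda>m. of_bool (m \<in> lattice_points v D) * ?e m) has_sum
      (\<Sum>m\<in>lattice_points v D. ?e m)) UNIV"
    by (rule has_sum_finite_neutralI[OF finite_lattice_points]) auto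
  ultimately show ?thesis using has_sum_unique by (simp only:)
qed

text \<open>The product over \<open>A\<close> vanishes to order \<open>card A > n\<close> at \<open>s = 0\<close>, and \<open>cone_sum\<close> has a pole of
  order at most \<open>n\<close> there.\<close>

lemma mixed_difference:
  assumes A: "finite A" "card A > CARD('n)" and nef: "\<And>i. i \<in> A \<Longrightarrow> nef (D i) (\<mu> i)"
  shows "(\<Sum>I\<in>Pow A. (-1) ^ card I * int (card (lattice_points v (\<Sum>i\<in>I. D i)))) = 0"
proof -
  obtain l :: "real ^ 'n" where l: "generic l" using generic_in_open[of UNIV] by auto
  define f where "f s = (\<Sum>I\<in>Pow A. (-1) ^ card I *
    (\<Sum>m\<in>lattice_points v (\<Sum>i\<in>I. D i). exp (- s * (rvec m \<bullet> l))))" for s :: real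
  have rv: "rvec (\<Sum>i\<in>I. g i) \<bullet> l = (\<Sum>i\<in>I. rvec (g i) \<bullet> l)" for I and g :: "'a \<Rightarrow> int ^ 'n"
  proof -
    have "rvec (\<Sum>i\<in>I. g i) = (\<Sum>i\<in>I. rvec (g i))"
      by (simp add: rvec_def vec_eq_iff)
    then show ?thesis by (simp add: inner_sum_left)
  qed
  \<comment> \<open>At each maximal cone the vertex of a sum of divisors is the sum of the vertices,
    and its weight is a product. The alternating sum over subsets therefore factors.\<close>
  have f_eq: "f s = (\<Sum>J\<in>top. (-1) ^ card (neg J l) * cone_sum l J s *
      (\<Prod>i\<in>A. 1 - exp (- s * (rvec (\<mu> i J) \<bullet> l))))" if s: "s > 0" for s
  proof -
    have "f s = (\<Sum>I\<in>Pow A. \<Sum>J\<in>top. (-1) ^ card (neg J l) * cone_sum l J s *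
        ((-1) ^ card I * (\<Prod>i\<in>I. exp (- s * (rvec (\<mu> i J) \<bullet> l)))))"
      unfolding f_def
    proof (rule sum.cong[OF refl])
      fix I assume I: "I \<in> Pow A"
      have fin: "finite I" using I A(1) finite_subset by blast
      have "nef (\<Sum>i\<in>I. D i) (\<lambda>J. \<Sum>i\<in>I. \<mu> i J)" using I nef by (intro nef_sum) auto
      note polytope_exp_sum[OF this l s]
      moreover have "exp (- s * (rvec (\<Sum>i\<in>I. \<mu> i J) \<bullet> l)) = (\<Prod>i\<in>I. exp (- s * (rvec (\<mu> i J) \<bullet> l)))" for J
        unfolding rv sum_distrib_left by (rule exp_sum[OF fin])
      ultimately show "(-1) ^ card I * (\<Sum>m\<in>lattice_points v (\<Sum>i\<in>I. D i). exp (- s * (rvec m \<bullet> l)))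
        = (\<Sum>J\<in>top. (-1) ^ card (neg J l) * cone_sum l J s *
            ((-1) ^ card I * (\<Prod>i\<in>I. exp (- s * (rvec (\<mu> i J) \<bullet> l)))))"
        by (simp add: sum_distrib_left mult_ac)
    qed
    also have "\<dots> = (\<Sum>J\<in>top. \<Sum>I\<in>Pow A. (-1) ^ card (neg J l) * cone_sum l J s *
        ((-1) ^ card I * (\<Prod>i\<in>I. exp (- s * (rvec (\<mu> i J) \<bullet> l)))))"
      by (rule sum.swap)
    also have "\<dots> = (\<Sum>J\<in>top. (-1) ^ card (neg J l) * cone_sum l J s *
        (\<Prod>i\<in>A. 1 - exp (- s * (rvec (\<mu> i J) \<bullet> l))))"
      using A(1) by (simp add: prod_diff_conv_sum sum_distrib_left)
    finally show ?thesis .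
  qed
  have term0: "((\<lambda>s. (-1) ^ card (neg J l) * cone_sum l J s *
      (\<Prod>i\<in>A. 1 - exp (- s * (rvec (\<mu> i J) \<bullet> l)))) \<longlongrightarrow> 0) (at_right 0)" if J: "J \<in> top" for J
  proof -
    have slope: "((\<lambda>s. (1 - exp (- s * x)) / s) \<longlongrightarrow> x) (at_right 0)" for x :: real
    proof -
      have "((\<lambda>s. 1 - exp (- s * x)) has_field_derivative x) (at 0)"
        by (auto intro!: derivative_eq_intros)
      then have "((\<lambda>s. (1 - exp (- s * x)) / s) \<longlongrightarrow> x) (at 0)" by (simp add: DERIV_def)
      then show ?thesis by (rule filterlim_mono[OF _ order_refl]) (simp add: at_within_le_at)
    qed
    \<comment> \<open>The upper bound with one factor \<open>s\<close> moved into each of the n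
      denominators and into each of the \<open>card A\<close> numerators. All quotients then have
      limits, those of the denominators being nonzero by genericity, and the surplus power of
      \<open>s\<close> tends to 0.\<close>
    define h where "h s = (\<Prod>j\<in>J. 1 / ((1 - exp (- s * \<bar>crd J l j\<bar>)) / s)) *
      \<bar>\<Prod>i\<in>A. (1 - exp (- s * (rvec (\<mu> i J) \<bullet> l))) / s\<bar> * s ^ (card A - CARD('n))" for s
    have "(h \<longlongrightarrow> (\<Prod>j\<in>J. 1 / \<bar>crd J l j\<bar>) * \<bar>\<Prod>i\<in>A. rvec (\<mu> i J) \<bullet> l\<bar> * 0 ^ (card A - CARD('n)))
      (at_right 0)"
      unfolding h_def using generic_crd[OF l J]
      by (intro tendsto_mult tendsto_prod tendsto_rabs tendsto_divide tendsto_const slope tendsto_power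
          tendsto_ident_at) auto
    moreover have "(0::real) ^ (card A - CARD('n)) = 0" using A(2) by simp
    ultimately have h0: "(h \<longlongrightarrow> 0) (at_right 0)" by (simp only: mult_zero_right)
    have "eventually (\<lambda>s. norm ((-1) ^ card (neg J l) * cone_sum l J s *
      (\<Prod>i\<in>A. 1 - exp (- s * (rvec (\<mu> i J) \<bullet> l)))) \<le> h s) (at_right 0)"
      using eventually_at_right_less[of "0::real"]
    proof eventually_elim
      case (elim s)
      have cJ: "card J = CARD('n)" using J by (simp add: top_def)
      have "norm ((-1) ^ card (neg J l) * cone_sum l J s *
          (\<Prod>i\<in>A. 1 - exp (- s * (rvec (\<mu> i J) \<bullet> l))))
        = cone_sum l J s * \<bar>\<Prod>i\<in>A. 1 - exp (- s * (rvec (\<mu> i J) \<bullet> l))\<bar>"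
        using cone_sum(2)[OF l J elim] by (simp add: abs_mult power_abs)
      also have "\<dots> \<le> (\<Prod>j\<in>J. 1 / (1 - exp (- s * \<bar>crd J l j\<bar>))) *
          \<bar>\<Prod>i\<in>A. 1 - exp (- s * (rvec (\<mu> i J) \<bullet> l))\<bar>"
        by (rule mult_right_mono[OF cone_sum(3)[OF l J elim]]) simp
      also have "\<dots> = h s"
      proof -
        have e1: "(\<Prod>j\<in>J. 1 / ((1 - exp (- s * \<bar>crd J l j\<bar>)) / s))
            = s ^ CARD('n) * (\<Prod>j\<in>J. 1 / (1 - exp (- s * \<bar>crd J l j\<bar>)))"
          by (simp add: prod_dividef cJ)
        have e2: "\<bar>\<Prod>i\<in>A. (1 - exp (- s * (rvec (\<mu> i J) \<bullet> l))) / s\<bar>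
            = \<bar>\<Prod>i\<in>A. 1 - exp (- s * (rvec (\<mu> i J) \<bullet> l))\<bar> / s ^ card A"
          using elim by (simp add: prod_dividef power_abs)
        have e3: "s ^ card A = s ^ CARD('n) * s ^ (card A - CARD('n))"
          using A(2) by (simp flip: power_add)
        show ?thesis unfolding h_def e1 e2 e3 using elim by (simp add: field_simps)
      qed
      finally show ?case .
    qed
    then show ?thesis by (rule Lim_null_comparison) (rule h0)
  qed
  have "((\<lambda>s. \<Sum>J\<in>top. (-1) ^ card (neg J l) * cone_sum l J s *
      (\<Prod>i\<in>A. 1 - exp (- s * (rvec (\<mu> i J) \<bullet> l)))) \<longlongrightarrow> (\<Sum>J\<in>top. 0)) (at_right 0)"
    by (intro tendsto_sum term0)
  then have lim0: "(f \<longlongrightarrow> 0) (at_right 0)"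
    using eventually_at_right_less[of "0::real"]
    by (simp, elim Lim_transform_eventually) (auto elim!: eventually_mono simp: f_eq)
  \<comment> \<open>In its original form \<open>f\<close> is a finite sum, whose limit at 0 is the
    signed count of lattice points.\<close>
  have "(f \<longlongrightarrow> (\<Sum>I\<in>Pow A. (-1) ^ card I *
    (\<Sum>m\<in>lattice_points v (\<Sum>i\<in>I. D i). exp (- 0 * (rvec m \<bullet> l))))) (at_right 0)"
    unfolding f_def
    by (intro tendsto_sum tendsto_mult tendsto_const tendsto_exp tendsto_minus tendsto_ident_at)
  from tendsto_unique[OF _ this lim0]
  have "(\<Sum>I\<in>Pow A. (-1) ^ card I * real (card (lattice_points v (\<Sum>i\<in>I. D i)))) = 0"
    by simp
  then have "real_of_int (\<Sum>I\<in>Pow A. (-1) ^ card I * int (card (lattice_points v (\<Sum>i\<in>I. D i)))) = 0"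
    by simp
  then show ?thesis by linarith
qed

end

section \<open>Hilbert functions of homogeneous regular sequences\<close>

definition cox_scale :: "'k::field \<Rightarrow> ('r, 'k) cox_ring \<Rightarrow> ('r, 'k) cox_ring" where
  "cox_scale c f = Poly_Mapping.single 0 c * f"

lemma cox_scale_lookup [simp]: "Poly_Mapping.lookup (cox_scale c f) a = c * Poly_Mapping.lookup f a"
  unfolding cox_scale_def by (simp flip: mult_map_scale_conv_mult add: map.rep_eq when_def)

interpretation cox: vector_space "cox_scale :: 'k::field \<Rightarrow> ('r, 'k) cox_ring \<Rightarrow> _"
proof
  fix a b :: 'k and x y :: "('r, 'k) cox_ring"
  show "cox_scale a (x + y) = cox_scale a x + cox_scale a y"
    by (simp add: cox_scale_def distrib_left)
  show "cox_scale (a + b) x = cox_scale a x + cox_scale b x"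
    by (simp add: cox_scale_def single_add distrib_right)
  show "cox_scale a (cox_scale b x) = cox_scale (a * b) x"
    by (simp add: cox_scale_def mult_single flip: mult.assoc)
  show "cox_scale 1 x = x"
    by (simp add: cox_scale_def)
qed

lemma ideal_gen_image:
  assumes "finite A"
  shows "f \<in> ideal_gen (F ` A) \<longleftrightarrow> (\<exists>g. f = (\<Sum>i\<in>A. g i * F i))"
proof
  assume "f \<in> ideal_gen (F ` A)"
  then have "f \<in> Modules.module.span (*) (F ` A)" by (simp add: ideal_gen_def)
  then show "\<exists>g. f = (\<Sum>i\<in>A. g i * F i)"
  proof (induction rule: ring_span_induct_alt)
    case base
    show ?case by (rule exI[of _ "\<lambda>_. 0"]) simp
  next
    case (step c x y)
    then obtain g i where g: "y = (\<Sum>i\<in>A. g i * F i)" "i \<in> A" "x = F i" by blast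
    have "(\<Sum>k\<in>A. of_bool (k = i) * c * F k) = (\<Sum>k\<in>A. if k = i then c * F k else 0)"
      by (rule sum.cong) auto
    then have "c * x + y = (\<Sum>k\<in>A. (of_bool (k = i) * c + g k) * F k)"
      using g assms by (simp add: distrib_right sum.distrib)
    then show ?case by (rule exI[of _ "\<lambda>k. of_bool (k = i) * c + g k"])
  qed
next
  assume "\<exists>g. f = (\<Sum>i\<in>A. g i * F i)"
  then obtain g where g: "f = (\<Sum>i\<in>A. g i * F i)" by blast
  show "f \<in> ideal_gen (F ` A)"
    unfolding ideal_gen_def g
    by (intro ring_span_sum ring_span_scale ring_span_base) auto
qed

lemma ideal_gen_imageI: "finite A \<Longrightarrow> f = (\<Sum>i\<in>A. g i * F i) \<Longrightarrow> f \<in> ideal_gen (F ` A)"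
  using ideal_gen_image[of A f F] by blast

text \<open>By regularity the last coefficient is a combination of the earlier generators. Multiples
  of the last generator are then added to the earlier coefficients, which leaves a shorter relation.
  This is the part of the exactness of the Koszul complex needed to compare two systems of
  generators.\<close>

lemma regular_sequence_relation:
  fixes F :: "nat \<Rightarrow> 'a::comm_ring_1"
  assumes reg: "\<And>i g. i \<in> {1..k} \<Longrightarrow> g * F i \<in> ideal_gen (F ` {1..<i}) \<Longrightarrow> g \<in> ideal_gen (F ` {1..<i})"
    and rel: "(\<Sum>i\<in>{1..k}. g i * F i) = 0"
  shows "\<forall>i\<in>{1..k}. g i \<in> ideal_gen (F ` {1..k})"
  using assms
proof (induction k arbitrary: g)
  case 0
  then show ?case by simp
next
  case (Suc k)
  have A: "{1..<Suc k} = {1..k}" by auto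
  have sub: "ideal_gen (F ` {1..k}) \<subseteq> ideal_gen (F ` {1..Suc k})"
    unfolding ideal_gen_def by (intro ring_span_mono) auto
  have "g (Suc k) * F (Suc k) = (\<Sum>i\<in>{1..k}. (- g i) * F i)"
    using Suc.prems(2) by (simp add: sum_negf add_eq_0_iff)
  then have "g (Suc k) * F (Suc k) \<in> ideal_gen (F ` {1..<Suc k})"
    unfolding A by (rule ideal_gen_imageI[rotated]) simp
  then have gk: "g (Suc k) \<in> ideal_gen (F ` {1..k})"
    using Suc.prems(1)[of "Suc k"] A by simp
  then obtain h where h: "g (Suc k) = (\<Sum>i\<in>{1..k}. h i * F i)"
    by (subst (asm) ideal_gen_image) auto
  have "(\<Sum>i\<in>{1..k}. (h i * F (Suc k)) * F i) = (\<Sum>i\<in>{1..k}. h i * F i) * F (Suc k)"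
    unfolding sum_distrib_right by (rule sum.cong[OF refl]) (simp only: mult_ac)
  then have "(\<Sum>i\<in>{1..k}. (g i + h i * F (Suc k)) * F i)
      = (\<Sum>i\<in>{1..k}. g i * F i) + (\<Sum>i\<in>{1..k}. h i * F i) * F (Suc k)"
    by (simp only: distrib_right sum.distrib)
  also have "\<dots> = 0" using Suc.prems(2) h by simp
  finally have IH: "\<forall>i\<in>{1..k}. g i + h i * F (Suc k) \<in> ideal_gen (F ` {1..k})"
    using Suc.IH[of "\<lambda>i. g i + h i * F (Suc k)"] Suc.prems(1) by simp
  show ?case
  proof
    fix i assume i: "i \<in> {1..Suc k}"
    show "g i \<in> ideal_gen (F ` {1..Suc k})"
    proof (cases "i = Suc k")
      case True
      then show ?thesis using gk sub by blast
    next
      case False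
      then have "g i + h i * F (Suc k) \<in> ideal_gen (F ` {1..Suc k})" using IH i sub by auto
      moreover have "h i * F (Suc k) \<in> ideal_gen (F ` {1..Suc k})"
        unfolding ideal_gen_def by (intro ring_span_scale ring_span_base) auto
      ultimately have "(g i + h i * F (Suc k)) - h i * F (Suc k) \<in> ideal_gen (F ` {1..Suc k})"
        unfolding ideal_gen_def by (rule ring_span_diff)
      then show ?thesis by simp
    qed
  qed
qed

definition exponents :: "('r::finite \<Rightarrow> int ^ 'n) \<Rightarrow> ('r \<Rightarrow>\<^sub>0 int) \<Rightarrow> ('r \<Rightarrow>\<^sub>0 nat) set" where
  "exponents v D = {a. \<exists>m. exp_divisor a = D + char_divisor v m}"

lemma graded_piece_exponents:
  "f \<in> graded_piece v (div_class v D) \<longleftrightarrow> Poly_Mapping.keys f \<subseteq> exponents v D"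
  by (auto simp: graded_piece_iff exponents_def)

lemma exponents_add:
  assumes "b \<in> exponents v E"
  shows "a + b \<in> exponents v D \<longleftrightarrow> a \<in> exponents v (D - E)"
proof -
  obtain m where m: "exp_divisor b = E + char_divisor v m" using assms by (auto simp: exponents_def)
  have "exp_divisor (a + b) = D + char_divisor v m' \<longleftrightarrow>
      exp_divisor a = (D - E) + char_divisor v (m' - m)" for m'
  proof -
    have "char_divisor v m' = char_divisor v (m' - m) + char_divisor v m" by (simp flip: char_add)
    then show ?thesis by (simp add: exp_divisor_add m algebra_simps)
  qed
  moreover have "exp_divisor a = (D - E) + char_divisor v m' \<longleftrightarrow>
      exp_divisor (a + b) = D + char_divisor v (m' + m)" for m'
    by (simp add: exp_divisor_add m char_add algebra_simps)
  ultimately show ?thesis unfolding exponents_def by blast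
qed

definition component :: "('r::finite \<Rightarrow> int ^ 'n) \<Rightarrow> ('r \<Rightarrow>\<^sub>0 int) \<Rightarrow> ('r, 'k::field) cox_ring \<Rightarrow> ('r, 'k) cox_ring"
  where "component v D f =
    (\<Sum>a\<in>Poly_Mapping.keys f \<inter> exponents v D. Poly_Mapping.single a (Poly_Mapping.lookup f a))"

lemma component_lookup:
  "Poly_Mapping.lookup (component v D f) a = (if a \<in> exponents v D then Poly_Mapping.lookup f a else 0)"
proof -
  have "Poly_Mapping.lookup (component v D f) a
      = (\<Sum>b\<in>Poly_Mapping.keys f \<inter> exponents v D. if b = a then Poly_Mapping.lookup f a else 0)"
    unfolding component_def lookup_sum by (rule sum.cong) (auto simp: lookup_single when_def)
  then show ?thesis by (simp add: in_keys_iff)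
qed

lemma component_mem: "component v D f \<in> graded_piece v (div_class v D)"
  unfolding graded_piece_exponents by (auto simp: in_keys_iff component_lookup split: if_splits)

lemma component_id:
  assumes "f \<in> graded_piece v (div_class v D)"
  shows "component v D f = f"
proof (rule poly_mapping_eqI)
  fix a
  show "Poly_Mapping.lookup (component v D f) a = Poly_Mapping.lookup f a"
    using assms unfolding graded_piece_exponents component_lookup by (auto simp: in_keys_iff)
qed

lemma component_add: "component v D (f + g) = component v D f + component v D g"
  by (rule poly_mapping_eqI) (simp add: component_lookup lookup_add)

lemma component_0 [simp]: "component v D 0 = 0"
  by (rule poly_mapping_eqI) (simp add: component_lookup)

lemma component_sum: "component v D (sum f A) = (\<Sum>i\<in>A. component v D (f i))"
  by (induction A rule: infinite_finite_induct) (auto simp: component_add)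

lemma graded_mult:
  assumes "f \<in> graded_piece v (div_class v D)" "g \<in> graded_piece v (div_class v E)"
  shows "f * g \<in> graded_piece v (div_class v (D + E))"
  unfolding graded_piece_exponents
proof
  fix c assume "c \<in> Poly_Mapping.keys (f * g)"
  then obtain a b where ab: "c = a + b" "a \<in> Poly_Mapping.keys f" "b \<in> Poly_Mapping.keys g"
    using keys_mult[of f g] by blast
  then have "a \<in> exponents v (D + E - E)" "b \<in> exponents v E"
    using assms by (auto simp: graded_piece_exponents)
  then show "c \<in> exponents v (D + E)" unfolding ab(1) using exponents_add by blast
qed

lemma component_mult:
  assumes f: "f \<in> graded_piece v (div_class v E)"
  shows "component v D (g * f) = component v (D - E) g * f"
proof (induction g rule: poly_mapping_sum_induct)
  case (single a c)
  have keys: "Poly_Mapping.keys (Poly_Mapping.single a c * f) \<subseteq> (\<lambda>b. a + b) ` Poly_Mapping.keys f"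
    using keys_mult[of "Poly_Mapping.single a c" f] by (auto split: if_splits)
  have iff: "a + b \<in> exponents v D \<longleftrightarrow> a \<in> exponents v (D - E)" if "b \<in> Poly_Mapping.keys f" for b
    using f that by (intro exponents_add) (auto simp: graded_piece_exponents)
  show ?case
  proof (cases "a \<in> exponents v (D - E)")
    case True
    then have "Poly_Mapping.single a c * f \<in> graded_piece v (div_class v D)"
      unfolding graded_piece_exponents using keys iff by blast
    moreover have "Poly_Mapping.single a c \<in> graded_piece v (div_class v (D - E))"
      unfolding graded_piece_exponents using True by auto
    ultimately show ?thesis by (simp add: component_id)
  next
    case False
    have "component v D (Poly_Mapping.single a c * f) = 0"
    proof (rule poly_mapping_eqI)
      fix x
      show "Poly_Mapping.lookup (component v D (Poly_Mapping.single a c * f)) x = Poly_Mapping.lookup 0 x"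
        using keys iff False unfolding component_lookup by (auto simp: in_keys_iff subset_iff)
    qed
    moreover have "component v (D - E) (Poly_Mapping.single a c) = 0"
      by (rule poly_mapping_eqI) (use False in \<open>auto simp: component_lookup lookup_single when_def\<close>)
    ultimately show ?thesis by simp
  qed
qed (simp_all add: component_add distrib_right)

lemma graded_subspace: "cox.subspace (graded_piece v (div_class v D))"
proof (rule cox.subspaceI)
  show "0 \<in> graded_piece v (div_class v D)" by (simp add: graded_piece_exponents)
  show "f + g \<in> graded_piece v (div_class v D)"
    if "f \<in> graded_piece v (div_class v D)" "g \<in> graded_piece v (div_class v D)" for f g
    using that keys_add[of f g] unfolding graded_piece_exponents by blast
  show "cox_scale c f \<in> graded_piece v (div_class v D)"
    if "f \<in> graded_piece v (div_class v D)" for c f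
    using that unfolding graded_piece_exponents by (auto simp: in_keys_iff subset_iff)
qed

lemma ideal_subspace: "cox.subspace (ideal_gen A)"
  unfolding ideal_gen_def
  by (rule cox.subspaceI)
    (auto simp: cox_scale_def intro: ring_span_zero ring_span_add ring_span_scale)

lemma subspace_inter: "cox.subspace A \<Longrightarrow> cox.subspace B \<Longrightarrow> cox.subspace (A \<inter> B)"
  by (auto simp: cox.subspace_def)

text \<open>Taking the component of degree \<open>D\<close> of an arbitrary representation replaces
  each coefficient by its component of the complementary degree.\<close>

lemma ideal_component:
  assumes A: "finite A" and F: "\<And>i. i \<in> A \<Longrightarrow> F i \<in> graded_piece v (div_class v (E i))"
    and f: "f \<in> ideal_gen (F ` A)" "f \<in> graded_piece v (div_class v D)"
  obtains g where "f = (\<Sum>i\<in>A. g i * F i)" "\<And>i. i \<in> A \<Longrightarrow> g i \<in> graded_piece v (div_class v (D - E i))"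
proof -
  obtain g where g: "f = (\<Sum>i\<in>A. g i * F i)" using f(1) ideal_gen_image[OF A] by blast
  have "f = component v D f" using component_id[OF f(2)] by simp
  also have "\<dots> = (\<Sum>i\<in>A. component v (D - E i) (g i) * F i)"
    unfolding g component_sum by (rule sum.cong[OF refl]) (rule component_mult[OF F])
  finally show thesis by (rule that) (rule component_mem)
qed

context lattice_fan
begin

lemma char_inj:
  assumes "char_divisor v m = char_divisor v m'"
  shows "m = m'"
proof -
  obtain J where J: "J \<in> top" using top_nonempty by blast
  show ?thesis by (rule pairing_determines[OF J]) (metis assms char_lookup)
qed

lemma bij_exponents:
  "bij_betw (\<lambda>m. Poly_Mapping.map nat (D + char_divisor v m)) (lattice_points v D) (exponents v D)"
proof -
  let ?g = "\<lambda>m. Poly_Mapping.map nat (D + char_divisor v m)"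
  note g = exp_divisor_map_nat[of _ v D]
  have inj: "inj_on ?g (lattice_points v D)"
  proof (rule inj_onI)
    fix m m' assume m: "m \<in> lattice_points v D" "m' \<in> lattice_points v D" "?g m = ?g m'"
    then have "D + char_divisor v m = D + char_divisor v m'" using g by metis
    then show "m = m'" using char_inj by simp
  qed
  have "a \<in> ?g ` lattice_points v D" if a: "a \<in> exponents v D" for a
  proof -
    obtain m where m: "exp_divisor a = D + char_divisor v m" using a by (auto simp: exponents_def)
    have mem: "m \<in> lattice_points v D" by (rule lattice_points_of_exponent[OF m])
    have "?g m = a" unfolding m[symmetric] by (rule poly_mapping_eqI) (simp add: map.rep_eq when_def)
    then show ?thesis using mem by blast
  qed
  moreover have "?g m \<in> exponents v D" if "m \<in> lattice_points v D" for m
    using g[OF that] by (auto simp: exponents_def)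
  ultimately show ?thesis using inj by (auto simp: bij_betw_def)
qed

lemma finite_exponents: "finite (exponents v D)"
  using bij_betw_finite[OF bij_exponents] finite_lattice_points by blast

lemma card_exponents: "card (exponents v D) = card (lattice_points v D)"
  using bij_betw_same_card[OF bij_exponents] by simp

abbreviation monomial_basis :: "('r \<Rightarrow>\<^sub>0 int) \<Rightarrow> ('r, 'k::field) cox_ring set" where
  "monomial_basis D \<equiv> (\<lambda>a. Poly_Mapping.single a 1) ` exponents v D"

lemma graded_span:
  "(graded_piece v (div_class v D) :: ('r, 'k::field) cox_ring set) \<subseteq> cox.span (monomial_basis D)"
proof
  fix f :: "('r, 'k) cox_ring" assume f: "f \<in> graded_piece v (div_class v D)"
  have "f = (\<Sum>a\<in>Poly_Mapping.keys f. cox_scale (Poly_Mapping.lookup f a) (Poly_Mapping.single a 1))"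
    unfolding cox_scale_def by (subst poly_mapping_expand) (simp add: mult_single)
  also have "\<dots> \<in> cox.span (monomial_basis D)"
    using f unfolding graded_piece_exponents
    by (intro cox.span_sum cox.span_scale cox.span_base) auto
  finally show "f \<in> cox.span (monomial_basis D)" .
qed

lemma finite_basis: "finite (monomial_basis D)"
  using finite_exponents by simp

lemma dim_graded:
  "cox.dim (graded_piece v (div_class v D) :: ('r, 'k::field) cox_ring set) = card (lattice_points v D)"
proof (rule cox.dim_unique)
  show "(monomial_basis D :: ('r, 'k) cox_ring set) \<subseteq> graded_piece v (div_class v D)"
    by (auto simp: graded_piece_exponents)
  show "graded_piece v (div_class v D) \<subseteq> cox.span (monomial_basis D :: ('r, 'k) cox_ring set)"
    by (rule graded_span)
  have inj: "inj_on (\<lambda>a. Poly_Mapping.single a (1::'k)) A" for A :: "('r \<Rightarrow>\<^sub>0 nat) set"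
  proof (rule inj_onI)
    fix a b :: "'r \<Rightarrow>\<^sub>0 nat" assume "Poly_Mapping.single a (1::'k) = Poly_Mapping.single b 1"
    then have "Poly_Mapping.lookup (Poly_Mapping.single a (1::'k)) a = Poly_Mapping.lookup (Poly_Mapping.single b 1) a"
      by simp
    then show "a = b" by (simp add: lookup_single when_def split: if_splits)
  qed
  show "cox.independent (monomial_basis D :: ('r, 'k) cox_ring set)"
  proof (rule cox.independent_if_scalars_zero[OF finite_basis])
    fix c :: "('r, 'k) cox_ring \<Rightarrow> 'k" and x :: "('r, 'k) cox_ring"
    assume c: "(\<Sum>x\<in>monomial_basis D. cox_scale (c x) x) = 0" and x: "x \<in> monomial_basis D"
    obtain a where a: "a \<in> exponents v D" "x = Poly_Mapping.single a 1" using x by blast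
    have "0 = Poly_Mapping.lookup (\<Sum>x\<in>monomial_basis D. cox_scale (c x) x) a" by (simp add: c)
    also have "\<dots> = (\<Sum>b\<in>exponents v D. c (Poly_Mapping.single b 1) * Poly_Mapping.lookup (Poly_Mapping.single b 1) a)"
      by (simp add: lookup_sum sum.reindex[OF inj])
    also have "\<dots> = (\<Sum>b\<in>exponents v D. if b = a then c (Poly_Mapping.single a 1) else 0)"
      by (rule sum.cong) (auto simp: lookup_single when_def)
    also have "\<dots> = c x" using a finite_exponents by simp
    finally show "c x = 0" by simp
  qed
  show "card (monomial_basis D :: ('r, 'k) cox_ring set) = card (lattice_points v D)"
    by (simp add: card_image[OF inj] card_exponents)
qed

text \<open>The orders of a character along the \<open>D_j\<close> satisfy the positive relation, so
  if they are all nonnegative they are all zero. This expresses that a complete variety has only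
  constant regular functions.\<close>

lemma degree_0_exponents: "exponents v 0 = {0}"
proof
  show "{0} \<subseteq> exponents v 0"
    by (auto simp: exponents_def intro: exI[of _ 0])
  show "exponents v 0 \<subseteq> {0}"
  proof
    fix a assume "a \<in> exponents v 0"
    then obtain m where m: "exp_divisor a = char_divisor v m" by (auto simp: exponents_def)
    obtain w where w: "\<And>j. w j > (0::real)" "\<And>m. (\<Sum>j\<in>UNIV. w j * real_of_int (pairing m (v j))) = 0"
      using positive_relation by blast
    have am: "real (Poly_Mapping.lookup a j) = real_of_int (pairing m (v j))" for j
      by (metis m char_lookup exp_divisor_lookup of_int_of_nat_eq)
    have "(\<Sum>j\<in>UNIV. w j * real (Poly_Mapping.lookup a j)) = 0" using w(2) by (simp add: am)
    then have z: "w j * real (Poly_Mapping.lookup a j) = 0" for j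
      using w(1) by (subst (asm) sum_nonneg_eq_0_iff) (auto simp: less_imp_le)
    then have "Poly_Mapping.lookup a j = 0" for j using z[of j] w(1)[of j] by simp
    then have "a = 0" by (intro poly_mapping_eqI) simp
    then show "a \<in> {0}" by simp
  qed
qed

text \<open>In degree \<open>D\<close> the enlarged ideal is the sum of the old one and the
  multiples of \<open>F i\<close>. By regularity these two meet in \<open>F i\<close> times the old
  ideal, and dimensions are counted in finite-dimensional graded pieces.\<close>

lemma hilbert_step:
  fixes F :: "nat \<Rightarrow> ('r, 'k::field) cox_ring"
  assumes A: "finite A" "i \<notin> A" and F: "\<And>i. F i \<in> graded_piece v (div_class v (E i))"
    and reg: "\<And>g. g * F i \<in> ideal_gen (F ` A) \<Longrightarrow> g \<in> ideal_gen (F ` A)"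
  defines "S \<equiv> \<lambda>D. graded_piece v (div_class v D) :: ('r, 'k) cox_ring set"
    and "J \<equiv> ideal_gen (F ` A)"
  shows "cox.dim (ideal_gen (F ` insert i A) \<inter> S D) + cox.dim (J \<inter> S (D - E i)) =
    cox.dim (J \<inter> S D) + cox.dim (S (D - E i))"
proof -
  let ?m = "\<lambda>g. g * F i"
  have lin: "Vector_Spaces.linear cox_scale cox_scale ?m"
    unfolding Vector_Spaces.linear_iff
    by (intro conjI allI cox.vector_space_axioms) (simp_all only: distrib_right cox_scale_def mult.assoc)
  interpret vector_space_pair "cox_scale :: 'k \<Rightarrow> ('r, 'k) cox_ring \<Rightarrow> _" cox_scale ..
  have sub: "cox.subspace (S D)" "cox.subspace J" for D
    by (simp_all add: S_def J_def graded_subspace ideal_subspace)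
  have subJ: "cox.subspace (J \<inter> S D)" for D by (intro subspace_inter sub)
  have sp: "S D \<subseteq> cox.span (monomial_basis D)" for D unfolding S_def by (rule graded_span)
  have img: "?m ` S (D - E i) \<subseteq> S D"
    unfolding S_def using graded_mult[OF _ F[of i]] by fastforce
  let ?B = "?m ` S (D - E i)"
  have subB: "cox.subspace ?B" by (rule linear_subspace_image[OF lin sub(1)])
  have dimB: "cox.dim (S (D - E i)) = cox.dim ?B + cox.dim {g \<in> S (D - E i). ?m g = 0}"
    by (rule rank_nullity[OF lin sub(1) sp finite_basis])
  have zero: "0 \<in> J" using sub(2) by (rule cox.subspace_0)
  have inter: "(J \<inter> S D) \<inter> ?B = ?m ` (J \<inter> S (D - E i))"
  proof
    show "(J \<inter> S D) \<inter> ?B \<subseteq> ?m ` (J \<inter> S (D - E i))" using reg by (auto simp: J_def)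
    have "?m g \<in> J" if "g \<in> J" for g
      using that unfolding J_def ideal_gen_def
      by (metis mult.commute ring_span_scale)
    then show "?m ` (J \<inter> S (D - E i)) \<subseteq> (J \<inter> S D) \<inter> ?B" using img by auto
  qed
  \<comment> \<open>Multiplication by \<open>F i\<close> is not shown to be injective. Regularity
    puts its kernel into \<open>J\<close>, so the same kernel appears in both dimension counts and
    cancels.\<close>
  have ker: "{g \<in> J \<inter> S (D - E i). ?m g = 0} = {g \<in> S (D - E i). ?m g = 0}"
    using reg zero by (auto simp: J_def)
  have dimI: "cox.dim (J \<inter> S (D - E i)) = cox.dim ((J \<inter> S D) \<inter> ?B) + cox.dim {g \<in> S (D - E i). ?m g = 0}"
    using rank_nullity[OF lin subJ, of "D - E i" "monomial_basis (D - E i)"] sp finite_basis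
    unfolding inter ker by blast
  have sum: "ideal_gen (F ` insert i A) \<inter> S D = {x + y | x y. x \<in> J \<inter> S D \<and> y \<in> ?B}"
  proof
    show "ideal_gen (F ` insert i A) \<inter> S D \<subseteq> {x + y | x y. x \<in> J \<inter> S D \<and> y \<in> ?B}"
    proof
      fix f assume f: "f \<in> ideal_gen (F ` insert i A) \<inter> S D"
      have fI: "f \<in> ideal_gen (F ` insert i A)" and fS: "f \<in> graded_piece v (div_class v D)"
        using f by (auto simp: S_def)
      obtain g where g: "f = (\<Sum>k\<in>insert i A. g k * F k)"
        "\<And>k. k \<in> insert i A \<Longrightarrow> g k \<in> graded_piece v (div_class v (D - E k))"
        by (rule ideal_component[OF _ F fI fS]) (use A in auto)
      let ?x = "\<Sum>k\<in>A. g k * F k"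
      have x: "?x \<in> J \<inter> S D"
      proof
        show "?x \<in> J" unfolding J_def by (rule ideal_gen_imageI[OF A(1) refl])
        have "g k * F k \<in> S D" if "k \<in> A" for k
          using graded_mult[OF g(2)[of k] F[of k]] that by (simp add: S_def)
        then show "?x \<in> S D" by (intro cox.subspace_sum[OF sub(1)])
      qed
      have "g i \<in> S (D - E i)" using g(2) by (simp add: S_def)
      moreover have "f = ?x + g i * F i" using g(1) A by (simp add: add.commute)
      ultimately show "f \<in> {x + y | x y. x \<in> J \<inter> S D \<and> y \<in> ?B}" using x by blast
    qed
    show "{x + y | x y. x \<in> J \<inter> S D \<and> y \<in> ?B} \<subseteq> ideal_gen (F ` insert i A) \<inter> S D"
    proof clarify
      fix x g assume x: "x \<in> J" "x \<in> S D" and g: "g \<in> S (D - E i)"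
      have "x \<in> ideal_gen (F ` insert i A)"
        using x(1) unfolding J_def ideal_gen_def by (rule subsetD[OF ring_span_mono, rotated]) auto
      moreover have "g * F i \<in> ideal_gen (F ` insert i A)"
        unfolding ideal_gen_def by (intro ring_span_scale ring_span_base) simp
      ultimately have "x + g * F i \<in> ideal_gen (F ` insert i A)"
        unfolding ideal_gen_def by (rule ring_span_add)
      moreover have "x + g * F i \<in> S D" using x(2) img g by (intro cox.subspace_add[OF sub(1)]) auto
      ultimately show "x + g * F i \<in> ideal_gen (F ` insert i A) \<inter> S D" by blast
    qed
  qed
  have "cox.dim (ideal_gen (F ` insert i A) \<inter> S D) + cox.dim ((J \<inter> S D) \<inter> ?B)
      = cox.dim (J \<inter> S D) + cox.dim ?B"
    unfolding sum
    by (rule cox.dim_sum_inter[OF subJ _ subB _ finite_basis[of D]]) (use sp img in auto)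
  then show ?thesis using dimB dimI by simp
qed

text \<open>One more generator replaces a function of \<open>D\<close> by its difference with step
  \<open>E (Suc k)\<close>. The two terms give the subsets without and with the new index, and the
  induction hypothesis is needed at two divisors.\<close>

lemma hilbert_function:
  fixes F :: "nat \<Rightarrow> ('r, 'k::field) cox_ring"
  assumes F: "\<And>i. F i \<in> graded_piece v (div_class v (E i))"
    and reg: "\<And>i g. i \<in> {1..k} \<Longrightarrow> g * F i \<in> ideal_gen (F ` {1..<i}) \<Longrightarrow> g \<in> ideal_gen (F ` {1..<i})"
  shows "int (card (lattice_points v D)) -
      int (cox.dim (ideal_gen (F ` {1..k}) \<inter> graded_piece v (div_class v D))) =
    (\<Sum>I\<in>Pow {1..k}. (-1) ^ card I * int (card (lattice_points v (D - (\<Sum>i\<in>I. E i)))))"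
  using reg
proof (induction k arbitrary: D)
  case 0
  have "ideal_gen (F ` {1..0}) \<inter> graded_piece v (div_class v D) \<subseteq> cox.span {}"
    unfolding ideal_gen_def by (auto simp: ring_span_empty)
  from cox.dim_le_card[OF this finite.emptyI]
  have "cox.dim (ideal_gen (F ` {1..0}) \<inter> graded_piece v (div_class v D)) = 0"
    by (simp only: card.empty le_zero_eq)
  moreover have "Pow {1..0::nat} = {{}}" by auto
  ultimately show ?case by (simp only:) simp
next
  case (Suc k)
  let ?S = "\<lambda>D. graded_piece v (div_class v D) :: ('r, 'k) cox_ring set"
  let ?c = "\<lambda>D. int (card (lattice_points v D))"
  let ?H = "\<lambda>k D. ?c D - int (cox.dim (ideal_gen (F ` {1..k}) \<inter> ?S D))"
  have A: "{1..<Suc k} = {1..k}" "{1..Suc k} = insert (Suc k) {1..k}" by auto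
  have IH: "?H k D = (\<Sum>I\<in>Pow {1..k}. (-1) ^ card I * ?c (D - (\<Sum>i\<in>I. E i)))" for D
    using Suc.IH Suc.prems by simp
  have "cox.dim (ideal_gen (F ` {1..Suc k}) \<inter> ?S D) + cox.dim (ideal_gen (F ` {1..k}) \<inter> ?S (D - E (Suc k)))
      = cox.dim (ideal_gen (F ` {1..k}) \<inter> ?S D) + card (lattice_points v (D - E (Suc k)))"
    using hilbert_step[of "{1..k}" "Suc k" F E D] F Suc.prems[of "Suc k"] A dim_graded[where 'k = 'k]
    by simp
  then have "?H (Suc k) D = ?H k D - ?H k (D - E (Suc k))" by linarith
  also have "\<dots> = (\<Sum>I\<in>Pow {1..k}. (-1) ^ card I * ?c (D - (\<Sum>i\<in>I. E i)))
      + (\<Sum>I\<in>Pow {1..k}. (-1) ^ card (insert (Suc k) I) * ?c (D - (\<Sum>i\<in>insert (Suc k) I. E i)))"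
  proof -
    have "(-1) ^ card (insert (Suc k) I) * ?c (D - (\<Sum>i\<in>insert (Suc k) I. E i))
        = - ((-1) ^ card I * ?c (D - E (Suc k) - (\<Sum>i\<in>I. E i)))" if "I \<in> Pow {1..k}" for I
    proof -
      have "finite I" "Suc k \<notin> I" using that finite_subset by auto
      then show ?thesis by (simp add: algebra_simps)
    qed
    then show ?thesis unfolding IH by (simp add: sum_negf)
  qed
  also have "\<dots> = (\<Sum>I\<in>Pow {1..Suc k}. (-1) ^ card I * ?c (D - (\<Sum>i\<in>I. E i)))"
  proof -
    have "inj_on (insert (Suc k)) (Pow {1..k})"
    proof (rule inj_onI)
      fix I I' assume I: "I \<in> Pow {1..k}" "I' \<in> Pow {1..k}" "insert (Suc k) I = insert (Suc k) I'"
      then have "Suc k \<notin> I" "Suc k \<notin> I'" by auto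
      then show "I = I'" using I(3) by (rule insert_ident[THEN iffD1])
    qed
    moreover have "Pow {1..k} \<inter> insert (Suc k) ` Pow {1..k} = {}" by force
    ultimately show ?thesis
      unfolding A Pow_insert by (subst sum.union_disjoint) (auto simp: sum.reindex)
  qed
  finally show ?case .
qed

text \<open>The value at the origin is the constant coefficient. A generator with nonzero constant
  coefficient would have degree 0, hence be a nonzero constant, and the ideal would not be
  proper.\<close>

lemma proper_ideal_no_constant:
  fixes F :: "nat \<Rightarrow> ('r, 'k::field) cox_ring"
  assumes A: "finite A" and F: "\<And>i. F i \<in> graded_piece v (div_class v (E i))"
    and proper: "ideal_gen (F ` A) \<noteq> UNIV" and h: "h \<in> ideal_gen (F ` A)"
  shows "poly_eval h 0 = 0"
proof -
  have ev: "poly_eval f 0 = Poly_Mapping.lookup f 0" for f :: "('r, 'k) cox_ring"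
  proof (induction f rule: poly_mapping_sum_induct)
    case (single a c)
    show ?case
    proof (cases "a = 0")
      case False
      then show ?thesis by (simp add: mon_eval_at_0 lookup_single when_def)
    qed simp
  qed (auto simp: lookup_add)
  have "poly_eval (F i) 0 = 0" if i: "i \<in> A" for i
  proof (rule ccontr)
    assume ne: "poly_eval (F i) 0 \<noteq> 0"
    then have "0 \<in> exponents v (E i)"
      using F[of i] unfolding ev graded_piece_exponents by (auto simp: in_keys_iff)
    then obtain m where m: "0 = E i + char_divisor v m" by (auto simp: exponents_def)
    have "div_class v (E i) = div_class v 0"
      by (rule div_class_eqI[of _ _ _ "- m"]) (use m in \<open>simp add: char_uminus add_eq_0_iff\<close>)
    then have "Poly_Mapping.keys (F i) \<subseteq> {0}"
      using F[of i] graded_piece_exponents[of "F i" v 0] degree_0_exponents by simp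
    then have Fi: "F i = Poly_Mapping.single 0 (Poly_Mapping.lookup (F i) 0)"
      by (intro poly_mapping_eqI) (auto simp: lookup_single when_def in_keys_iff)
    have "Poly_Mapping.single 0 (inverse (Poly_Mapping.lookup (F i) 0)) * F i = 1"
      using ne unfolding ev by (subst (2) Fi) (simp add: mult_single)
    moreover have "Poly_Mapping.single 0 (inverse (Poly_Mapping.lookup (F i) 0)) * F i \<in> ideal_gen (F ` A)"
      unfolding ideal_gen_def using i by (intro ring_span_scale ring_span_base) auto
    ultimately have "g * 1 \<in> ideal_gen (F ` A)" for g
      unfolding ideal_gen_def by (intro ring_span_scale) simp
    then show False using proper by auto
  qed
  moreover obtain g where "h = (\<Sum>i\<in>A. g i * F i)" using h ideal_gen_image[OF A] by blast
  ultimately show ?thesis by simp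
qed

text \<open>Graded Nakayama: modulo the irrelevant maximal ideal, the base change between two minimal
  systems of generators is an invertible matrix, so some product of \<open>n\<close> entries is nonzero.\<close>

lemma generator_degrees:
  fixes F F' :: "nat \<Rightarrow> ('r, 'k::field) cox_ring"
  assumes F: "\<And>i. F i \<in> graded_piece v (div_class v (E i))"
    and F': "\<And>i. F' i \<in> graded_piece v (div_class v (E' i))"
    and reg: "regular_sequence CARD('n) F'"
    and eq: "ideal_gen (F ` {1..CARD('n)}) = ideal_gen (F' ` {1..CARD('n)})"
  obtains \<pi> where "bij_betw \<pi> {1..CARD('n)} {1..CARD('n)}"
    "\<And>i. i \<in> {1..CARD('n)} \<Longrightarrow> div_class v (E' i) = div_class v (E (\<pi> i))"
proof -
  let ?N = "{1..CARD('n)}"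
  have "\<exists>g. F' i = (\<Sum>j\<in>?N. g j * F j) \<and> (\<forall>j\<in>?N. g j \<in> graded_piece v (div_class v (E' i - E j)))"
    if "i \<in> ?N" for i
  proof -
    have mem: "F' i \<in> ideal_gen (F ` ?N)"
      unfolding eq unfolding ideal_gen_def using that by (intro ring_span_base) auto
    obtain g where g: "F' i = (\<Sum>j\<in>?N. g j * F j)"
      "\<And>j. j \<in> ?N \<Longrightarrow> g j \<in> graded_piece v (div_class v (E' i - E j))"
      by (rule ideal_component[OF finite_atLeastAtMost F mem F'], rule that)
    show ?thesis by (rule exI[of _ g]) (use g in blast)
  qed
  then obtain P where P: "\<And>i. i \<in> ?N \<Longrightarrow> F' i = (\<Sum>j\<in>?N. P i j * F j)"
    "\<And>i j. i \<in> ?N \<Longrightarrow> j \<in> ?N \<Longrightarrow> P i j \<in> graded_piece v (div_class v (E' i - E j))"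
    by metis
  have "\<exists>g. F j = (\<Sum>k\<in>?N. g k * F' k)" if "j \<in> ?N" for j
  proof -
    have "F j \<in> ideal_gen (F' ` ?N)"
      unfolding eq[symmetric] unfolding ideal_gen_def using that by (intro ring_span_base) auto
    then show ?thesis by (rule iffD1[OF ideal_gen_image, rotated]) simp
  qed
  then obtain Q where Q: "\<And>j. j \<in> ?N \<Longrightarrow> F j = (\<Sum>k\<in>?N. Q j k * F' k)" by metis
  \<comment> \<open>Substituting the two base changes into each other gives a relation among the
    \<open>F'\<close>, with coefficients the entries of \<open>P\<close> times \<open>Q\<close>
    minus the identity. Regularity puts these entries into the ideal, whose elements vanish at the
    origin.\<close>
  have one: "(\<Sum>j\<in>?N. poly_eval (P i j) 0 * poly_eval (Q j k) 0) = of_bool (i = k)"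
    if i: "i \<in> ?N" and k: "k \<in> ?N" for i k
  proof -
    let ?g = "\<lambda>k. (\<Sum>j\<in>?N. P i j * Q j k) - of_bool (i = k)"
    have "(\<Sum>k\<in>?N. of_bool (i = k) * F' k) = (\<Sum>k\<in>?N. if k = i then F' k else 0)"
      by (rule sum.cong) auto
    then have d: "(\<Sum>k\<in>?N. of_bool (i = k) * F' k) = F' i" using i by simp
    have "(\<Sum>k\<in>?N. (\<Sum>j\<in>?N. P i j * Q j k) * F' k) = (\<Sum>j\<in>?N. \<Sum>k\<in>?N. P i j * Q j k * F' k)"
      unfolding sum_distrib_right by (rule sum.swap)
    also have "\<dots> = (\<Sum>j\<in>?N. P i j * (\<Sum>k\<in>?N. Q j k * F' k))"
      by (simp only: sum_distrib_left mult.assoc)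
    also have "\<dots> = (\<Sum>j\<in>?N. P i j * F j)"
      by (rule sum.cong[OF refl]) (simp only: Q)
    also have "\<dots> = F' i" using P(1)[OF i] by (rule sym)
    finally have "(\<Sum>k\<in>?N. ?g k * F' k) = 0"
      by (simp only: left_diff_distrib sum_subtractf d cancel_comm_monoid_add_class.diff_cancel)
    then have "?g k \<in> ideal_gen (F' ` ?N)"
      using regular_sequence_relation[of "CARD('n)" F' ?g] reg k unfolding regular_sequence_def by blast
    then have "poly_eval (?g k) 0 = 0"
      using reg by (intro proper_ideal_no_constant[OF _ F']) (auto simp: regular_sequence_def)
    then show ?thesis by (cases "i = k") simp_all
  qed
  \<comment> \<open>The indices are moved to the type \<open>'n\<close>, over which matrices and
    determinants are defined.\<close>
  obtain b where b: "bij_betw b (UNIV :: 'n set) ?N"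
    using finite_same_card_bij[of "UNIV :: 'n set" ?N] by auto
  have bN: "b i \<in> ?N" for i using b by (auto simp: bij_betw_def)
  define M :: "'k ^ 'n ^ 'n" where "M = (\<chi> i j. poly_eval (P (b i) (b j)) 0)"
  define M' :: "'k ^ 'n ^ 'n" where "M' = (\<chi> i j. poly_eval (Q (b i) (b j)) 0)"
  have "M ** M' = mat 1"
  proof -
    have "(M ** M') $ i $ k = mat 1 $ i $ k" for i k
    proof -
      have "(M ** M') $ i $ k = (\<Sum>j\<in>UNIV. poly_eval (P (b i) (b j)) 0 * poly_eval (Q (b j) (b k)) 0)"
        by (simp add: matrix_matrix_mult_def M_def M'_def)
      also have "\<dots> = (\<Sum>j\<in>?N. poly_eval (P (b i) j) 0 * poly_eval (Q j (b k)) 0)"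
        by (rule sum.reindex_bij_betw[OF b])
      also have "\<dots> = of_bool (b i = b k)" by (rule one[OF bN bN])
      also have "\<dots> = mat 1 $ i $ k"
        using bij_betw_imp_inj_on[OF b] by (auto simp: mat_def inj_def)
      finally show ?thesis .
    qed
    then show ?thesis by (simp add: vec_eq_iff)
  qed
  then have "det M * det M' = 1" by (metis det_I det_mul)
  then have "det M \<noteq> 0" by auto
  then obtain p where p: "p permutes UNIV" "(\<Prod>i\<in>UNIV. M $ i $ p i) \<noteq> 0"
    unfolding det_def by (metis (mono_tags, lifting) mem_Collect_eq mult_zero_right sum.neutral)
  \<comment> \<open>The entry of \<open>P\<close> at these indices is homogeneous of the difference
    of the two degrees. As it is nonzero at the origin, it has a constant term, and so the
    difference is 0.\<close>
  have "div_class v (E' (b i)) = div_class v (E (b (p i)))" for i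
  proof -
    have "poly_eval (P (b i) (b (p i))) 0 \<noteq> 0" using p(2) by (simp add: M_def)
    moreover have "poly_eval f 0 = 0"
      if "f \<in> graded_piece v (div_class v D)" "0 \<notin> exponents v D" for f :: "('r, 'k) cox_ring" and D
    proof -
      have "mon_eval a (0 :: 'k ^ 'r) = 0" if "a \<in> Poly_Mapping.keys f" for a
      proof -
        have "a \<noteq> 0" using that \<open>f \<in> _\<close> \<open>0 \<notin> _\<close> unfolding graded_piece_exponents by blast
        then show ?thesis by (rule mon_eval_at_0)
      qed
      then show ?thesis by (simp add: poly_eval_superset[of "Poly_Mapping.keys f"])
    qed
    ultimately have "0 \<in> exponents v (E' (b i) - E (b (p i)))" using P(2)[OF bN bN] by blast
    then obtain m where m: "0 = E' (b i) - E (b (p i)) + char_divisor v m" by (auto simp: exponents_def)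
    show ?thesis
      by (rule div_class_eqI[of _ _ _ "- m"]) (use m in \<open>simp add: char_uminus algebra_simps\<close>)
  qed
  note cls = this
  define \<pi> where "\<pi> = b \<circ> p \<circ> inv_into UNIV b"
  show thesis
  proof
    show "bij_betw \<pi> ?N ?N"
      unfolding \<pi>_def using bij_betw_inv_into[OF b] permutes_imp_bij[OF p(1)] b
      by (intro bij_betw_trans) auto
    fix i assume i: "i \<in> ?N"
    then have "b (inv_into UNIV b i) = i" using b by (auto simp: bij_betw_def f_inv_into_f)
    then show "div_class v (E' i) = div_class v (E (\<pi> i))" using cls[of "inv_into UNIV b i"] by (simp add: \<pi>_def)
  qed
qed

end

sublocale complete_simplicial \<subseteq> lattice_fan "cone_rays v ` \<Sigma>" v
  using fan_complex by (simp add: lattice_fan_def)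

section \<open>The vanishing ideal of a set of points\<close>

lemma prod_powi:
  fixes f :: "'a \<Rightarrow> 'k::field"
  shows "(\<Prod>i\<in>A. f i) powi n = (\<Prod>i\<in>A. f i powi n)"
  by (induction A rule: infinite_finite_induct) (auto simp: power_int_mult_distrib)

lemma powi_sum:
  fixes x :: "'k::field"
  assumes "x \<noteq> 0"
  shows "x powi (\<Sum>i\<in>A. f i) = (\<Prod>i\<in>A. x powi f i)"
  using assms by (induction A rule: infinite_finite_induct) (auto simp: power_int_add)

lemma prod_powi_pairing:
  fixes x :: "'k::field ^ 'r::finite"
  assumes "\<And>j. x $ j \<noteq> 0"
  shows "(\<Prod>j\<in>UNIV. (x $ j) powi pairing m (v j)) =
    (\<Prod>i\<in>UNIV. (\<Prod>j\<in>UNIV. (x $ j) powi (v j $ i)) powi (m $ i))"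
proof -
  have "(\<Prod>j\<in>UNIV. (x $ j) powi pairing m (v j))
      = (\<Prod>j\<in>UNIV. \<Prod>i\<in>UNIV. (x $ j) powi (m $ i * v j $ i))"
    unfolding pairing_def by (rule prod.cong[OF refl]) (rule powi_sum[OF assms])
  also have "\<dots> = (\<Prod>i\<in>UNIV. \<Prod>j\<in>UNIV. (x $ j) powi (m $ i * v j $ i))"
    by (rule prod.swap)
  also have "\<dots> = (\<Prod>i\<in>UNIV. (\<Prod>j\<in>UNIV. (x $ j) powi (v j $ i)) powi (m $ i))"
    unfolding prod_powi power_int_mult[symmetric] by (simp only: mult.commute)
  finally show ?thesis .
qed

text \<open>The Laurent monomial with exponent \<open>D\<close>. On the torus it has no zeros and
  trivializes the sections of degree \<open>D\<close>, also where \<open>D\<close> has negative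
  coefficients.\<close>

definition laurent_mon :: "('r::finite \<Rightarrow>\<^sub>0 int) \<Rightarrow> 'k::field ^ 'r \<Rightarrow> 'k" where
  "laurent_mon D x = (\<Prod>j\<in>UNIV. (x $ j) powi Poly_Mapping.lookup D j)"

lemma mon_eval_laurent: "mon_eval a x = laurent_mon (exp_divisor a) x"
  by (simp add: mon_eval_def laurent_mon_def)

lemma laurent_mon_char:
  fixes x :: "'k::field ^ 'r::finite"
  assumes "\<And>j. x $ j \<noteq> 0"
  shows "laurent_mon (D + char_divisor v m) x
    = laurent_mon D x * (\<Prod>j\<in>UNIV. (x $ j) powi pairing m (v j))"
  using assms by (simp add: laurent_mon_def lookup_add power_int_add prod.distrib)

lemma laurent_mon_nonzero:
  fixes x :: "'k::field ^ 'r::finite"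
  shows "(\<And>j. x $ j \<noteq> 0) \<Longrightarrow> laurent_mon D x \<noteq> 0"
  by (simp add: laurent_mon_def)

text \<open>Monomials of equal degree differ by characters, and these are 1 on the group. So all
  monomials of \<open>f\<close> are scaled by the same factor.\<close>

lemma poly_eval_cox_group:
  assumes g: "g \<in> cox_group v" and f: "f \<in> graded_piece v (div_class v D)"
  shows "poly_eval f (\<chi> j. g $ j * x $ j) = laurent_mon D g * poly_eval f x"
proof -
  have e: "mon_eval a (\<chi> j. g $ j * x $ j) = laurent_mon D g * mon_eval a x"
    if a: "a \<in> Poly_Mapping.keys f" for a
  proof -
    obtain m where m: "exp_divisor a = D + char_divisor v m"
      using f a unfolding graded_piece_iff by blast
    have "mon_eval a (\<chi> j. g $ j * x $ j) = mon_eval a g * mon_eval a x"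
      by (simp add: mon_eval_def power_mult_distrib prod.distrib)
    also have "mon_eval a g = laurent_mon D g"
      using g unfolding mon_eval_laurent m by (subst laurent_mon_char) (auto simp: cox_group_def)
    finally show ?thesis .
  qed
  have "poly_eval f (\<chi> j. g $ j * x $ j)
      = (\<Sum>a\<in>Poly_Mapping.keys f. Poly_Mapping.lookup f a * mon_eval a (\<chi> j. g $ j * x $ j))"
    by (rule poly_eval_superset) auto
  also have "\<dots> = (\<Sum>a\<in>Poly_Mapping.keys f. laurent_mon D g * (Poly_Mapping.lookup f a * mon_eval a x))"
    by (rule sum.cong[OF refl]) (simp only: e mult_ac)
  also have "\<dots> = laurent_mon D g * poly_eval f x"
    by (simp only: poly_eval_superset[OF finite_keys order_refl] sum_distrib_left)
  finally show ?thesis .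
qed

lemma zero_set_ideal_gen: "zero_set (ideal_gen A) = zero_set A"
proof
  have "A \<subseteq> ideal_gen A" unfolding ideal_gen_def by (rule ring_span_superset)
  then show "zero_set (ideal_gen A) \<subseteq> zero_set A" unfolding zero_set_def by blast
  show "zero_set A \<subseteq> zero_set (ideal_gen A)"
  proof
    fix x assume x: "x \<in> zero_set A"
    have "poly_eval f x = 0" if "f \<in> Modules.module.span (*) A" for f
      using that by (induction rule: ring_span_induct_alt) (use x in \<open>auto simp: zero_set_def\<close>)
    then show "x \<in> zero_set (ideal_gen A)" unfolding zero_set_def ideal_gen_def by blast
  qed
qed

lemma mem_cox_quotient: "x \<in> cox_quotient v x"
  unfolding cox_quotient_def
  by (intro CollectI exI[of _ "\<chi> j. 1"]) (auto simp: cox_group_def vec_eq_iff)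

lemma quotient_in_subvariety:
  assumes I: "homogeneous_ideal v I" and x: "x \<in> zero_set I" "x \<notin> zero_set (irrelevant_ideal \<Sigma> v)"
  shows "cox_quotient v x \<in> subvariety \<Sigma> v I"
proof -
  have gen: "zero_set I = zero_set {f \<in> I. homogeneous v f}"
    using I zero_set_ideal_gen unfolding homogeneous_ideal_def by metis
  have "y \<in> zero_set I" if y: "y \<in> cox_quotient v x" for y
  proof -
    obtain g where g: "g \<in> cox_group v" "y = (\<chi> j. g $ j * x $ j)"
      using y by (auto simp: cox_quotient_def)
    have "poly_eval f y = 0" if f: "f \<in> I" "homogeneous v f" for f
    proof -
      obtain D where D: "f \<in> graded_piece v (div_class v D)"
        using f(2) unfolding homogeneous_def carrier_Cl by blast
      have "poly_eval f y = laurent_mon D g * poly_eval f x"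
        unfolding g(2) by (rule poly_eval_cox_group[OF g(1) D])
      moreover have "poly_eval f x = 0" using x(1) f(1) unfolding zero_set_def by blast
      ultimately show ?thesis by simp
    qed
    then have "y \<in> zero_set {f \<in> I. homogeneous v f}" by (simp add: zero_set_def)
    then show ?thesis by (simp only: gen)
  qed
  then have "cox_quotient v x \<subseteq> zero_set I" by (rule subsetI)
  moreover have "cox_quotient v x \<in> toric_variety \<Sigma> v"
    unfolding toric_variety_def using x(2) by (intro imageI) simp
  ultimately show ?thesis by (simp add: subvariety_def)
qed

lemma is_ideal_ideal_gen: "is_ideal (ideal_gen A)"
  unfolding is_ideal_iff ideal_gen_def
  by (auto intro: ring_span_zero ring_span_add ring_span_scale)

lemma ideal_gen_superset: "A \<subseteq> ideal_gen A"
  unfolding ideal_gen_def by (rule ring_span_superset)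

lemma ideal_gen_minimal: "A \<subseteq> I \<Longrightarrow> is_ideal I \<Longrightarrow> ideal_gen A \<subseteq> I"
  unfolding ideal_gen_def is_ideal_def by (rule ring_span_minimal)

text \<open>If \<open>f\<close> vanishes on \<open>Y\<close> and \<open>b\<close> lies in the irrelevant ideal, then \<open>f * b\<close> vanishes on all
  of the affine zero set of \<open>I\<close>, so that the affine Nullstellensatz applies.\<close>

lemma mem_ideal_of_iff:
  fixes f :: "('r::finite, 'k::alg_closed_field) cox_ring"
  assumes I: "is_ideal_of \<Sigma> v Y I"
  shows "f \<in> I \<longleftrightarrow> (\<forall>q\<in>Y. \<forall>x\<in>q. poly_eval f x = 0)"
proof
  assume "f \<in> I"
  then show "\<forall>q\<in>Y. \<forall>x\<in>q. poly_eval f x = 0"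
    using I unfolding is_ideal_of_def subvariety_def zero_set_def by blast
next
  assume van: "\<forall>q\<in>Y. \<forall>x\<in>q. poly_eval f x = 0"
  let ?B = "irrelevant_ideal \<Sigma> v :: ('r, 'k) cox_ring set"
  have rad: "is_ideal I" "\<And>f k. f ^ k \<in> I \<Longrightarrow> f \<in> I"
    using I by (auto simp: is_ideal_of_def radical_ideal_def)
  have fb: "f * b \<in> I" if b: "b \<in> ?B" for b
  proof -
    have "poly_eval (f * b) x = 0" if x: "x \<in> zero_set I" for x
    proof (cases "x \<in> zero_set ?B")
      case True
      then show ?thesis using b by (simp add: zero_set_def)
    next
      case False
      then have "cox_quotient v x \<in> Y"
        using quotient_in_subvariety[OF _ x False] I by (simp add: is_ideal_of_def)
      then have "poly_eval f x = 0" using van mem_cox_quotient by blast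
      then show ?thesis by simp
    qed
    then obtain k where "(f * b) ^ k \<in> I" using Nullstellensatz[OF rad(1)] by blast
    then show ?thesis by (rule rad(2))
  qed
  \<comment> \<open>Exponent 1 suffices in the saturation, since the products with the irrelevant
    ideal already lie in \<open>I\<close> by radicality.\<close>
  have "ideal_power ?B 1 \<subseteq> ?B"
    unfolding ideal_power_def
    by (rule ideal_gen_minimal) (auto simp: irrelevant_ideal_def is_ideal_ideal_gen)
  then have "\<forall>g\<in>ideal_power ?B 1. f * g \<in> I" using fb by blast
  then show "f \<in> I" using I unfolding is_ideal_of_def saturated_def by blast
qed

section \<open>Evaluation at points of the torus\<close>

definition char_vec :: "('s::finite \<Rightarrow> 'q::field ^ 'n) \<Rightarrow> int ^ 'n \<Rightarrow> 'q ^ 's" where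
  "char_vec p m = (\<chi> s. \<Prod>i\<in>UNIV. (p s $ i) powi (m $ i))"

lemma to_ac_powi: "to_ac (x powi n) = to_ac x powi n"
  by (simp add: power_int_def)

lemma torus_point_mon_eval:
  assumes x: "x \<in> torus_point v (alg_closure_point (p s))" and a: "exp_divisor a = D + char_divisor v m"
  shows "mon_eval a x = laurent_mon D x * to_ac (char_vec p m $ s)"
proof -
  have x0: "x $ j \<noteq> 0" for j using x by (simp add: torus_point_def)
  have "(\<Prod>j\<in>UNIV. (x $ j) powi (v j $ i)) = to_ac (p s $ i)" for i
    using x by (simp add: torus_point_def alg_closure_point_def)
  then show ?thesis
    unfolding mon_eval_laurent a laurent_mon_char[OF x0] prod_powi_pairing[OF x0]
    by (simp add: char_vec_def to_ac_prod to_ac_powi)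
qed

lemma torus_point_nonzero: "x \<in> torus_point v t \<Longrightarrow> x $ j \<noteq> 0"
  by (simp add: torus_point_def)

context lattice_fan
begin

text \<open>The value of a section of degree \<open>D\<close> at a point with homogeneous coordinates \<open>x\<close> is
  \<open>poly_eval f x / laurent_mon D x\<close>; it depends on the point only.\<close>

definition section_value :: "('s::finite \<Rightarrow> 'q::finite_field ^ 'n) \<Rightarrow> ('r \<Rightarrow>\<^sub>0 int) \<Rightarrow>
    ('r, 'q alg_closure) cox_ring \<Rightarrow> 'q alg_closure ^ 's" where
  "section_value p D f = (\<Sum>m\<in>lattice_points v D.
     Poly_Mapping.lookup f (Poly_Mapping.map nat (D + char_divisor v m)) *s map_vec to_ac (char_vec p m))"

lemma poly_eval_section:
  assumes f: "f \<in> graded_piece v (div_class v D)"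
    and x: "x \<in> torus_point v (alg_closure_point (p s))"
  shows "poly_eval f x = laurent_mon D x * section_value p D f $ s"
proof -
  let ?g = "\<lambda>m. Poly_Mapping.map nat (D + char_divisor v m)"
  have "poly_eval f x = (\<Sum>a\<in>exponents v D. Poly_Mapping.lookup f a * mon_eval a x)"
    using f unfolding graded_piece_exponents by (rule poly_eval_superset[OF finite_exponents])
  also have "\<dots> = (\<Sum>m\<in>lattice_points v D. Poly_Mapping.lookup f (?g m) * mon_eval (?g m) x)"
    by (rule sum.reindex_bij_betw[OF bij_exponents, symmetric])
  also have "\<dots> = (\<Sum>m\<in>lattice_points v D.
      laurent_mon D x * (Poly_Mapping.lookup f (?g m) * to_ac (char_vec p m $ s)))"
  proof (rule sum.cong[OF refl])
    fix m assume "m \<in> lattice_points v D"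
    from torus_point_mon_eval[where p = p and s = s, OF x exp_divisor_map_nat[OF this]]
    show "Poly_Mapping.lookup f (?g m) * mon_eval (?g m) x
        = laurent_mon D x * (Poly_Mapping.lookup f (?g m) * to_ac (char_vec p m $ s))"
      by (simp only: mult_ac)
  qed
  finally show ?thesis by (simp add: section_value_def sum_distrib_left)
qed

lemma section_value_zero_iff:
  assumes f: "f \<in> graded_piece v (div_class v D)"
    and ne: "\<And>s. torus_point v (alg_closure_point (p s)) \<noteq> {}"
  shows "section_value p D f = 0 \<longleftrightarrow> (\<forall>q\<in>points_in_X v p. \<forall>x\<in>q. poly_eval f x = 0)"
proof
  assume z: "section_value p D f = 0"
  have "poly_eval f x = 0" if x: "x \<in> torus_point v (alg_closure_point (p s))" for x s
    using poly_eval_section[where p = p and s = s, OF f x] by (simp add: z)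
  then show "\<forall>q\<in>points_in_X v p. \<forall>x\<in>q. poly_eval f x = 0"
    by (auto simp: points_in_X_def)
next
  assume van: "\<forall>q\<in>points_in_X v p. \<forall>x\<in>q. poly_eval f x = 0"
  have "section_value p D f $ s = 0" for s
  proof -
    obtain x where x: "x \<in> torus_point v (alg_closure_point (p s))" using ne by blast
    then have "poly_eval f x = 0" using van by (auto simp: points_in_X_def)
    then show ?thesis
      using poly_eval_section[where p = p and s = s, OF f x] laurent_mon_nonzero[OF torus_point_nonzero[OF x]] by simp
  qed
  then show "section_value p D f = 0" by (simp add: vec_eq_iff)
qed

lemma section_value_linear:
  "Vector_Spaces.linear cox_scale (*s) (section_value p D)"
  unfolding Vector_Spaces.linear_iff
proof (intro conjI allI cox.vector_space_axioms vec.vector_space_axioms)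
  fix f g c
  show "section_value p D (f + g) = section_value p D f + section_value p D g"
    by (simp add: section_value_def lookup_add vec.scale_left_distrib sum.distrib)
  show "section_value p D (cox_scale c f) = c *s section_value p D f"
    by (simp add: section_value_def vec.scale_sum_right)
qed

lemma section_value_monomial:
  assumes a: "exp_divisor a = D + char_divisor v m"
  shows "section_value p D (Poly_Mapping.single a c) = c *s map_vec to_ac (char_vec p m)"
proof -
  let ?g = "\<lambda>m. Poly_Mapping.map nat (D + char_divisor v m)"
  have ga: "?g m = a" unfolding a[symmetric] by (rule poly_mapping_eqI) (simp add: map.rep_eq when_def)
  have m: "m \<in> lattice_points v D" by (rule lattice_points_of_exponent[OF a])
  have iff: "?g m' = a \<longleftrightarrow> m' = m" if "m' \<in> lattice_points v D" for m'
    using bij_betw_imp_inj_on[OF bij_exponents, of D] ga m that by (auto simp: inj_on_def)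
  have "section_value p D (Poly_Mapping.single a c)
      = (\<Sum>m'\<in>lattice_points v D. if m' = m then c *s map_vec to_ac (char_vec p m) else 0)"
    unfolding section_value_def
  proof (rule sum.cong[OF refl])
    fix m' assume m': "m' \<in> lattice_points v D"
    show "Poly_Mapping.lookup (Poly_Mapping.single a c) (?g m') *s map_vec to_ac (char_vec p m')
        = (if m' = m then c *s map_vec to_ac (char_vec p m) else 0)"
    proof (cases "m' = m")
      case True
      then have "?g m' = a" using ga by (simp only:)
      then show ?thesis unfolding True by simp
    next
      case False
      then have "a \<noteq> ?g m'" using iff[OF m'] by metis
      then show ?thesis using False by (simp add: lookup_single_not_eq)
    qed
  qed
  then show ?thesis using m finite_lattice_points by simp
qed

lemma section_value_image:
  fixes p :: "'s::finite \<Rightarrow> 'q::finite_field ^ 'n"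
  shows "section_value p D ` graded_piece v (div_class v D)
    = vec.span (map_vec to_ac ` char_vec p ` lattice_points v D)"
proof -
  interpret pair: vector_space_pair
    "cox_scale :: 'q alg_closure \<Rightarrow> ('r, 'q alg_closure) cox_ring \<Rightarrow> _"
    "(*s) :: 'q alg_closure \<Rightarrow> 'q alg_closure ^ 's \<Rightarrow> _" ..
  have img: "section_value p D ` monomial_basis D = map_vec to_ac ` char_vec p ` lattice_points v D"
  proof
    show "section_value p D ` monomial_basis D \<subseteq> map_vec to_ac ` char_vec p ` lattice_points v D"
    proof clarify
      fix a assume "a \<in> exponents v D"
      then obtain m where m: "exp_divisor a = D + char_divisor v m" by (auto simp: exponents_def)
      then have "m \<in> lattice_points v D" by (rule lattice_points_of_exponent)
      then show "section_value p D (Poly_Mapping.single a 1) \<in> map_vec to_ac ` char_vec p ` lattice_points v D"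
        unfolding section_value_monomial[OF m] by simp
    qed
    show "map_vec to_ac ` char_vec p ` lattice_points v D \<subseteq> section_value p D ` monomial_basis D"
    proof clarify
      fix m assume m: "m \<in> lattice_points v D"
      obtain a where a: "exp_divisor a = D + char_divisor v m" using exp_divisor_map_nat[OF m] by blast
      then have "a \<in> exponents v D" by (auto simp: exponents_def)
      moreover have "map_vec to_ac (char_vec p m) = section_value p D (Poly_Mapping.single a 1)"
        unfolding section_value_monomial[OF a] by simp
      ultimately show "map_vec to_ac (char_vec p m) \<in> section_value p D ` monomial_basis D" by blast
    qed
  qed
  have "graded_piece v (div_class v D) = cox.span (monomial_basis D :: ('r, 'q alg_closure) cox_ring set)"
  proof
    show "cox.span (monomial_basis D) \<subseteq> (graded_piece v (div_class v D) :: ('r, 'q alg_closure) cox_ring set)"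
      by (rule cox.span_minimal[OF _ graded_subspace]) (auto simp: graded_piece_exponents)
  qed (rule graded_span)
  then show ?thesis
    using pair.linear_span_image[OF section_value_linear, of p D "monomial_basis D"] img by simp
qed

text \<open>Defined for every divisor, also when its class contains no monomial to divide by, and
  the dimension is then 0. This makes the codes of different degrees comparable.\<close>

definition code_dim :: "('s::finite \<Rightarrow> 'q::finite_field ^ 'n) \<Rightarrow> ('r \<Rightarrow>\<^sub>0 int) \<Rightarrow> nat" where
  "code_dim p D = vec.dim (char_vec p ` lattice_points v D)"

text \<open>Rank-nullity over the closure for the evaluation of sections. Its kernel is the graded
  piece of the vanishing ideal, and its image is spanned by vectors over the finite field, so
  extension of scalars gives the dimension.\<close>

lemma code_dim_hilbert:
  fixes p :: "'s::finite \<Rightarrow> 'q::finite_field ^ 'n"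
  assumes ne: "\<And>s. torus_point v (alg_closure_point (p s)) \<noteq> {}"
    and I: "\<And>f. f \<in> I \<longleftrightarrow> (\<forall>q\<in>points_in_X v p. \<forall>x\<in>q. poly_eval f x = 0)"
  shows "card (lattice_points v D) = code_dim p D + cox.dim (I \<inter> graded_piece v (div_class v D))"
proof -
  interpret pair: vector_space_pair
    "cox_scale :: 'q alg_closure \<Rightarrow> ('r, 'q alg_closure) cox_ring \<Rightarrow> _"
    "(*s) :: 'q alg_closure \<Rightarrow> 'q alg_closure ^ 's \<Rightarrow> _" ..
  let ?S = "graded_piece v (div_class v D) :: ('r, 'q alg_closure) cox_ring set"
  have ker: "{f \<in> ?S. section_value p D f = 0} = I \<inter> ?S"
  proof (rule Set.set_eqI)
    fix f
    show "f \<in> {f \<in> ?S. section_value p D f = 0} \<longleftrightarrow> f \<in> I \<inter> ?S"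
    proof (cases "f \<in> ?S")
      case True
      then show ?thesis using section_value_zero_iff[OF True ne] I[of f] by simp
    qed simp
  qed
  have "cox.dim ?S = vec.dim (section_value p D ` ?S) + cox.dim (I \<inter> ?S)"
    using pair.rank_nullity[OF section_value_linear[of p D] graded_subspace[of v D] graded_span[of D] finite_basis[of D]]
    unfolding ker .
  also have "vec.dim (section_value p D ` ?S) = code_dim p D"
    unfolding section_value_image vec.dim_span code_dim_def
    by (rule dim_map_vec) (auto simp: inj_to_ac)
  finally show ?thesis unfolding dim_graded .
qed

text \<open>For the representative \<open>exp_divisor a\<close> of the class, the monomial in the
  denominator is exactly \<open>laurent_mon\<close>, so the quotients are section values.
  Coefficients fixed by Frobenius correspond to linear combinations over the finite field.\<close>

lemma evaluation_code_span:
  fixes p :: "'s::finite \<Rightarrow> 'q::finite_field ^ 'n"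
  assumes ne: "\<And>s. torus_point v (alg_closure_point (p s)) \<noteq> {}"
  shows "evaluation_code v p (div_class v (exp_divisor a)) (Poly_Mapping.single a 1)
    = vec.span (char_vec p ` lattice_points v (exp_divisor a))"
proof -
  let ?D = "exp_divisor a" and ?F0 = "Poly_Mapping.single a 1 :: ('r, 'q alg_closure) cox_ring"
  let ?C = "evaluation_code v p (div_class v ?D) ?F0"
  have F0: "poly_eval ?F0 x = laurent_mon ?D x" for x
    by (simp add: mon_eval_laurent)
  have mem: "c \<in> ?C \<longleftrightarrow> (\<exists>F\<in>frobenius_piece v (div_class v ?D). map_vec to_ac c = section_value p ?D F)" for c
  proof -
    have "(\<forall>s. \<forall>x\<in>torus_point v (alg_closure_point (p s)). to_ac (c $ s) = poly_eval F x / poly_eval ?F0 x)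
        \<longleftrightarrow> map_vec to_ac c = section_value p ?D F"
      if F: "F \<in> frobenius_piece v (div_class v ?D)" for F
    proof -
      have gp: "F \<in> graded_piece v (div_class v ?D)" using F by (simp add: frobenius_piece_def)
      have q: "poly_eval F x / poly_eval ?F0 x = section_value p ?D F $ s"
        if x: "x \<in> torus_point v (alg_closure_point (p s))" for x s
        unfolding F0
        using poly_eval_section[where p = p and s = s, OF gp x] laurent_mon_nonzero[OF torus_point_nonzero[OF x]]
        by simp
      show ?thesis
      proof
        assume L: "\<forall>s. \<forall>x\<in>torus_point v (alg_closure_point (p s)). to_ac (c $ s) = poly_eval F x / poly_eval ?F0 x"
        have "to_ac (c $ s) = section_value p ?D F $ s" for s
        proof -
          obtain x where x: "x \<in> torus_point v (alg_closure_point (p s))" using ne by blast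
          then show ?thesis using L q[OF x] by simp
        qed
        then show "map_vec to_ac c = section_value p ?D F" by (simp add: vec_eq_iff)
      next
        assume R: "map_vec to_ac c = section_value p ?D F"
        have "to_ac (c $ s) = section_value p ?D F $ s" for s
          using arg_cong[OF R, of "\<lambda>y. y $ s"] by simp
        then show "\<forall>s. \<forall>x\<in>torus_point v (alg_closure_point (p s)). to_ac (c $ s) = poly_eval F x / poly_eval ?F0 x"
          using q by simp
      qed
    qed
    then show ?thesis unfolding evaluation_code_def by blast
  qed
  show ?thesis
  proof
    show "?C \<subseteq> vec.span (char_vec p ` lattice_points v ?D)"
    proof
      fix c assume "c \<in> ?C"
      then obtain F where F: "F \<in> frobenius_piece v (div_class v ?D)"
        "map_vec to_ac c = section_value p ?D F" unfolding mem by blast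
      let ?g = "\<lambda>m. Poly_Mapping.map nat (?D + char_divisor v m)"
      have "\<forall>b. \<exists>t. Poly_Mapping.lookup F b = to_ac t" using F(1) by (auto simp: frobenius_piece_def)
      then obtain t where t: "\<And>b. Poly_Mapping.lookup F b = to_ac (t b)" by metis
      have "to_ac (c $ s) = to_ac ((\<Sum>m\<in>lattice_points v ?D. t (?g m) *s char_vec p m) $ s)" for s
        using arg_cong[OF F(2), of "\<lambda>y. y $ s"] by (simp add: section_value_def t to_ac_sum)
      then have "c = (\<Sum>m\<in>lattice_points v ?D. t (?g m) *s char_vec p m)"
        by (simp only: to_ac_eq_iff vec_eq_iff) simp
      also have "\<dots> \<in> vec.span (char_vec p ` lattice_points v ?D)"
        by (intro vec.span_sum vec.span_scale vec.span_base) simp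
      finally show "c \<in> vec.span (char_vec p ` lattice_points v ?D)" .
    qed
    show "vec.span (char_vec p ` lattice_points v ?D) \<subseteq> ?C"
    proof
      fix c assume "c \<in> vec.span (char_vec p ` lattice_points v ?D)"
      then show "c \<in> ?C"
      proof (induction rule: vec.span_induct_alt)
        case base
        have "(0 :: ('r, 'q alg_closure) cox_ring) \<in> frobenius_piece v (div_class v ?D)"
          by (auto simp: frobenius_piece_def graded_piece_def image_iff intro!: exI[of _ 0])
        moreover have "map_vec to_ac (0 :: 'q ^ 's) = section_value p ?D 0"
          by (simp add: section_value_def vec_eq_iff)
        ultimately show ?case unfolding mem by blast
      next
        case (step k x y)
        obtain m where m: "m \<in> lattice_points v ?D" "x = char_vec p m" using step.hyps by blast
        obtain F where F: "F \<in> frobenius_piece v (div_class v ?D)"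
          "map_vec to_ac y = section_value p ?D F" using step.IH unfolding mem by blast
        obtain b where b: "exp_divisor b = ?D + char_divisor v m" using exp_divisor_map_nat[OF m(1)] by blast
        let ?F = "Poly_Mapping.single b (to_ac k) + F"
        have "Poly_Mapping.single b (to_ac k) \<in> graded_piece v (div_class v ?D)"
          unfolding graded_piece_iff using b by (auto split: if_splits)
        then have "?F \<in> graded_piece v (div_class v ?D)"
          using F(1) cox.subspace_add[OF graded_subspace] by (auto simp: frobenius_piece_def)
        moreover have "Poly_Mapping.lookup ?F e \<in> range to_ac" for e
        proof -
          obtain r where "Poly_Mapping.lookup F e = to_ac r" using F(1) by (auto simp: frobenius_piece_def)
          then have "Poly_Mapping.lookup ?F e = to_ac ((if b = e then k else 0) + r)"
            by (simp add: lookup_add lookup_single when_def)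
          then show ?thesis by (rule range_eqI)
        qed
        ultimately have "?F \<in> frobenius_piece v (div_class v ?D)" by (simp add: frobenius_piece_def)
        moreover have "section_value p ?D ?F = section_value p ?D (Poly_Mapping.single b (to_ac k)) + section_value p ?D F"
          using section_value_linear[of p ?D] unfolding Vector_Spaces.linear_iff by blast
        then have "map_vec to_ac (k *s x + y) = section_value p ?D ?F"
          unfolding section_value_monomial[OF b] F(2)[symmetric] m(2) by (simp add: vec_eq_iff)
        ultimately show ?case unfolding mem by blast
      qed
    qed
  qed
qed

end

section \<open>The dimension of the code\<close>

lemma char_vec_nth: "char_vec p m $ s = (\<Prod>i\<in>UNIV. (p s $ i) powi (m $ i))"
  by (simp add: char_vec_def)

lemma char_vec_add:
  fixes p :: "'s::finite \<Rightarrow> 'q::field ^ 'n"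
  assumes "\<And>s i. p s $ i \<noteq> 0"
  shows "char_vec p (m + m') $ s = char_vec p m $ s * char_vec p m' $ s"
  using assms by (simp add: char_vec_nth power_int_add prod.distrib)

lemma char_vec_nonzero:
  fixes p :: "'s::finite \<Rightarrow> 'q::field ^ 'n"
  assumes "\<And>s i. p s $ i \<noteq> 0"
  shows "char_vec p m $ s \<noteq> 0"
  using assms by (simp add: char_vec_nth)

lemma char_vec_0: "char_vec p 0 $ s = 1"
  by (simp add: char_vec_nth)

lemma char_vec_axis:
  fixes p :: "'s::finite \<Rightarrow> 'q::field ^ 'n"
  shows "char_vec p (axis i 1) $ s = p s $ i"
proof -
  have "char_vec p (axis i 1) $ s = (\<Prod>k\<in>UNIV. if k = i then p s $ i else 1)"
    unfolding char_vec_nth by (rule prod.cong) (auto simp: axis_def)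
  then show ?thesis by simp
qed

text \<open>The span of the characters is an algebra that contains the constants and separates the points.\<close>

lemma span_char_vec:
  fixes p :: "'s::finite \<Rightarrow> 'q::field ^ 'n"
  assumes inj: "inj p" and nz: "\<And>s i. p s $ i \<noteq> 0"
  shows "vec.span (range (char_vec p)) = UNIV"
proof -
  let ?W = "vec.span (range (char_vec p))"
  have c: "char_vec p m \<in> ?W" for m by (intro vec.span_base) simp
  have mult: "(\<chi> s. (a *s char_vec p m + b *s char_vec p m') $ s * w $ s) \<in> ?W"
    if "w \<in> ?W" for w a b m m'
    using that
  proof (induction rule: vec.span_induct_alt)
    case base
    have "(\<chi> s. (a *s char_vec p m + b *s char_vec p m') $ s * (0 :: 'q ^ 's) $ s) = 0"
      by (simp add: vec_eq_iff)
    then show ?case using vec.span_zero by metis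
  next
    case (step k x y)
    obtain l where l: "x = char_vec p l" using step.hyps by blast
    have "(\<chi> s. (a *s char_vec p m + b *s char_vec p m') $ s * (k *s x + y) $ s)
        = k *s (a *s char_vec p (m + l) + b *s char_vec p (m' + l))
          + (\<chi> s. (a *s char_vec p m + b *s char_vec p m') $ s * y $ s)"
      unfolding vec_eq_iff l
      by (simp only: vec_lambda_beta vector_add_component vector_smult_component char_vec_add[OF nz]
          distrib_left distrib_right mult_ac add_ac simp_thms)
    also have "\<dots> \<in> ?W" by (intro vec.span_add vec.span_scale c step.IH)
    finally show ?case .
  qed
  have sep: "\<exists>w\<in>?W. w $ s = 1 \<and> (\<forall>s'\<in>Q. w $ s' = 0)" if "finite Q" "s \<notin> Q" for s and Q :: "'s set"
    using that
  proof (induction Q rule: finite_induct)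
    case empty
    have "char_vec p 0 $ s = 1" by (rule char_vec_0)
    then show ?case using c[of 0] by blast
  next
    case (insert s' Q)
    then obtain w where w: "w \<in> ?W" "w $ s = 1" "\<forall>s'\<in>Q. w $ s' = 0" by blast
    have "p s \<noteq> p s'" using insert.prems inj by (auto simp: inj_def)
    then obtain i where i: "p s $ i \<noteq> p s' $ i" by (auto simp: vec_eq_iff)
    \<comment> \<open>Lagrange interpolation: \<open>w\<close> is multiplied by the affine function
      of the \<open>i\<close>-th coordinate that is 1 at \<open>s\<close> and 0 at
      \<open>s'\<close>.\<close>
    define d where "d = inverse (p s $ i - p s' $ i)"
    define w' where "w' = (\<chi> t. (d *s char_vec p (axis i 1) + (- d * p s' $ i) *s char_vec p 0) $ t * w $ t)"
    have w': "w' $ t = d * (p t $ i - p s' $ i) * w $ t" for t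
      by (simp only: w'_def vec_lambda_beta vector_add_component vector_smult_component char_vec_axis
          char_vec_0 distrib_left mult_minus_left mult_minus_right mult_1_right diff_conv_add_uminus)
    have "w' \<in> ?W" unfolding w'_def by (rule mult[OF w(1)])
    moreover have "w' $ s = 1" using i w(2) by (simp add: w' d_def)
    moreover have "\<forall>t\<in>insert s' Q. w' $ t = 0" using w(3) by (simp add: w')
    ultimately show ?case by blast
  qed
  have ax: "axis s 1 \<in> ?W" for s
  proof -
    obtain w where w: "w \<in> ?W" "w $ s = 1" "\<forall>s'\<in>UNIV - {s}. w $ s' = 0"
      using sep[of "UNIV - {s}" s] by auto
    then have "w = axis s 1" by (auto simp: vec_eq_iff axis_def)
    then show ?thesis using w(1) by simp
  qed
  have "x \<in> ?W" for x
  proof -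
    have "(\<Sum>s\<in>UNIV. x $ s *s axis s 1) \<in> ?W" by (intro vec.span_sum vec.span_scale ax)
    then show ?thesis by (simp add: basis_expansion)
  qed
  then show ?thesis by blast
qed

text \<open>A translation of characters is the multiplication by the values of one character, which
  vanish nowhere; this is a linear automorphism.\<close>

lemma dim_char_vec_translate:
  fixes p :: "'s::finite \<Rightarrow> 'q::field ^ 'n"
  assumes nz: "\<And>s i. p s $ i \<noteq> 0" and sub: "\<And>m. m \<in> S \<Longrightarrow> m + m0 \<in> T"
  shows "vec.dim (char_vec p ` S) \<le> vec.dim (char_vec p ` T)"
proof -
  have pair: "vector_space_pair ((*s) :: 'q \<Rightarrow> 'q ^ 's \<Rightarrow> _) ((*s) :: 'q \<Rightarrow> 'q ^ 's \<Rightarrow> _)" ..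
  define f where "f x = (\<chi> s. char_vec p m0 $ s * x $ s)" for x :: "'q ^ 's"
  have lf: "Vector_Spaces.linear (*s) (*s) f"
    unfolding Vector_Spaces.linear_iff
    by (intro conjI allI vec.vector_space_axioms)
      (simp_all only: f_def vec_eq_iff vec_lambda_beta vector_add_component vector_smult_component
        distrib_left mult_ac simp_thms)
  have inj: "inj f"
  proof (rule injI)
    fix x y assume eq: "f x = f y"
    have "x $ s = y $ s" for s
    proof -
      have "char_vec p m0 $ s * x $ s = char_vec p m0 $ s * y $ s"
        using arg_cong[OF eq, of "\<lambda>x. x $ s"] by (simp only: f_def vec_lambda_beta)
      then show ?thesis using char_vec_nonzero[where m = m0 and s = s, OF nz] by (simp only: mult_cancel_left simp_thms)
    qed
    then show "x = y" by (simp only: vec_eq_iff simp_thms)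
  qed
  have "f (char_vec p m) = char_vec p (m + m0)" for m
    by (simp only: f_def vec_eq_iff vec_lambda_beta char_vec_add[OF nz] mult.commute simp_thms)
  then have "f ` char_vec p ` S \<subseteq> char_vec p ` T" using sub by auto
  then have "vec.dim (f ` char_vec p ` S) \<le> vec.dim (char_vec p ` T)" by (rule vec.dim_subset)
  then show ?thesis using vector_space_pair.dim_image_inj[OF pair lf inj_on_subset[OF inj subset_UNIV]] by simp
qed

lemma lattice_points_add:
  "m \<in> lattice_points v D \<Longrightarrow> m' \<in> lattice_points v D' \<Longrightarrow> m + m' \<in> lattice_points v (D + D')"
  unfolding lattice_points_iff lookup_add pairing_add
  by (metis add.assoc add.left_commute add_nonneg_nonneg)

lemma lattice_points_sum:
  "(\<And>i. i \<in> A \<Longrightarrow> m i \<in> lattice_points v (D i)) \<Longrightarrow> (\<Sum>i\<in>A. m i) \<in> lattice_points v (\<Sum>i\<in>A. D i)"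
proof (induction A rule: infinite_finite_induct)
  case (insert a A)
  then show ?case by (simp add: lattice_points_add)
qed (simp_all add: lattice_points_iff)

text \<open>If the local generator of the sheaf on a chart is a combination of global sections, then one of
  their monomials is a local generator.\<close>

lemma semi_ample_vertices:
  fixes K :: "'k::field itself"
  assumes "semi_ample K \<Sigma> v \<alpha>"
  shows "\<exists>D. \<alpha> = div_class v D \<and> (\<forall>\<sigma>\<in>\<Sigma>. \<exists>m\<in>lattice_points v D.
    \<forall>j\<in>cone_rays v \<sigma>. pairing m (v j) = - Poly_Mapping.lookup D j)"
proof -
  obtain D where D: "\<alpha> = div_class v D" "Cartier \<Sigma> v D" "globally_generated K \<Sigma> v D"
    using assms by (auto simp: semi_ample_def)
  have "\<exists>m\<in>lattice_points v D. \<forall>j\<in>cone_rays v \<sigma>. pairing m (v j) = - Poly_Mapping.lookup D j"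
    if \<sigma>: "\<sigma> \<in> \<Sigma>" for \<sigma>
  proof -
    obtain m0 where m0: "\<forall>j\<in>cone_rays v \<sigma>. Poly_Mapping.lookup D j = pairing m0 (v j)"
      using D(2) \<sigma> by (auto simp: Cartier_def)
    define m where "m = - m0"
    have m: "\<forall>j\<in>cone_rays v \<sigma>. pairing m (v j) = - Poly_Mapping.lookup D j"
      using m0 by (simp add: m_def pairing_uminus)
    let ?f = "Poly_Mapping.single m (1::'k)"
    have "?f \<in> div_sections v (cone_rays v \<sigma>) D" using m by (simp add: div_sections_def)
    then obtain k :: nat and g s where gs:
      "\<forall>i<k. g i \<in> div_sections v (cone_rays v \<sigma>) 0 \<and> s i \<in> div_sections v UNIV D"
      "?f = (\<Sum>i<k. g i * s i)"
      using D(3) \<sigma> unfolding globally_generated_def by blast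
    have "m \<in> Poly_Mapping.keys (\<Sum>i<k. g i * s i)" unfolding gs(2)[symmetric] by simp
    then obtain i where i: "i < k" "m \<in> Poly_Mapping.keys (g i * s i)"
      using keys_sum[of "\<lambda>i. g i * s i" "{..<k}"] by blast
    then obtain a b where ab: "m = a + b" "a \<in> Poly_Mapping.keys (g i)" "b \<in> Poly_Mapping.keys (s i)"
      using keys_mult[of "g i" "s i"] by blast
    have a: "\<forall>j\<in>cone_rays v \<sigma>. pairing a (v j) \<ge> 0"
      using gs(1) i(1) ab(2) by (auto simp: div_sections_def)
    have b: "\<forall>j. pairing b (v j) \<ge> - Poly_Mapping.lookup D j"
      using gs(1) i(1) ab(3) by (auto simp: div_sections_def)
    \<comment> \<open>On the rays of the cone the sum of the two pairings attains the sum of their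
      lower bounds, so each attains its own.\<close>
    have "pairing b (v j) = - Poly_Mapping.lookup D j" if "j \<in> cone_rays v \<sigma>" for j
    proof -
      have "pairing a (v j) + pairing b (v j) = - Poly_Mapping.lookup D j"
        using m that by (simp add: ab(1) pairing_add)
      moreover have "pairing a (v j) \<ge> 0" using a that by blast
      moreover have "pairing b (v j) \<ge> - Poly_Mapping.lookup D j" using b by blast
      ultimately show ?thesis by linarith
    qed
    moreover have "b \<in> lattice_points v D" using b by (simp add: lattice_points_def)
    ultimately show ?thesis by blast
  qed
  then show ?thesis using D(1) by blast
qed

lemma alternating_sum_complement:
  assumes N: "finite N"
  shows "(\<Sum>I\<in>Pow N. (-1) ^ card I * f (N - I)) = (-1) ^ card N * (\<Sum>I\<in>Pow N. (-1) ^ card I * (f I :: int))"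
proof -
  have "(\<Sum>I\<in>Pow N. (-1) ^ card I * f (N - I)) = (\<Sum>I\<in>Pow N. (-1) ^ card (N - I) * f I)"
    by (rule sum.reindex_bij_witness[of _ "\<lambda>I. N - I" "\<lambda>I. N - I"]) (auto simp: double_diff)
  also have "\<dots> = (\<Sum>I\<in>Pow N. (-1) ^ card N * ((-1) ^ card I * f I))"
  proof (rule sum.cong[OF refl])
    fix I assume I: "I \<in> Pow N"
    then have "I \<subseteq> N" "finite I" using N finite_subset by auto
    then have "card N = card (N - I) + card I"
      using card_mono[OF N \<open>I \<subseteq> N\<close>] by (simp add: card_Diff_subset)
    then show "(-1) ^ card (N - I) * f I = (-1) ^ card N * ((-1) ^ card I * f I)"
      by (simp add: power_add)
  qed
  finally show ?thesis by (simp only: sum_distrib_left)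
qed

context lattice_fan
begin

lemma code_dim_mono:
  fixes p :: "'s::finite \<Rightarrow> 'q::finite_field ^ 'n"
  assumes nz: "\<And>s i. p s $ i \<noteq> 0" and ne: "lattice_points v (A - D) \<noteq> {}"
  shows "code_dim p D \<le> code_dim p A"
proof -
  obtain m0 where "m0 \<in> lattice_points v (A - D)" using ne by blast
  then have "m + m0 \<in> lattice_points v A" if "m \<in> lattice_points v D" for m
    using lattice_points_add[OF that, of m0 "A - D"] by simp
  then show ?thesis unfolding code_dim_def by (rule dim_char_vec_translate[OF nz])
qed

lemma code_dim_le:
  fixes p :: "'s::finite \<Rightarrow> 'q::finite_field ^ 'n"
  shows "code_dim p D \<le> CARD('s)"
proof -
  have "vec.dim (char_vec p ` lattice_points v D) \<le> vec.dim (UNIV :: ('q ^ 's) set)"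
    by (rule vec.dim_subset) simp
  then show ?thesis unfolding code_dim_def vec_dim_card .
qed

text \<open>Passing to complements of \<open>I\<close> turns both sides into sums over nef divisors.
  Their difference is, up to sign, the mixed difference of the n+1 divisors \<open>H\<close> and
  \<open>E i\<close>, where \<open>H\<close> is \<open>k - 1\<close> times \<open>G\<close> and
  receives the index 0 outside \<open>N\<close>. The assumption \<open>k \<ge> 1\<close> allows one
  copy of \<open>G\<close> to be split off.\<close>

lemma mixed_sum_shift:
  assumes nef: "\<And>i. i \<in> N \<Longrightarrow> nef (E i) (\<mu> i)" and N: "N = {1..CARD('n)}" and k: "k \<ge> (1::nat)"
  defines "G \<equiv> (\<Sum>i\<in>N. E i)"
  shows "(\<Sum>I\<in>Pow N. (-1) ^ card I * int (card (lattice_points v ((\<Sum>i<k. G) - (\<Sum>i\<in>I. E i)))))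
    = (\<Sum>I\<in>Pow N. (-1) ^ card I * int (card (lattice_points v (G - (\<Sum>i\<in>I. E i)))))"
proof -
  let ?c = "\<lambda>D. int (card (lattice_points v D))"
  define H where "H = (\<Sum>i<k - 1. G)"
  have kG: "(\<Sum>i<k. G) = H + G" using k by (cases k) (simp_all add: H_def)
  define A where "A = insert 0 N"
  define D where "D i = (if i = 0 then H else E i)" for i
  define \<nu> where "\<nu> i = (if i = 0 then (\<lambda>J. \<Sum>_<k - 1. \<Sum>i\<in>N. \<mu> i J) else \<mu> i)" for i
  have "nef G (\<lambda>J. \<Sum>i\<in>N. \<mu> i J)" unfolding G_def by (rule nef_sum[OF nef])
  then have "nef H (\<lambda>J. \<Sum>_<k - 1. \<Sum>i\<in>N. \<mu> i J)" unfolding H_def by (intro nef_sum)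
  then have "nef (D i) (\<nu> i)" if "i \<in> A" for i
    using that nef by (auto simp: A_def D_def \<nu>_def)
  moreover have "finite A" "card A > CARD('n)" by (simp_all add: A_def N)
  ultimately have zero: "(\<Sum>I\<in>Pow A. (-1) ^ card I * ?c (\<Sum>i\<in>I. D i)) = 0"
    by (intro mixed_difference)
  have N0: "0 \<notin> N" "finite N" by (simp_all add: N)
  have DE: "(\<Sum>i\<in>I. D i) = (\<Sum>i\<in>I. E i)" if "I \<in> Pow N" for I
    using that N0(1) by (intro sum.cong) (auto simp: D_def)
  have "(\<Sum>I\<in>Pow A. (-1) ^ card I * ?c (\<Sum>i\<in>I. D i))
      = (\<Sum>I\<in>Pow N. (-1) ^ card I * ?c (\<Sum>i\<in>I. D i))
        + (\<Sum>I\<in>Pow N. (-1) ^ card (insert 0 I) * ?c (\<Sum>i\<in>insert 0 I. D i))"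
  proof -
    have "inj_on (insert 0) (Pow N)"
    proof (rule inj_onI)
      fix I I' assume I: "I \<in> Pow N" "I' \<in> Pow N" "insert 0 I = insert 0 I'"
      then have "0 \<notin> I" "0 \<notin> I'" using N0(1) by auto
      then show "I = I'" using I(3) by (rule insert_ident[THEN iffD1])
    qed
    moreover have "Pow N \<inter> insert 0 ` Pow N = {}" using N0(1) by blast
    ultimately show ?thesis
      unfolding A_def Pow_insert using N0(2) by (subst sum.union_disjoint) (auto simp: sum.reindex)
  qed
  also have "(\<Sum>I\<in>Pow N. (-1) ^ card (insert 0 I) * ?c (\<Sum>i\<in>insert 0 I. D i))
      = (\<Sum>I\<in>Pow N. - ((-1) ^ card I * ?c (H + (\<Sum>i\<in>I. E i))))"
  proof (rule sum.cong[OF refl])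
    fix I assume I: "I \<in> Pow N"
    then have "finite I" "0 \<notin> I" using N0 finite_subset by auto
    then have "(\<Sum>i\<in>insert 0 I. D i) = H + (\<Sum>i\<in>I. E i)" "card (insert 0 I) = Suc (card I)"
      using DE[OF I] by (simp_all add: D_def)
    then show "(-1) ^ card (insert 0 I) * ?c (\<Sum>i\<in>insert 0 I. D i) = - ((-1) ^ card I * ?c (H + (\<Sum>i\<in>I. E i)))"
      by simp
  qed
  also have "(\<Sum>I\<in>Pow N. (-1) ^ card I * ?c (\<Sum>i\<in>I. D i)) = (\<Sum>I\<in>Pow N. (-1) ^ card I * ?c (\<Sum>i\<in>I. E i))"
    by (rule sum.cong[OF refl]) (simp only: DE)
  finally have main: "(\<Sum>I\<in>Pow N. (-1) ^ card I * ?c (\<Sum>i\<in>I. E i))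
      = (\<Sum>I\<in>Pow N. (-1) ^ card I * ?c (H + (\<Sum>i\<in>I. E i)))"
    using zero by (simp add: sum_negf)
  have compl: "G - (\<Sum>i\<in>I. E i) = (\<Sum>i\<in>N - I. E i)" if "I \<in> Pow N" for I
    using that N0(2) unfolding G_def by (subst sum_diff) auto
  have "(\<Sum>I\<in>Pow N. (-1) ^ card I * ?c ((\<Sum>i<k. G) - (\<Sum>i\<in>I. E i)))
      = (\<Sum>I\<in>Pow N. (-1) ^ card I * ?c (H + (\<Sum>i\<in>N - I. E i)))"
  proof (rule sum.cong[OF refl])
    fix I assume "I \<in> Pow N"
    from compl[OF this] have "(\<Sum>i<k. G) - (\<Sum>i\<in>I. E i) = H + (\<Sum>i\<in>N - I. E i)"
      unfolding kG by (simp add: add_diff_eq[symmetric])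
    then show "(-1) ^ card I * ?c ((\<Sum>i<k. G) - (\<Sum>i\<in>I. E i)) = (-1) ^ card I * ?c (H + (\<Sum>i\<in>N - I. E i))"
      by (simp only:)
  qed
  also have "\<dots> = (-1) ^ card N * (\<Sum>I\<in>Pow N. (-1) ^ card I * ?c (H + (\<Sum>i\<in>I. E i)))"
    by (rule alternating_sum_complement[OF N0(2), of "\<lambda>I. ?c (H + (\<Sum>i\<in>I. E i))"])
  also have "\<dots> = (-1) ^ card N * (\<Sum>I\<in>Pow N. (-1) ^ card I * ?c (\<Sum>i\<in>I. E i))"
    by (simp only: main)
  also have "\<dots> = (\<Sum>I\<in>Pow N. (-1) ^ card I * ?c (\<Sum>i\<in>N - I. E i))"
    by (rule alternating_sum_complement[OF N0(2), of "\<lambda>I. ?c (\<Sum>i\<in>I. E i)", symmetric])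
  also have "\<dots> = (\<Sum>I\<in>Pow N. (-1) ^ card I * ?c (G - (\<Sum>i\<in>I. E i)))"
    by (rule sum.cong[OF refl]) (simp only: compl)
  finally show ?thesis .
qed

text \<open>If the sum of the vertices of the polytope of \<open>G\<close> lies in its interior, the multiples of the
  polytope absorb every finite set of characters up to translation.\<close>

lemma code_dim_multiple_full:
  fixes p :: "'s::finite \<Rightarrow> 'q::finite_field ^ 'n"
  assumes inj: "inj p" and nz: "\<And>s i. p s $ i \<noteq> 0"
    and nef: "nef G \<mu>" and int: "\<And>j. \<exists>J\<in>top. pairing (\<mu> J) (v j) \<noteq> - Poly_Mapping.lookup G j"
  shows "\<exists>k\<ge>(1::nat). code_dim p (\<Sum>i<k. G) = CARD('s)"
proof -
  obtain B where B: "B \<subseteq> range (char_vec p)" "vec.independent B" "range (char_vec p) \<subseteq> vec.span B"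
    by (rule vec.maximal_independent_subset[of "range (char_vec p)"], rule that)
  have finB: "finite B" using vec.finiteI_independent[OF B(2)] .
  obtain M where M: "finite M" "B = char_vec p ` M"
    using finite_subset_image[OF finB B(1)] by blast
  have "vec.span B = UNIV"
    using vec.span_minimal[OF B(3) vec.subspace_span] span_char_vec[OF inj nz] by auto
  then have dimM: "vec.dim (char_vec p ` M) = CARD('s)"
    unfolding M(2)[symmetric] by (metis vec.dim_span vec_dim_card)
  define t where "t = card top"
  have t: "t \<ge> 1" using top_nonempty by (auto simp: t_def Suc_le_eq card_gt_0_iff)
  \<comment> \<open>The sum of the vertices over all \<open>t\<close> maximal cones. It is a lattice
    point at which every inequality of \<open>t\<close> times \<open>G\<close> is strict, hence
    holds with an integral margin of at least 1.\<close>
  define c where "c = (\<Sum>J\<in>top. \<mu> J)"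
  have c: "pairing c (v j) + int t * Poly_Mapping.lookup G j \<ge> 1" for j
  proof -
    have nn: "0 \<le> pairing (\<mu> J) (v j) + Poly_Mapping.lookup G j" if "J \<in> top" for J
      using nef that unfolding nef_def lattice_points_iff by (simp add: add.commute)
    have "(\<Sum>J\<in>top. pairing (\<mu> J) (v j) + Poly_Mapping.lookup G j) > 0"
    proof -
      obtain J where J: "J \<in> top" "pairing (\<mu> J) (v j) \<noteq> - Poly_Mapping.lookup G j" using int by blast
      then have "pairing (\<mu> J) (v j) + Poly_Mapping.lookup G j > 0" using nn[OF J(1)] by linarith
      then show ?thesis using J(1) nn by (intro sum_pos2[of top J]) auto
    qed
    then show ?thesis by (simp add: c_def pairing_sum sum.distrib t_def)
  qed
  \<comment> \<open>A bound for all pairings of the finitely many characters in \<open>M\<close>.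
    After dilation by \<open>b\<close> the margin absorbs them; the summand 1 keeps the resulting
    multiple positive.\<close>
  define b where "b = 1 + (\<Sum>m\<in>M. \<Sum>j\<in>UNIV. nat \<bar>pairing m (v j)\<bar>)"
  have bound: "pairing m (v j) \<ge> - int b" if m: "m \<in> M" for m j
  proof -
    have "nat \<bar>pairing m (v j)\<bar> \<le> (\<Sum>j\<in>UNIV. nat \<bar>pairing m (v j)\<bar>)"
      by (rule member_le_sum) auto
    also have "\<dots> \<le> (\<Sum>m\<in>M. \<Sum>j\<in>UNIV. nat \<bar>pairing m (v j)\<bar>)"
      by (rule member_le_sum[OF m, of "\<lambda>m. \<Sum>j\<in>UNIV. nat \<bar>pairing m (v j)\<bar>"]) (use M in auto)
    finally have "nat \<bar>pairing m (v j)\<bar> \<le> b" by (simp add: b_def)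
    then show ?thesis by linarith
  qed
  let ?k = "b * t"
  let ?u = "\<Sum>i<b. c"
  have lk: "Poly_Mapping.lookup (\<Sum>i<?k. G) j = int b * int t * Poly_Mapping.lookup G j" for j
    by (simp add: lookup_sum)
  have "m + ?u \<in> lattice_points v (\<Sum>i<?k. G)" if m: "m \<in> M" for m
    unfolding lattice_points_iff
  proof
    fix j
    have "int b * (pairing c (v j) + int t * Poly_Mapping.lookup G j) \<ge> int b * 1"
      using c by (intro mult_left_mono) auto
    then have "int b \<le> int b * pairing c (v j) + int b * int t * Poly_Mapping.lookup G j"
      by (simp only: distrib_left mult_1_right mult.assoc)
    then show "0 \<le> Poly_Mapping.lookup (\<Sum>i<?k. G) j + pairing (m + ?u) (v j)"
      unfolding lk pairing_add pairing_sum using bound[OF m, of j] by simp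
  qed
  then have "CARD('s) \<le> code_dim p (\<Sum>i<?k. G)"
    unfolding code_dim_def dimM[symmetric] by (rule dim_char_vec_translate[OF nz])
  then have "code_dim p (\<Sum>i<?k. G) = CARD('s)" using code_dim_le by (intro antisym)
  moreover have "?k \<ge> 1" using t by (simp add: b_def)
  ultimately show ?thesis by blast
qed

end

context complete_simplicial
begin

lemma nef_vertices:
  assumes "\<forall>\<sigma>\<in>\<Sigma>. \<exists>m\<in>lattice_points v D. \<forall>j\<in>cone_rays v \<sigma>. pairing m (v j) = - Poly_Mapping.lookup D j"
  obtains \<mu> where "nef D \<mu>"
proof -
  have "\<forall>J\<in>top. \<exists>m. (\<forall>j\<in>J. pairing m (v j) = - Poly_Mapping.lookup D j) \<and> m \<in> lattice_points v D"
    using assms by (auto simp: top_def)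
  then obtain \<mu> where "\<forall>J\<in>top. (\<forall>j\<in>J. pairing (\<mu> J) (v j) = - Poly_Mapping.lookup D j) \<and> \<mu> J \<in> lattice_points v D"
    by (rule bchoice[THEN exE])
  then have "nef D \<mu>" by (simp add: nef_def)
  then show thesis by (rule that)
qed

text \<open>The vector opposite to \<open>v j\<close> lies in some maximal cone \<open>J\<close>,
  and on that cone the vertex of \<open>J\<close> is minimal among the points of the polytope. Hence
  the pairing with \<open>v j\<close> is largest at this vertex, where by assumption it has its
  smallest possible value.\<close>

lemma nef_flat:
  assumes nef: "nef D \<mu>" and flat: "\<And>J. J \<in> top \<Longrightarrow> pairing (\<mu> J) (v j) = - Poly_Mapping.lookup D j"
    and m: "m \<in> lattice_points v D"
  shows "pairing m (v j) = - Poly_Mapping.lookup D j"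
proof -
  obtain c where c: "\<forall>k. c k \<ge> 0" "{k. c k \<noteq> 0} \<in> cone_rays v ` \<Sigma>"
    "- rvec (v j) = (\<Sum>k\<in>UNIV. c k *\<^sub>R rvec (v k))"
    using rep_ex[of "- rvec (v j)"] by blast
  obtain w :: "real ^ 'n" where w: "generic w" using generic_in_open[of UNIV] by auto
  obtain J where J: "J \<in> top" "{k. c k \<noteq> 0} \<subseteq> J" using local_top_exists[OF c(2) w] by blast
  have pr: "- real_of_int (pairing m' (v j)) = (\<Sum>k\<in>UNIV. c k * real_of_int (pairing m' (v k)))" for m'
    using arg_cong[OF c(3), of "\<lambda>x. rvec m' \<bullet> x"] by (simp add: inner_sum_right rvec_inner)
  have "(\<Sum>k\<in>UNIV. c k * real_of_int (pairing (\<mu> J) (v k))) \<le> (\<Sum>k\<in>UNIV. c k * real_of_int (pairing m (v k)))"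
  proof (rule sum_mono)
    fix k
    show "c k * real_of_int (pairing (\<mu> J) (v k)) \<le> c k * real_of_int (pairing m (v k))"
    proof (cases "k \<in> J")
      case True
      then have "pairing (\<mu> J) (v k) = - Poly_Mapping.lookup D k" using nef J(1) by (simp add: nef_def)
      also have "\<dots> \<le> pairing m (v k)" using m by (simp add: lattice_points_def)
      finally show ?thesis using c(1) by (intro mult_left_mono) auto
    next
      case False
      then have "c k = 0" using J(2) by blast
      then show ?thesis by simp
    qed
  qed
  then have "- real_of_int (pairing (\<mu> J) (v j)) \<le> - real_of_int (pairing m (v j))"
    by (simp only: pr)
  then have "pairing m (v j) \<le> - Poly_Mapping.lookup D j" using flat[OF J(1)] by simp
  moreover have "pairing m (v j) \<ge> - Poly_Mapping.lookup D j" using m by (simp add: lattice_points_def)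
  ultimately show ?thesis by (rule antisym)
qed

text \<open>If all vertices lay on the facets given by \<open>v j\<close>, then \<open>x\<^sub>j\<close> would not occur in any of the
  generators, and setting \<open>x\<^sub>j = 0\<close> at a point of \<open>Y\<close> would yield a point of \<open>Y\<close> outside the torus.\<close>

lemma vertices_not_flat:
  fixes p :: "'s::finite \<Rightarrow> 'q::finite_field ^ 'n"
  assumes I: "is_ideal_of \<Sigma> v (points_in_X v p) I" "I = ideal_gen (F ` N)"
    and F: "\<And>i. i \<in> N \<Longrightarrow> F i \<in> graded_piece v (div_class v (E i))"
    and nef: "\<And>i. i \<in> N \<Longrightarrow> nef (E i) (\<mu> i)"
    and ne: "\<And>s. torus_point v (alg_closure_point (p s)) \<noteq> {}"
  shows "\<exists>i\<in>N. \<exists>J\<in>top. pairing (\<mu> i J) (v j) \<noteq> - Poly_Mapping.lookup (E i) j"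
proof (rule ccontr)
  assume "\<not> ?thesis"
  then have flat: "pairing (\<mu> i J) (v j) = - Poly_Mapping.lookup (E i) j" if "i \<in> N" "J \<in> top" for i J
    using that by blast
  have Fv: "F i \<in> vars_in (UNIV - {j})" if i: "i \<in> N" for i
    unfolding vars_in_def
  proof (intro CollectI ballI subsetI)
    fix a k assume a: "a \<in> Poly_Mapping.keys (F i)" and k: "k \<in> Poly_Mapping.keys a"
    obtain m where m: "exp_divisor a = E i + char_divisor v m"
      using F[OF i] a unfolding graded_piece_iff by blast
    have e: "int (Poly_Mapping.lookup a j) = Poly_Mapping.lookup (E i) j + pairing m (v j)"
      by (metis m char_lookup exp_divisor_lookup lookup_add)
    have mem: "m \<in> lattice_points v (E i)" by (rule lattice_points_of_exponent[OF m])
    have "pairing m (v j) = - Poly_Mapping.lookup (E i) j"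
      by (rule nef_flat[OF nef[OF i] _ mem]) (rule flat[OF i])
    then have "Poly_Mapping.lookup a j = 0" using e by simp
    then show "k \<in> UNIV - {j}" using k by (auto simp: in_keys_iff)
  qed
  obtain x where x: "x \<in> torus_point v (alg_closure_point (p undefined))" using ne by blast
  have Y: "points_in_X v p = subvariety \<Sigma> v I" and hom: "homogeneous_ideal v I"
    using I(1) by (simp_all add: is_ideal_of_def)
  have "torus_point v (alg_closure_point (p undefined)) \<in> subvariety \<Sigma> v I"
    unfolding Y[symmetric] points_in_X_def by (rule rangeI)
  then have xI: "x \<in> zero_set I" using x by (auto simp: subvariety_def)
  let ?x = "upd_vec x j 0"
  have "poly_eval (F i) ?x = 0" if i: "i \<in> N" for i
  proof -
    have "poly_eval (F i) ?x = poly_eval (F i) x" by (rule poly_eval_upd_vec[OF Fv[OF i]]) simp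
    moreover have "F i \<in> I" unfolding I(2) by (rule subsetD[OF ideal_gen_superset imageI[OF i]])
    ultimately show ?thesis using xI by (simp add: zero_set_def)
  qed
  then have "?x \<in> zero_set (F ` N)" by (simp add: zero_set_def)
  then have x1: "?x \<in> zero_set I" unfolding I(2) zero_set_ideal_gen .
  \<comment> \<open>Only the coordinate \<open>j\<close> vanishes at the new point, so the point
    lies in the chart of the ray of \<open>v j\<close>.\<close>
  have x2: "?x \<notin> zero_set (irrelevant_ideal \<Sigma> v)"
  proof
    assume "?x \<in> zero_set (irrelevant_ideal \<Sigma> v)"
    then have "poly_eval (\<Prod>k\<in>{k. \<not> ray (v k) \<subseteq> ray (v j)}. cox_var k) ?x = 0"
      using v_ray[of j] unfolding irrelevant_ideal_def zero_set_ideal_gen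
      by (simp add: zero_set_def cox_var_def del: poly_eval_prod)
    then have "(\<Prod>k\<in>{k. \<not> ray (v k) \<subseteq> ray (v j)}. ?x $ k) = 0"
      by (simp only: poly_eval_prod poly_eval_cox_var)
    then obtain k where k: "\<not> ray (v k) \<subseteq> ray (v j)" "?x $ k = 0" by (auto simp: prod_zero_iff)
    then have "k \<noteq> j" by blast
    then show False using k(2) torus_point_nonzero[OF x] by simp
  qed
  have "cox_quotient v ?x \<in> points_in_X v p"
    unfolding Y by (rule quotient_in_subvariety[OF hom x1 x2])
  then obtain s where "cox_quotient v ?x = torus_point v (alg_closure_point (p s))"
    unfolding points_in_X_def by blast
  then have "?x \<in> torus_point v (alg_closure_point (p s))" using mem_cox_quotient by blast
  then have "?x $ j \<noteq> 0" by (rule torus_point_nonzero)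
  then show False by simp
qed

text \<open>\<open>torus_point\<close> is a solution set of equations, for which solvability has to
  be argued. Here it is a point of the variety, that is, an orbit, and an orbit contains its
  representative.\<close>

lemma torus_points_nonempty:
  assumes I: "is_ideal_of \<Sigma> v (points_in_X v p) I"
  shows "torus_point v (alg_closure_point (p s)) \<noteq> {}"
proof -
  have "torus_point v (alg_closure_point (p s)) \<in> points_in_X v p" by (simp add: points_in_X_def)
  then have "torus_point v (alg_closure_point (p s)) \<in> toric_variety \<Sigma> v"
    using I by (auto simp: is_ideal_of_def subvariety_def)
  then show ?thesis using mem_cox_quotient by (auto simp: toric_variety_def)
qed

text \<open>Both systems of generators span the vanishing ideal of the same points. The Hilbert
  function is computed with the regular sequence \<open>F'\<close>, and its degrees are those of
  \<open>F\<close> up to a permutation of the indices, which permutes the subsets; characters do not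
  change the counts.\<close>

lemma code_dim_formula:
  fixes p :: "'s::finite \<Rightarrow> 'q::finite_field ^ 'n" and F :: "nat \<Rightarrow> ('r, 'q alg_closure) cox_ring"
  defines "N \<equiv> {1..CARD('n)}"
  assumes ci: "complete_intersection_points \<Sigma> v (points_in_X v p)"
    and I: "is_ideal_of \<Sigma> v (points_in_X v p) I" "I = ideal_gen (F ` N)"
    and F: "\<And>i. i \<in> N \<Longrightarrow> F i \<in> graded_piece v (div_class v (E i))"
  shows "int (code_dim p D) =
    (\<Sum>K\<in>Pow N. (-1) ^ card K * int (card (lattice_points v (D - (\<Sum>i\<in>K. E i)))))"
proof -
  obtain F' where F': "regular_sequence CARD('n) F'" "\<forall>i\<in>N. homogeneous v (F' i)"
    "is_ideal_of \<Sigma> v (points_in_X v p) (ideal_gen (F' ` N))"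
    using ci unfolding complete_intersection_points_def N_def by blast
  have same: "ideal_gen (F' ` N) = ideal_gen (F ` N)"
    unfolding I(2)[symmetric] using mem_ideal_of_iff[OF I(1)] mem_ideal_of_iff[OF F'(3)] by blast
  have "\<forall>i\<in>N. \<exists>D. F' i \<in> graded_piece v (div_class v D)"
    using F'(2) unfolding homogeneous_def carrier_Cl by blast
  then obtain E' where E': "\<forall>i\<in>N. F' i \<in> graded_piece v (div_class v (E' i))" by (rule bchoice[THEN exE])
  \<comment> \<open>Extension by zero makes the sequences homogeneous at all indices, as the lemmas
    on regular sequences expect; zero has every degree.\<close>
  define H where "H i = (if i \<in> N then F i else 0)" for i
  define H' where "H' i = (if i \<in> N then F' i else 0)" for i
  have im: "H ` N = F ` N" "H' ` N = F' ` N" by (auto simp: H_def H'_def)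
  have gH: "H i \<in> graded_piece v (div_class v (E i))" for i
    using F by (simp add: H_def graded_piece_exponents)
  have gH': "H' i \<in> graded_piece v (div_class v (E' i))" for i
    using E' by (simp add: H'_def graded_piece_exponents)
  have pre: "H' ` {1..<i} = F' ` {1..<i}" "H' i = F' i" if "i \<in> N" for i
    using that by (auto simp: H'_def N_def)
  have reg: "regular_sequence CARD('n) H'"
    unfolding regular_sequence_def
  proof (intro conjI ballI allI impI)
    fix i g assume i: "i \<in> {1..CARD('n)}" and g: "g * H' i \<in> ideal_gen (H' ` {1..<i})"
    have iN: "i \<in> N" using i by (simp add: N_def)
    have "g * F' i \<in> ideal_gen (F' ` {1..<i})" using g unfolding pre[OF iN] .
    then have "g \<in> ideal_gen (F' ` {1..<i})" using F'(1) i unfolding regular_sequence_def by blast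
    then show "g \<in> ideal_gen (H' ` {1..<i})" unfolding pre[OF iN] .
  next
    show "ideal_gen (H' ` {1..CARD('n)}) \<noteq> UNIV"
      using F'(1) unfolding regular_sequence_def im(2)[unfolded N_def] by blast
  qed
  have eq: "ideal_gen (H ` {1..CARD('n)}) = ideal_gen (H' ` {1..CARD('n)})"
    using im same unfolding N_def by simp
  obtain \<pi> where \<pi>': "bij_betw \<pi> {1..CARD('n)} {1..CARD('n)}"
    "\<And>i. i \<in> {1..CARD('n)} \<Longrightarrow> div_class v (E' i) = div_class v (E (\<pi> i))"
    by (rule generator_degrees[OF gH gH' reg eq], rule that)
  note \<pi> = \<pi>'[folded N_def]
  have "int (card (lattice_points v D)) - int (cox.dim (ideal_gen (H' ` N) \<inter> graded_piece v (div_class v D)))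
     = (\<Sum>K\<in>Pow N. (-1) ^ card K * int (card (lattice_points v (D - (\<Sum>i\<in>K. E' i)))))"
    unfolding N_def by (rule hilbert_function[OF gH']) (use reg in \<open>auto simp: regular_sequence_def\<close>)
  also have "\<dots> = (\<Sum>K\<in>Pow N. (-1) ^ card (\<pi> ` K) * int (card (lattice_points v (D - (\<Sum>i\<in>\<pi> ` K. E i)))))"
  proof (rule sum.cong[OF refl])
    fix K assume K: "K \<in> Pow N"
    have inj: "inj_on \<pi> K" using bij_betw_imp_inj_on[OF \<pi>(1)] K inj_on_subset by blast
    have fin: "finite K" using K finite_subset unfolding N_def by blast
    have "\<forall>i\<in>K. \<exists>m. E' i = E (\<pi> i) + char_divisor v m"
      using \<pi>(2) K unfolding div_class_eq_iff by blast
    then obtain m where m: "\<forall>i\<in>K. E' i = E (\<pi> i) + char_divisor v (m i)" by (rule bchoice[THEN exE])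
    have "(\<Sum>i\<in>K. E' i) = (\<Sum>i\<in>K. E (\<pi> i)) + (\<Sum>i\<in>K. char_divisor v (m i))"
      using m by (simp add: sum.distrib)
    also have "(\<Sum>i\<in>K. char_divisor v (m i)) = char_divisor v (\<Sum>i\<in>K. m i)"
      using fin by (induction K rule: finite_induct) (simp_all add: char_add)
    finally have "D - (\<Sum>i\<in>K. E' i) = D - (\<Sum>i\<in>\<pi> ` K. E i) + char_divisor v (- (\<Sum>i\<in>K. m i))"
      by (simp add: sum.reindex[OF inj] char_uminus)
    from card_lattice_points_class[OF div_class_eqI[OF this]]
    show "(-1) ^ card K * int (card (lattice_points v (D - (\<Sum>i\<in>K. E' i))))
        = (-1) ^ card (\<pi> ` K) * int (card (lattice_points v (D - (\<Sum>i\<in>\<pi> ` K. E i))))"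
      by (simp only: card_image[OF inj])
  qed
  also have "\<dots> = (\<Sum>K\<in>Pow N. (-1) ^ card K * int (card (lattice_points v (D - (\<Sum>i\<in>K. E i)))))"
    by (rule sum.reindex_bij_betw[OF bij_betw_Pow[OF \<pi>(1)]])
  also have "ideal_gen (H' ` N) = I" unfolding im same I(2) ..
  finally have "int (card (lattice_points v D)) - int (cox.dim (I \<inter> graded_piece v (div_class v D)))
     = (\<Sum>K\<in>Pow N. (-1) ^ card K * int (card (lattice_points v (D - (\<Sum>i\<in>K. E i)))))" .
  moreover have "card (lattice_points v D) = code_dim p D + cox.dim (I \<inter> graded_piece v (div_class v D))"
    by (rule code_dim_hilbert[OF torus_points_nonempty[OF I(1)] mem_ideal_of_iff[OF I(1)]])
  ultimately show ?thesis by simp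
qed

text \<open>A lattice point of \<open>A - D\<close> is a translation that carries one polytope into
  the other. For the converse, the containment must control each coefficient of \<open>D\<close>;
  this needs a lattice point of \<open>D\<close> at which inequality \<open>j\<close> is an
  equality, and the hypothesis supplies it at the ray of \<open>v j\<close>.\<close>

lemma Cl_le_iff_polytope_contains:
  assumes D: "\<forall>\<sigma>\<in>\<Sigma>. \<exists>m\<in>lattice_points v D. \<forall>j\<in>cone_rays v \<sigma>. pairing m (v j) = - Poly_Mapping.lookup D j"
  shows "Cl_le v (div_class v D) (div_class v A) \<longleftrightarrow> polytope_contains v (div_class v A) (div_class v D)"
proof -
  have le: "Cl_le v (div_class v D) (div_class v A) \<longleftrightarrow> lattice_points v (A - D) \<noteq> {}"
    unfolding Cl_le_def Cl_diff_class Nbeta_iff ..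
  show ?thesis
    unfolding le
  proof
    assume "lattice_points v (A - D) \<noteq> {}"
    then obtain m where m: "m \<in> lattice_points v (A - D)" by blast
    have "Poly_Mapping.lookup D j \<le> Poly_Mapping.lookup (A + char_divisor v m) j" for j
      using m unfolding lattice_points_iff by (simp add: lookup_add lookup_minus algebra_simps)
    then have "- real_of_int (Poly_Mapping.lookup (A + char_divisor v m) j) \<le> - real_of_int (Poly_Mapping.lookup D j)" for j
      by simp
    then have "div_polytope v D \<subseteq> div_polytope v (A + char_divisor v m)"
      unfolding div_polytope_def using order_trans by blast
    moreover have "D \<in> div_class v D" unfolding mem_div_class by (rule exI[of _ 0]) simp
    moreover have "A + char_divisor v m \<in> div_class v A" unfolding mem_div_class by blast
    ultimately show "polytope_contains v (div_class v A) (div_class v D)"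
      unfolding polytope_contains_def by blast
  next
    assume "polytope_contains v (div_class v A) (div_class v D)"
    then obtain D1 D2 where D12: "D1 \<in> div_class v D" "D2 \<in> div_class v A"
      "div_polytope v D1 \<subseteq> div_polytope v D2"
      unfolding polytope_contains_def by blast
    obtain m1 where m1: "D1 = D + char_divisor v m1" using D12(1) unfolding mem_div_class by blast
    obtain m2 where m2: "D2 = A + char_divisor v m2" using D12(2) unfolding mem_div_class by blast
    note sub = D12(3)[unfolded m1 m2]
    have "0 \<le> Poly_Mapping.lookup (A - D) j + pairing (m2 - m1) (v j)" for j
    proof -
      obtain m where m: "m \<in> lattice_points v D" "pairing m (v j) = - Poly_Mapping.lookup D j"
        using D v_ray[of j] by (fastforce simp: cone_rays_def)
      have "m - m1 \<in> lattice_points v (D + char_divisor v m1)"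
        using m(1) by (simp add: lattice_points_char)
      then have "rvec (m - m1) \<in> div_polytope v (D + char_divisor v m1)"
        unfolding lattice_points_iff_real div_polytope_def by blast
      then have "rvec (m - m1) \<in> div_polytope v (A + char_divisor v m2)" using sub by blast
      then have "m - m1 \<in> lattice_points v (A + char_divisor v m2)"
        unfolding lattice_points_iff_real div_polytope_def by blast
      then have "0 \<le> Poly_Mapping.lookup A j + pairing m2 (v j) + pairing (m - m1) (v j)"
        unfolding lattice_points_iff by (simp add: lookup_add)
      then show ?thesis using m(2) by (simp add: pairing_diff lookup_minus)
    qed
    then have "m2 - m1 \<in> lattice_points v (A - D)" unfolding lattice_points_iff by blast
    then show "lattice_points v (A - D) \<noteq> {}" by blast
  qed
qed

end

theorem theorem4p5:
  fixes \<Sigma> :: "(real ^ 'n) set set"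
    and v :: "'r::finite \<Rightarrow> int ^ 'n"
    and p :: "'s::finite \<Rightarrow> 'q::finite_field ^ 'n"
    and I\<^sub>Y :: "('r, 'q alg_closure) cox_ring set"
    and F :: "nat \<Rightarrow> ('r, 'q alg_closure) cox_ring"
    and \<alpha>s :: "nat \<Rightarrow> ('r \<Rightarrow>\<^sub>0 int) set"
    and \<alpha> :: "('r \<Rightarrow>\<^sub>0 int) set"
    and F\<^sub>0 :: "('r, 'q alg_closure) cox_ring"
    and a\<^sub>0 :: "'r \<Rightarrow>\<^sub>0 nat"
  defines "n \<equiv> CARD('n)"
  assumes "complete_fan \<Sigma>" and "simplicial_fan \<Sigma>"
    and "bij_betw v UNIV (primitive_ray_generators \<Sigma>)"
    and "torsion_free (Cl v)"
    and "inj p" and "\<And>s i. p s $ i \<noteq> 0"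
    and "complete_intersection_points \<Sigma> v (points_in_X v p)"
    and "is_ideal_of \<Sigma> v (points_in_X v p) I\<^sub>Y"
    and "I\<^sub>Y = ideal_gen (F ` {1..n})"
    and "\<And>i. i \<in> {1..n} \<Longrightarrow> F i \<in> graded_piece v (\<alpha>s i)"
    and "\<And>i. i \<in> {1..n} \<Longrightarrow> semi_ample TYPE('q alg_closure) \<Sigma> v (\<alpha>s i)"
    and "\<alpha> \<in> Nbeta v"
    and "F\<^sub>0 = Poly_Mapping.single a\<^sub>0 1" and "F\<^sub>0 \<in> graded_piece v \<alpha>"
  shows
    "int (vec.dim (evaluation_code v p \<alpha> F\<^sub>0)) =
       (\<Sum>s=0..n. (-1) ^ s * (\<Sum>I\<in>{I. I \<subseteq> {1..n} \<and> card I = s}.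
          int (card (class_polytope v (Cl_diff v \<alpha> (\<Otimes>\<^bsub>Cl v\<^esub>i\<in>I. \<alpha>s i)) \<inter> lattice_M))))
     \<and> (\<forall>i\<in>{1..n}. Cl_le v (\<alpha>s i) \<alpha> \<longleftrightarrow> polytope_contains v \<alpha> (\<alpha>s i))
     \<and> ((\<forall>i\<in>{1..n}. \<not> Cl_le v (\<alpha>s i) \<alpha>) \<longrightarrow>
          vec.dim (evaluation_code v p \<alpha> F\<^sub>0) = card (class_polytope v \<alpha> \<inter> lattice_M))
     \<and> (Cl_le v (\<Otimes>\<^bsub>Cl v\<^esub>i\<in>{1..n}. \<alpha>s i) \<alpha> \<longrightarrow>
          vec.dim (evaluation_code v p \<alpha> F\<^sub>0) = card (range p) \<and> evaluation_code v p \<alpha> F\<^sub>0 = UNIV)"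
proof -
  interpret complete_simplicial \<Sigma> v
    by (intro complete_simplicial.intro assms(2-4))
  note inj = assms(6) and nz = assms(7) and ci = assms(8) and I = assms(9,10)
  let ?N = "{1..n}"
  let ?c = "\<lambda>D. int (card (lattice_points v D))"
  have "\<forall>i\<in>?N. \<exists>D. \<alpha>s i = div_class v D \<and> (\<forall>\<sigma>\<in>\<Sigma>. \<exists>m\<in>lattice_points v D.
      \<forall>j\<in>cone_rays v \<sigma>. pairing m (v j) = - Poly_Mapping.lookup D j)"
    using semi_ample_vertices[OF assms(12)] by blast
  then obtain E where E: "\<forall>i\<in>?N. \<alpha>s i = div_class v (E i) \<and> (\<forall>\<sigma>\<in>\<Sigma>. \<exists>m\<in>lattice_points v (E i).
      \<forall>j\<in>cone_rays v \<sigma>. pairing m (v j) = - Poly_Mapping.lookup (E i) j)"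
    by (rule bchoice[THEN exE])
  have Ecls: "\<alpha>s i = div_class v (E i)" if "i \<in> ?N" for i using E that by blast
  have "\<exists>\<mu>. nef (E i) \<mu>" if "i \<in> ?N" for i
  proof -
    have "\<forall>\<sigma>\<in>\<Sigma>. \<exists>m\<in>lattice_points v (E i). \<forall>j\<in>cone_rays v \<sigma>. pairing m (v j) = - Poly_Mapping.lookup (E i) j"
      using E that by blast
    from nef_vertices[OF this] show ?thesis by blast
  qed
  then have "\<forall>i\<in>?N. \<exists>\<mu>. nef (E i) \<mu>" by blast
  then obtain \<mu> where \<mu>: "\<forall>i\<in>?N. nef (E i) (\<mu> i)" by (rule bchoice[THEN exE])
  then have nef: "\<And>i. i \<in> ?N \<Longrightarrow> nef (E i) (\<mu> i)" by blast
  have F: "F i \<in> graded_piece v (div_class v (E i))" if "i \<in> ?N" for i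
    using assms(11)[OF that] Ecls[OF that] by simp
  \<comment> \<open>The representative of the class given by the monomial of the denominator; with
    it, values of the code are section values without a correction factor.\<close>
  define A where "A = exp_divisor a\<^sub>0"
  have \<alpha>: "\<alpha> = div_class v A"
    using assms(14,15) by (simp add: graded_piece_def mon_degree_class A_def)
  have ne: "torus_point v (alg_closure_point (p s)) \<noteq> {}" for s by (rule torus_points_nonempty[OF I(1)])
  let ?C = "evaluation_code v p \<alpha> F\<^sub>0"
  have C: "?C = vec.span (char_vec p ` lattice_points v A)"
    unfolding \<alpha> assms(14) A_def by (rule evaluation_code_span[OF ne])
  have dimC: "vec.dim ?C = code_dim p A" unfolding C vec.dim_span code_dim_def ..
  have formula: "int (code_dim p D) = (\<Sum>K\<in>Pow ?N. (-1) ^ card K * ?c (D - (\<Sum>i\<in>K. E i)))" for D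
    unfolding n_def
    by (rule code_dim_formula[OF ci I(1)]) (use I(2) F in \<open>auto simp: n_def\<close>)
  have prod: "(\<Otimes>\<^bsub>Cl v\<^esub>i\<in>K. \<alpha>s i) = div_class v (\<Sum>i\<in>K. E i)" if K: "K \<subseteq> ?N" for K
  proof -
    interpret Cl: comm_group "Cl v" by (rule comm_group_Cl)
    have "(\<Otimes>\<^bsub>Cl v\<^esub>i\<in>K. \<alpha>s i) = (\<Otimes>\<^bsub>Cl v\<^esub>i\<in>K. div_class v (E i))"
      using K Ecls by (intro Cl.finprod_cong') auto
    also have "\<dots> = div_class v (\<Sum>i\<in>K. E i)"
      using K finite_subset by (intro Cl_finprod) blast
    finally show ?thesis .
  qed
  have le: "Cl_le v (\<Otimes>\<^bsub>Cl v\<^esub>i\<in>K. \<alpha>s i) \<alpha> \<longleftrightarrow> lattice_points v (A - (\<Sum>i\<in>K. E i)) \<noteq> {}"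
    if "K \<subseteq> ?N" for K
    unfolding prod[OF that] \<alpha> Cl_le_def Cl_diff_class Nbeta_iff ..
  have le1: "Cl_le v (\<alpha>s i) \<alpha> \<longleftrightarrow> lattice_points v (A - E i) \<noteq> {}" if "i \<in> ?N" for i
    unfolding Ecls[OF that] \<alpha> Cl_le_def Cl_diff_class Nbeta_iff ..
  have part1: "int (vec.dim ?C) =
       (\<Sum>s=0..n. (-1) ^ s * (\<Sum>I\<in>{I. I \<subseteq> ?N \<and> card I = s}.
          int (card (class_polytope v (Cl_diff v \<alpha> (\<Otimes>\<^bsub>Cl v\<^esub>i\<in>I. \<alpha>s i)) \<inter> lattice_M))))"
  proof -
    have "(\<Sum>s=0..n. (-1) ^ s * (\<Sum>I\<in>{I. I \<subseteq> ?N \<and> card I = s}.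
          int (card (class_polytope v (Cl_diff v \<alpha> (\<Otimes>\<^bsub>Cl v\<^esub>i\<in>I. \<alpha>s i)) \<inter> lattice_M))))
        = (\<Sum>s=0..n. \<Sum>K\<in>{K \<in> Pow ?N. card K = s}. (-1) ^ card K * ?c (A - (\<Sum>i\<in>K. E i)))"
    proof (rule sum.cong[OF refl])
      fix s
      have "(\<Sum>I\<in>{I. I \<subseteq> ?N \<and> card I = s}.
          int (card (class_polytope v (Cl_diff v \<alpha> (\<Otimes>\<^bsub>Cl v\<^esub>i\<in>I. \<alpha>s i)) \<inter> lattice_M)))
          = (\<Sum>K\<in>{K \<in> Pow ?N. card K = s}. ?c (A - (\<Sum>i\<in>K. E i)))"
        by (rule sum.cong) (auto simp: prod \<alpha> Cl_diff_class card_class_polytope)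
      then show "(-1) ^ s * (\<Sum>I\<in>{I. I \<subseteq> ?N \<and> card I = s}.
          int (card (class_polytope v (Cl_diff v \<alpha> (\<Otimes>\<^bsub>Cl v\<^esub>i\<in>I. \<alpha>s i)) \<inter> lattice_M)))
          = (\<Sum>K\<in>{K \<in> Pow ?N. card K = s}. (-1) ^ card K * ?c (A - (\<Sum>i\<in>K. E i)))"
        by (simp add: sum_distrib_left)
    qed
    also have "\<dots> = (\<Sum>K\<in>Pow ?N. (-1) ^ card K * ?c (A - (\<Sum>i\<in>K. E i)))"
    proof (rule sum.group)
      show "card ` Pow ?N \<subseteq> {0..n}" using card_mono[of ?N] by fastforce
    qed auto
    finally show ?thesis unfolding dimC formula by (rule sym)
  qed
  have part2: "Cl_le v (\<alpha>s i) \<alpha> \<longleftrightarrow> polytope_contains v \<alpha> (\<alpha>s i)" if i: "i \<in> ?N" for i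
  proof -
    have "\<forall>\<sigma>\<in>\<Sigma>. \<exists>m\<in>lattice_points v (E i). \<forall>j\<in>cone_rays v \<sigma>. pairing m (v j) = - Poly_Mapping.lookup (E i) j"
      using E i by blast
    then show ?thesis unfolding Ecls[OF i] \<alpha> by (rule Cl_le_iff_polytope_contains)
  qed
  have part3: "vec.dim ?C = card (class_polytope v \<alpha> \<inter> lattice_M)"
    if no: "\<forall>i\<in>?N. \<not> Cl_le v (\<alpha>s i) \<alpha>"
  proof -
    have E_ne: "\<exists>m. m \<in> lattice_points v (E i)" if "i \<in> ?N" for i
    proof -
      obtain J where "J \<in> top" using top_nonempty by blast
      then show ?thesis using nef[OF that] by (auto simp: nef_def)
    qed
    \<comment> \<open>If \<alpha> - \<alpha>_K had an effective representative, adding lattice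
      points for all indices of \<open>K\<close> except \<open>i\<close> would give one of \<alpha>
      - \<alpha>_i. Hence only the empty subset contributes to the alternating sum.\<close>
    have empty: "lattice_points v (A - (\<Sum>i\<in>K. E i)) = {}" if K: "K \<subseteq> ?N" "K \<noteq> {}" for K
    proof (rule ccontr)
      assume "lattice_points v (A - (\<Sum>i\<in>K. E i)) \<noteq> {}"
      then obtain m where m: "m \<in> lattice_points v (A - (\<Sum>i\<in>K. E i))" by blast
      obtain i where i: "i \<in> K" using K(2) by blast
      have fin: "finite K" using K(1) finite_subset by blast
      have "\<forall>k\<in>K - {i}. \<exists>m. m \<in> lattice_points v (E k)" using E_ne K(1) by blast
      then obtain g where "\<forall>k\<in>K - {i}. g k \<in> lattice_points v (E k)" by (rule bchoice[THEN exE])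
      then have "(\<Sum>k\<in>K - {i}. g k) \<in> lattice_points v (\<Sum>k\<in>K - {i}. E k)"
        by (intro lattice_points_sum) blast
      from lattice_points_add[OF m this]
      have "m + (\<Sum>k\<in>K - {i}. g k) \<in> lattice_points v (A - E i)"
        using sum.remove[OF fin i, of E] by simp
      then show False using no le1[of i] i K(1) by blast
    qed
    have "int (code_dim p A) = (\<Sum>K\<in>Pow ?N. if K = {} then ?c A else 0)"
      unfolding formula by (rule sum.cong[OF refl]) (use empty in auto)
    then have "code_dim p A = card (lattice_points v A)" by simp
    then show ?thesis unfolding dimC unfolding \<alpha> card_class_polytope .
  qed
  have part4: "vec.dim ?C = card (range p) \<and> ?C = UNIV" if big: "Cl_le v (\<Otimes>\<^bsub>Cl v\<^esub>i\<in>?N. \<alpha>s i) \<alpha>"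
  proof -
    define G where "G = (\<Sum>i\<in>?N. E i)"
    have nefG: "nef G (\<lambda>J. \<Sum>i\<in>?N. \<mu> i J)" unfolding G_def by (rule nef_sum[OF nef])
    have int: "\<exists>J\<in>top. pairing (\<Sum>i\<in>?N. \<mu> i J) (v j) \<noteq> - Poly_Mapping.lookup G j" for j
    proof -
      obtain i J where iJ: "i \<in> ?N" "J \<in> top" "pairing (\<mu> i J) (v j) \<noteq> - Poly_Mapping.lookup (E i) j"
      proof -
        have "\<exists>i\<in>?N. \<exists>J\<in>top. pairing (\<mu> i J) (v j) \<noteq> - Poly_Mapping.lookup (E i) j"
          by (rule vertices_not_flat[OF I]) (use F nef ne in auto)
        then show thesis using that by blast
      qed
      \<comment> \<open>One generator whose vertex lies off the facet is enough, because the others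
        contribute nonnegatively at the same maximal cone.\<close>
      have nn: "0 \<le> Poly_Mapping.lookup (E k) j + pairing (\<mu> k J) (v j)" if "k \<in> ?N" for k
        using nef[OF that] iJ(2) unfolding nef_def lattice_points_iff by blast
      have "0 < Poly_Mapping.lookup (E i) j + pairing (\<mu> i J) (v j)" using nn[OF iJ(1)] iJ(3) by linarith
      then have "0 < (\<Sum>k\<in>?N. Poly_Mapping.lookup (E k) j + pairing (\<mu> k J) (v j))"
        using iJ(1) nn by (intro sum_pos2[of ?N i]) auto
      then have "pairing (\<Sum>i\<in>?N. \<mu> i J) (v j) \<noteq> - Poly_Mapping.lookup G j"
        by (simp add: G_def pairing_sum lookup_sum sum.distrib)
      then show ?thesis using iJ(2) by blast
    qed
    obtain k :: nat where k: "k \<ge> 1" "code_dim p (\<Sum>i<k. G) = CARD('s)"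
      using code_dim_multiple_full[OF inj nz nefG int] by blast
    have "int (code_dim p (\<Sum>i<k. G)) = int (code_dim p G)"
      unfolding formula unfolding G_def
      by (rule mixed_sum_shift[OF nef _ k(1)]) (simp_all add: n_def)
    then have "code_dim p G = CARD('s)" using k(2) by simp
    moreover have "code_dim p G \<le> code_dim p A"
      using big le[OF order_refl] unfolding G_def by (intro code_dim_mono nz) simp
    ultimately have full: "vec.dim ?C = CARD('s)" using code_dim_le[of p A] dimC by simp
    have "?C = UNIV"
    proof (rule vec.subspace_dim_equal)
      show "vec.subspace ?C" unfolding C by (rule vec.subspace_span)
      show "vec.dim (UNIV :: ('q ^ 's) set) \<le> vec.dim ?C" unfolding full vec_dim_card ..
    qed simp_all
    then show ?thesis using full card_image[OF inj] by simp
  qed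
  show ?thesis using part1 part2 part3 part4 by blast
qed

end
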